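(* Let $n\ge 1$, $\epsilon\in\{+,-\}$, and let $\Gamma$ be a code in $J(\mathcal{Q}^\epsilon,k)$ for some $k$ with $1<k<|\mathcal{Q}^\epsilon|-1$. Suppose that $X=\mathrm{Sp}_{2n}(2)\le \mathrm{Aut}(\Gamma)\cap\mathrm{Sym}(\mathcal{Q}^\epsilon)$ (with $X$ acting on $\mathcal{Q}^\epsilon$ by $\phi^g(x)=\phi(xg^{-1})$), that $\Gamma$ is $X$-strongly incidence-transitive, and that the stabiliser $X_\Delta$ of a codeword $\Delta\in\Gamma$ is a geometric subgroup of $X$. Then $\Gamma$ is one of the codes $\Gamma(n,d,\epsilon,\epsilon')$ (for some $d$ and sign $\epsilon'$ satisfying the conditions of that construction) or $\Gamma(n,d,\epsilon,\delta)$ (for some $d$ and $\delta\in\{0,1\}$ satisfying the conditions of that construction), as defined in the context.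
   Context: Let $V=\mathbb{F}_2^{2n}$ with a symplectic (nondegenerate alternating bilinear) form $B$, and $X=\mathrm{Sp}_{2n}(2)$ the group of $g\in\mathrm{GL}(V)$ with $B(ug,vg)=B(u,v)$ (maps act on the right). $\mathcal{Q}$ is the set of quadratic forms $\phi:V\to\mathbb{F}_2$ with $\phi(x+y)+\phi(x)+\phi(y)=B(x,y)$ for all $x,y$; $\mathcal{Q}^\epsilon$ ($\epsilon\in\{+,-\}$) is the set of those of type $\epsilon$ (hyperbolic/elliptic). Signs are identified with $\pm1$ in arithmetic, so $|\mathcal{Q}^\epsilon|=2^{n-1}(2^n+\epsilon)$, and $\epsilon\epsilon'$ is the product sign. $X$ acts on $\mathcal{Q}^\epsilon$ by $\phi^g(x)=\phi(xg^{-1})$. For a subspace $U$, $U^\perp$ is its $B$-orthogonal complement; $U$ is nondegenerate if $U\cap U^\perp=0$, totally isotropic if $U\le U^\perp$; $\phi_U$ is the restriction of $\phi$ to $U$; $\mathrm{Sing}(\phi)=\{x:\phi(x)=0\}$; $X_U$ is the setwise stabiliser of $U$. Johnson graph $J(\mathcal V,k)$: vertices are $k$-subsets of the finite set $\mathcal V$, adjacent iff they meet in $k-1$ points. A code is a nonempty set $\Gamma$ of vertices (codewords); $\mathrm{Aut}(\Gamma)$ is the group of graph automorphisms preserving $\Gamma$. For $G\le\mathrm{Aut}(\Gamma)\cap\mathrm{Sym}(\mathcal V)$, $\Gamma$ is $G$-strongly incidence-transitive if $G$ is transitive on $\Gamma$ and for each $\Delta\in\Gamma$, $G_\Delta$ is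 transitive on $\Delta\times(\mathcal V\setminus\Delta)$. Code $\Gamma(n,d,\epsilon,\epsilon')$ (fourth parameter a sign): for $n\ge2$, $1\le d\le n-1$, $\epsilon,\epsilon'\in\{+,-\}$, $(n,d,\epsilon)\ne(2,1,+)$, it is the code in $J(\mathcal{Q}^\epsilon,k)$ with $k=2^{n-2}(2^d+\epsilon')(2^{n-d}+\epsilon\epsilon')$ whose codewords are $\Delta(U)=\{\phi\in\mathcal{Q}^\epsilon:\phi_U\text{ has type }\epsilon'\text{ and }\phi_{U^\perp}\text{ has type }\epsilon\epsilon'\}$, one for each nondegenerate $2d$-dimensional subspace $U$. Code $\Gamma(n,d,\epsilon,\delta)$ (fourth parameter $\delta\in\{0,1\}$): for $n\ge2$, $1\le d\le n$, $(d,\epsilon)\neq(n,-)$, it is the code in $J(\mathcal{Q}^\epsilon,k)$ with $k=2^{n-1}(2^{n-d}+\epsilon)$ if $\delta=0$ and $k=2^{2n-d-1}(2^d-1)$ if $\delta=1$, whose codewords are $\Delta^\delta(U)=\{\phi\in\mathcal{Q}^\epsilon:\dim(\mathrm{Sing}(\phi)\cap U)=d-\delta\}$, one for each totally isotropic $d$-dimensional subspace $U$. A geometric subgroup of $X$ is a subgroup contained in one of the following subgroups: (a) $X_U$ for $U$ nondegenerate of dimension $2d$, $1\le d\le (n-1)/2$; (b) $X_U$ for $U$ totally isotropic of dimension $d$, $1\le d\le n$; (c) the stabiliser of a decomposition $V=V_1\oplus\cdots\oplus V_t$ into pairwise orthogonal nondegenerate subspaces of dimension $2m$ with $m=n/t<n$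 (isomorphic to $\mathrm{Sp}_{2m}(2)\wr S_t$); (d) for a prime $b$ with $n=mb$, viewing $V$ as the $\mathbb{F}_2$-space underlying a $2m$-dimensional $\mathbb{F}_{2^b}$-space $W$ carrying a symplectic form $\tilde B$ with $B=\mathrm{Tr}\circ\tilde B$ ($\mathrm{Tr}$ the absolute trace $\mathbb{F}_{2^b}\to\mathbb{F}_2$), the group of all additive bijections $g$ of $W$ such that for some field automorphism $\sigma$, $(\alpha w)g=\alpha^\sigma(wg)$ and $\tilde B(ug,vg)=\tilde B(u,v)^\sigma$ (isomorphic to $\mathrm{Sp}_{2m}(2^b)\rtimes C_b$); (e) the stabiliser $X_\psi$ of some $\psi\in\mathcal{Q}$ (isomorphic to $\mathrm{O}^{\pm}_{2n}(2)$). *)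

theory Defs
  imports
    "HOL-Analysis.Cartesian_Space"
    "HOL-Library.Z2"
    "HOL-Computational_Algebra.Primes"
    "HOL-Algebra.Module"
    "HOL-Algebra.QuotRing"
    "HOL-Algebra.Bij"
begin

text \<open>
  The space \<open>V\<close> is \<^typ>\<open>bit ^ 'm\<close>, of dimension \<open>CARD('m)\<close> over the two-element
  field \<^typ>\<open>bit\<close>. Signs are the integers \<open>1\<close> and \<open>-1\<close>.
\<close>

section \<open>Symplectic and quadratic forms\<close>

definition bilinear_form :: "(bit ^ 'm \<Rightarrow> bit ^ 'm \<Rightarrow> bit) \<Rightarrow> bool" where
  "bilinear_form B \<longleftrightarrow>
     (\<forall>u. Vector_Spaces.linear (*s) (*) (\<lambda>v. B u v)) \<and>
     (\<forall>v. Vector_Spaces.linear (*s) (*) (\<lambda>u. B u v))"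

definition symplectic_form :: "(bit ^ 'm \<Rightarrow> bit ^ 'm \<Rightarrow> bit) \<Rightarrow> bool" where
  "symplectic_form B \<longleftrightarrow> bilinear_form B \<and> (\<forall>u. B u u = 0) \<and>
     (\<forall>u. (\<forall>v. B u v = 0) \<longrightarrow> u = 0)"

definition perp :: "(bit ^ 'm \<Rightarrow> bit ^ 'm \<Rightarrow> bit) \<Rightarrow> (bit ^ 'm) set \<Rightarrow> (bit ^ 'm) set" where
  "perp B U = {v. \<forall>u\<in>U. B u v = 0}"

definition nondegenerate_subspace ::
  "(bit ^ 'm \<Rightarrow> bit ^ 'm \<Rightarrow> bit) \<Rightarrow> (bit ^ 'm) set \<Rightarrow> bool" where
  "nondegenerate_subspace B U \<longleftrightarrow> vec.subspace U \<and> U \<inter> perp B U = {0}"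

definition totally_isotropic ::
  "(bit ^ 'm \<Rightarrow> bit ^ 'm \<Rightarrow> bit) \<Rightarrow> (bit ^ 'm) set \<Rightarrow> bool" where
  "totally_isotropic B U \<longleftrightarrow> vec.subspace U \<and> U \<subseteq> perp B U"

definition quadratic_form :: "(bit ^ 'm \<Rightarrow> bit) \<Rightarrow> bool" where
  "quadratic_form \<phi> \<longleftrightarrow> (\<forall>a x. \<phi> (a *s x) = a\<^sup>2 * \<phi> x) \<and>
     bilinear_form (\<lambda>x y. \<phi> (x + y) - \<phi> x - \<phi> y)"

definition forms :: "(bit ^ 'm \<Rightarrow> bit ^ 'm \<Rightarrow> bit) \<Rightarrow> (bit ^ 'm \<Rightarrow> bit) set" where
  "forms B = {\<phi>. quadratic_form \<phi> \<and> (\<forall>x y. \<phi> (x + y) + \<phi> x + \<phi> y = B x y)}"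

definition Sing :: "(bit ^ 'm \<Rightarrow> bit) \<Rightarrow> (bit ^ 'm) set" where
  "Sing \<phi> = {x. \<phi> x = 0}"

definition witt_index :: "(bit ^ 'm \<Rightarrow> bit) \<Rightarrow> (bit ^ 'm) set \<Rightarrow> nat" where
  "witt_index \<phi> U = Max {vec.dim W | W. vec.subspace W \<and> W \<subseteq> U \<and> W \<subseteq> Sing \<phi>}"

text \<open>
  The restriction of \<open>\<phi>\<close> to a nondegenerate subspace \<open>U\<close> of dimension \<open>2 r\<close> is hyperbolic
  (sign \<open>1\<close>) if its Witt index is \<open>r\<close> and elliptic (sign \<open>-1\<close>) if its Witt index is \<open>r - 1\<close>.
\<close>

definition has_type :: "(bit ^ 'm \<Rightarrow> bit) \<Rightarrow> (bit ^ 'm) set \<Rightarrow> int \<Rightarrow> bool" where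
  "has_type \<phi> U \<epsilon> \<longleftrightarrow>
     \<epsilon> = 1 \<and> vec.dim U = 2 * witt_index \<phi> U \<or>
     \<epsilon> = -1 \<and> vec.dim U = 2 * (witt_index \<phi> U + 1)"

definition forms_of_type ::
  "(bit ^ 'm \<Rightarrow> bit ^ 'm \<Rightarrow> bit) \<Rightarrow> int \<Rightarrow> (bit ^ 'm \<Rightarrow> bit) set" where
  "forms_of_type B \<epsilon> = {\<phi> \<in> forms B. has_type \<phi> UNIV \<epsilon>}"


section \<open>The symplectic group and its action on quadratic forms\<close>

text \<open>Maps act on the right, so the product of \<open>g\<close> and \<open>h\<close> applies \<open>g\<close> first.\<close>

definition Sp :: "(bit ^ 'm \<Rightarrow> bit ^ 'm \<Rightarrow> bit) \<Rightarrow> (bit ^ 'm \<Rightarrow> bit ^ 'm) monoid" where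
  "Sp B = \<lparr>carrier = {g. Vector_Spaces.linear (*s) (*s) g \<and> bij g \<and>
                         (\<forall>u v. B (g u) (g v) = B u v)},
           mult = (\<lambda>g h. h \<circ> g), one = id\<rparr>"

definition form_act ::
  "(bit ^ 'm \<Rightarrow> bit ^ 'm) \<Rightarrow> (bit ^ 'm \<Rightarrow> bit) \<Rightarrow> (bit ^ 'm \<Rightarrow> bit)" where
  "form_act g \<phi> = (\<lambda>x. \<phi> (inv_into UNIV g x))"

definition Sp_perms ::
  "(bit ^ 'm \<Rightarrow> bit ^ 'm \<Rightarrow> bit) \<Rightarrow> int \<Rightarrow> ((bit ^ 'm \<Rightarrow> bit) \<Rightarrow> (bit ^ 'm \<Rightarrow> bit)) set" where
  "Sp_perms B \<epsilon> = (\<lambda>g. restrict (form_act g) (forms_of_type B \<epsilon>)) ` carrier (Sp B)"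

definition subspace_stabiliser ::
  "(bit ^ 'm \<Rightarrow> bit ^ 'm \<Rightarrow> bit) \<Rightarrow> (bit ^ 'm) set \<Rightarrow> (bit ^ 'm \<Rightarrow> bit ^ 'm) set" where
  "subspace_stabiliser B U = {g \<in> carrier (Sp B). g ` U = U}"

definition form_stabiliser ::
  "(bit ^ 'm \<Rightarrow> bit ^ 'm \<Rightarrow> bit) \<Rightarrow> (bit ^ 'm \<Rightarrow> bit) \<Rightarrow> (bit ^ 'm \<Rightarrow> bit ^ 'm) set" where
  "form_stabiliser B \<psi> = {g \<in> carrier (Sp B). form_act g \<psi> = \<psi>}"

definition codeword_stabiliser ::
  "(bit ^ 'm \<Rightarrow> bit ^ 'm \<Rightarrow> bit) \<Rightarrow> (bit ^ 'm \<Rightarrow> bit) set \<Rightarrow> (bit ^ 'm \<Rightarrow> bit ^ 'm) set" where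
  "codeword_stabiliser B \<Delta> = {g \<in> carrier (Sp B). form_act g ` \<Delta> = \<Delta>}"


section \<open>Geometric subgroups\<close>

definition orthogonal_decomposition ::
  "(bit ^ 'm \<Rightarrow> bit ^ 'm \<Rightarrow> bit) \<Rightarrow> nat \<Rightarrow> nat \<Rightarrow> (bit ^ 'm) set set \<Rightarrow> bool" where
  "orthogonal_decomposition B m t D \<longleftrightarrow> finite D \<and> card D = t \<and>
     (\<forall>W\<in>D. nondegenerate_subspace B W \<and> vec.dim W = 2 * m) \<and>
     (\<forall>W\<in>D. \<forall>W'\<in>D. W \<noteq> W' \<longrightarrow> W' \<subseteq> perp B W) \<and>
     (\<forall>v. \<exists>!f. f \<in> (\<Pi>\<^sub>E W\<in>D. W) \<and> (\<Sum>W\<in>D. f W) = v)"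

definition decomposition_stabiliser ::
  "(bit ^ 'm \<Rightarrow> bit ^ 'm \<Rightarrow> bit) \<Rightarrow> (bit ^ 'm) set set \<Rightarrow> (bit ^ 'm \<Rightarrow> bit ^ 'm) set" where
  "decomposition_stabiliser B D = {g \<in> carrier (Sp B). (\<lambda>W. g ` W) ` D = D}"

text \<open>
  A structure of vector space over a field \<open>K\<close> on the additive group of \<open>V\<close>. The module
  axioms do not involve the multiplicative part of the record. If \<open>K\<close> has order \<open>2 ^ b\<close>
  and \<open>V\<close> has dimension \<open>2 m b\<close> over \<^typ>\<open>bit\<close>, then the dimension over \<open>K\<close> is \<open>2 m\<close>.
\<close>

definition scalar_structure :: "nat ring \<Rightarrow> (nat \<Rightarrow> bit ^ 'm \<Rightarrow> bit ^ 'm) \<Rightarrow> bool" where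
  "scalar_structure K s \<longleftrightarrow> Ring.field K \<and>
     Module.module K \<lparr>carrier = UNIV, mult = undefined, one = undefined,
                      zero = 0, add = (+), smult = s\<rparr>"

definition symplectic_form_over ::
  "nat ring \<Rightarrow> (nat \<Rightarrow> bit ^ 'm \<Rightarrow> bit ^ 'm) \<Rightarrow> (bit ^ 'm \<Rightarrow> bit ^ 'm \<Rightarrow> nat) \<Rightarrow> bool" where
  "symplectic_form_over K s C \<longleftrightarrow>
     (\<forall>u v. C u v \<in> carrier K) \<and>
     (\<forall>u u' v. C (u + u') v = C u v \<oplus>\<^bsub>K\<^esub> C u' v) \<and>
     (\<forall>u v v'. C u (v + v') = C u v \<oplus>\<^bsub>K\<^esub> C u v') \<and>
     (\<forall>a\<in>carrier K. \<forall>u v. C (s a u) v = a \<otimes>\<^bsub>K\<^esub> C u v \<and> C u (s a v) = a \<otimes>\<^bsub>K\<^esub> C u v) \<and>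
     (\<forall>u. C u u = \<zero>\<^bsub>K\<^esub>) \<and>
     (\<forall>u. (\<forall>v. C u v = \<zero>\<^bsub>K\<^esub>) \<longrightarrow> u = 0)"

text \<open>The trace from a field of order \<open>2 ^ b\<close> takes values in the prime field inside \<open>K\<close>.\<close>

definition abs_trace :: "nat ring \<Rightarrow> nat \<Rightarrow> nat \<Rightarrow> nat" where
  "abs_trace K b x = (\<Oplus>\<^bsub>K\<^esub>i\<in>{..<b}. x [^]\<^bsub>K\<^esub> ((2::nat) ^ i))"

definition bit_embed :: "nat ring \<Rightarrow> bit \<Rightarrow> nat" where
  "bit_embed K c = (if c = 0 then \<zero>\<^bsub>K\<^esub> else \<one>\<^bsub>K\<^esub>)"

text \<open>
  Every field of order \<open>2 ^ b\<close> is isomorphic to one with carrier in \<^typ>\<open>nat\<close>, so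
  quantifying over \<^typ>\<open>nat ring\<close> covers all extension field structures on \<open>V\<close>.
\<close>

definition field_extension_structure ::
  "(bit ^ 'm \<Rightarrow> bit ^ 'm \<Rightarrow> bit) \<Rightarrow> nat \<Rightarrow> nat ring \<Rightarrow> (nat \<Rightarrow> bit ^ 'm \<Rightarrow> bit ^ 'm) \<Rightarrow>
   (bit ^ 'm \<Rightarrow> bit ^ 'm \<Rightarrow> nat) \<Rightarrow> bool" where
  "field_extension_structure B b K s C \<longleftrightarrow>
     scalar_structure K s \<and> card (carrier K) = 2 ^ b \<and> symplectic_form_over K s C \<and>
     (\<forall>u v. bit_embed K (B u v) = abs_trace K b (C u v))"

definition semilinear_group ::
  "nat ring \<Rightarrow> (nat \<Rightarrow> bit ^ 'm \<Rightarrow> bit ^ 'm) \<Rightarrow> (bit ^ 'm \<Rightarrow> bit ^ 'm \<Rightarrow> nat) \<Rightarrow>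
   (bit ^ 'm \<Rightarrow> bit ^ 'm) set" where
  "semilinear_group K s C = {g. bij g \<and> (\<forall>u v. g (u + v) = g u + g v) \<and>
     (\<exists>\<sigma>\<in>ring_iso K K. (\<forall>a\<in>carrier K. \<forall>w. g (s a w) = s (\<sigma> a) (g w)) \<and>
                       (\<forall>u v. C (g u) (g v) = \<sigma> (C u v)))}"

definition geometric_subgroup ::
  "nat \<Rightarrow> (bit ^ 'm \<Rightarrow> bit ^ 'm \<Rightarrow> bit) \<Rightarrow> (bit ^ 'm \<Rightarrow> bit ^ 'm) set \<Rightarrow> bool" where
  "geometric_subgroup n B H \<longleftrightarrow> subgroup H (Sp B) \<and>
     ((\<exists>d U. 1 \<le> d \<and> 2 * d \<le> n - 1 \<and> nondegenerate_subspace B U \<and> vec.dim U = 2 * d \<and>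
         H \<subseteq> subspace_stabiliser B U) \<or>
      (\<exists>d U. 1 \<le> d \<and> d \<le> n \<and> totally_isotropic B U \<and> vec.dim U = d \<and>
         H \<subseteq> subspace_stabiliser B U) \<or>
      (\<exists>m t D. n = m * t \<and> m < n \<and> orthogonal_decomposition B m t D \<and>
         H \<subseteq> decomposition_stabiliser B D) \<or>
      (\<exists>m b K s C. Factorial_Ring.prime b \<and> n = m * b \<and> field_extension_structure B b K s C \<and>
         H \<subseteq> semilinear_group K s C) \<or>
      (\<exists>\<psi>\<in>forms B. H \<subseteq> form_stabiliser B \<psi>))"


section \<open>Codes in Johnson graphs\<close>

definition johnson_vertices :: "'v set \<Rightarrow> nat \<Rightarrow> 'v set set" where
  "johnson_vertices S k = {\<Delta>. \<Delta> \<subseteq> S \<and> finite \<Delta> \<and> card \<Delta> = k}"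

definition johnson_adj :: "nat \<Rightarrow> 'v set \<Rightarrow> 'v set \<Rightarrow> bool" where
  "johnson_adj k \<Delta> \<Delta>' \<longleftrightarrow> card (\<Delta> \<inter> \<Delta>') + 1 = k"

definition johnson_code :: "'v set \<Rightarrow> nat \<Rightarrow> 'v set set \<Rightarrow> bool" where
  "johnson_code S k \<Gamma> \<longleftrightarrow> \<Gamma> \<noteq> {} \<and> \<Gamma> \<subseteq> johnson_vertices S k"

definition johnson_aut :: "'v set \<Rightarrow> nat \<Rightarrow> ('v set \<Rightarrow> 'v set) set" where
  "johnson_aut S k = {f \<in> Bij (johnson_vertices S k).
     \<forall>\<Delta>\<in>johnson_vertices S k. \<forall>\<Delta>'\<in>johnson_vertices S k.
       johnson_adj k (f \<Delta>) (f \<Delta>') \<longleftrightarrow> johnson_adj k \<Delta> \<Delta>'}"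

definition code_aut :: "'v set \<Rightarrow> nat \<Rightarrow> 'v set set \<Rightarrow> ('v set \<Rightarrow> 'v set) set" where
  "code_aut S k \<Gamma> = {f \<in> johnson_aut S k. f ` \<Gamma> = \<Gamma>}"

text \<open>
  The intersection of \<open>Aut(\<Gamma>)\<close> and \<open>Sym(S)\<close>, where a permutation of \<open>S\<close> is identified with
  the map that it induces on the \<open>k\<close>-subsets of \<open>S\<close>.
\<close>

definition code_aut_sym :: "'v set \<Rightarrow> nat \<Rightarrow> 'v set set \<Rightarrow> ('v \<Rightarrow> 'v) set" where
  "code_aut_sym S k \<Gamma> =
     {p \<in> Bij S. restrict (\<lambda>\<Delta>. p ` \<Delta>) (johnson_vertices S k) \<in> code_aut S k \<Gamma>}"

definition strongly_incidence_transitive ::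
  "'v set \<Rightarrow> ('v \<Rightarrow> 'v) set \<Rightarrow> 'v set set \<Rightarrow> bool" where
  "strongly_incidence_transitive S G \<Gamma> \<longleftrightarrow>
     (\<forall>\<Delta>\<in>\<Gamma>. \<forall>\<Delta>'\<in>\<Gamma>. \<exists>g\<in>G. g ` \<Delta> = \<Delta>') \<and>
     (\<forall>\<Delta>\<in>\<Gamma>. \<forall>(a, c)\<in>\<Delta> \<times> (S - \<Delta>). \<forall>(a', c')\<in>\<Delta> \<times> (S - \<Delta>).
        \<exists>g\<in>G. g ` \<Delta> = \<Delta> \<and> g a = a' \<and> g c = c')"


section \<open>The two families of codes\<close>

definition nondegenerate_code ::
  "(bit ^ 'm \<Rightarrow> bit ^ 'm \<Rightarrow> bit) \<Rightarrow> nat \<Rightarrow> int \<Rightarrow> int \<Rightarrow> (bit ^ 'm \<Rightarrow> bit) set set" where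
  "nondegenerate_code B d \<epsilon> \<epsilon>' =
     {{\<phi> \<in> forms_of_type B \<epsilon>. has_type \<phi> U \<epsilon>' \<and> has_type \<phi> (perp B U) (\<epsilon> * \<epsilon>')} | U.
        nondegenerate_subspace B U \<and> vec.dim U = 2 * d}"

text \<open>
  For \<open>U\<close> totally isotropic, \<open>\<phi>\<close> is linear on \<open>U\<close>, so that \<open>Sing \<phi> \<inter> U\<close> is a subspace.
\<close>

definition isotropic_code ::
  "(bit ^ 'm \<Rightarrow> bit ^ 'm \<Rightarrow> bit) \<Rightarrow> nat \<Rightarrow> int \<Rightarrow> nat \<Rightarrow> (bit ^ 'm \<Rightarrow> bit) set set" where
  "isotropic_code B d \<epsilon> \<delta> =
     {{\<phi> \<in> forms_of_type B \<epsilon>. vec.dim (Sing \<phi> \<inter> U) = d - \<delta>} | U.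
        totally_isotropic B U \<and> vec.dim U = d}"

end

theory Submission
  imports Defs
begin

text \<open>
  Write \<open>H\<close> for the stabiliser of the codeword \<open>\<Delta>\<close>. The forms polarising to \<open>B\<close> are an affine
  space over \<open>V\<close>, with \<open>\<phi> + v\<close> given by \<open>\<phi> x + B x v\<close>, and the transvection of a nonzero vector \<open>v\<close>
  interchanges \<open>\<phi>\<close> and \<open>\<phi> + v\<close> when both have the same type and fixes \<open>\<phi>\<close> otherwise. Hence a
  transvection lies outside \<open>H\<close> exactly if its vector is the difference of a form in \<open>\<Delta>\<close> and a form
  of type \<open>\<epsilon>\<close> outside \<open>\<Delta>\<close>, and transitivity of \<open>H\<close> on such pairs makes these vectors a single
  \<open>H\<close>-orbit. By Brauer's permutation lemma \<open>H\<close> has at least three orbits on \<open>V\<close>, so it contains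
  transvections, which excludes field extension subgroups. In every other geometric subgroup it is
  clear which transvections do not belong to it, and the orbit property then forces all remaining
  transvections into \<open>H\<close>; following the forms along these transvections determines \<open>\<Delta>\<close>.

  Types are recognised by the sum of the signs \<open>(-1)\<close> to the power \<open>\<phi> x\<close>, which is \<open>\<plusminus>2 ^ r\<close> on a
  nondegenerate space of dimension \<open>2 r\<close>.
\<close>


text \<open>By transitivity \<open>\<Gamma>\<close> is the orbit of \<open>\<Delta>\<close>, so a
  single codeword has to be identified; Witt's theorem turns the families indexed by subspaces into
  orbits as well. Two geometric cases resist the general pattern. If no form of type
  \<open>\<epsilon>\<close> vanishes on a totally isotropic \<open>U\<close> (dimension
  \<open>n\<close>, elliptic type), the code belongs not to \<open>U\<close> but to a proper
  subspace of it, which is recovered from the way the restrictions to \<open>U\<close> are divided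
  between \<open>\<Delta>\<close> and its complement. For the stabiliser of a form
  \<open>\<psi>\<close>, the forms of type \<open>\<epsilon>\<close> become the vectors on which
  \<open>\<psi>\<close> is 1, joined when they are not orthogonal, and \<open>\<Delta>\<close> is a
  union of components of this graph. The graph is disconnected only for the hyperbolic form in
  dimension 4, where it consists of two triangles; one triangle spans the nondegenerate plane of the
  code. Sums of signs are convenient because they are multiplicative over orthogonal sums and change
  by an explicit sign under translation, which serves the stabiliser arguments and the counting
  alike.\<close>

declare add_bit_eq_xor [simp del] mult_bit_eq_and [simp del]

section \<open>Vectors over the two-element field\<close>

lemma bit_add_self [simp]: "a + a = (0 :: bit)" "a + (a + b) = (b :: bit)"
  by (cases a; cases b; simp)+

lemma bit_vec_add_self [simp]: "x + x = (0 :: bit ^ 'm)" "x + (x + y) = (y :: bit ^ 'm)"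
  by (simp_all add: vec_eq_iff)

lemma bit_vec_add_eq_0_iff [simp]: "x + y = 0 \<longleftrightarrow> x = (y :: bit ^ 'm)"
  by (metis bit_vec_add_self(2) add.right_neutral bit_vec_add_self(1))

lemma bit_vec_diff [simp]: "x - y = x + (y :: bit ^ 'm)"
  by (simp add: vec_eq_iff)

lemma bit_scale: "a *s x = (if a = 0 then 0 else (x :: bit ^ 'm))"
  by (cases a) simp_all

lemma bit_subspace_iff:
  "vec.subspace (U :: (bit ^ 'm) set) \<longleftrightarrow> 0 \<in> U \<and> (\<forall>x\<in>U. \<forall>y\<in>U. x + y \<in> U)"
  by (auto simp: vec.subspace_def bit_scale)

lemma bit_subspace_add_iff:
  assumes "vec.subspace (U :: (bit ^ 'm) set)" "x \<in> U"
  shows "x + y \<in> U \<longleftrightarrow> y \<in> U" "y + x \<in> U \<longleftrightarrow> y \<in> U"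
proof -
  show "x + y \<in> U \<longleftrightarrow> y \<in> U"
    using assms vec.subspace_add[OF assms(1,2)] by (metis bit_vec_add_self(2))
  then show "y + x \<in> U \<longleftrightarrow> y \<in> U"
    by (simp add: add.commute)
qed

text \<open>The only scalars are 0 and 1, so homogeneity follows from additivity.\<close>

lemma bit_linear_iff:
  "Vector_Spaces.linear (*s) (*s) g \<longleftrightarrow> (\<forall>x y. g (x + y) = g x + (g y :: bit ^ 'k))"
proof
  assume add: "\<forall>x y. g (x + y) = g x + (g y :: bit ^ 'k)"
  then have "g 0 = 0"
    by (metis add.right_neutral bit_vec_add_self(2))
  with add show "Vector_Spaces.linear (*s) (*s) g"
    by (simp add: Vector_Spaces.linear_iff bit_scale vec.vector_space_axioms)
qed (simp add: Vector_Spaces.linear_iff)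

lemma finite_bit_vec [simp, intro]: "finite (A :: (bit ^ 'm) set)"
proof -
  have "finite (UNIV :: bit set)"
    by (rule finite_subset[of _ "{0, 1}"]) auto
  then have "finite (UNIV :: ('m \<Rightarrow> bit) set)"
    using finite_set_of_finite_funs[of "UNIV :: 'm set" "UNIV :: bit set"] by simp
  then have "finite (range (vec_lambda :: ('m \<Rightarrow> bit) \<Rightarrow> bit ^ 'm))"
    by simp
  moreover have "range (vec_lambda :: ('m \<Rightarrow> bit) \<Rightarrow> bit ^ 'm) = UNIV"
    by (metis surjI vec_nth_inverse)
  ultimately have "finite (UNIV :: (bit ^ 'm) set)"
    by simp
  then show ?thesis
    by (rule finite_subset[OF subset_UNIV])
qed

lemma bit_span_insert:
  "x \<in> vec.span (insert a S) \<longleftrightarrow> x \<in> vec.span S \<or> x + a \<in> vec.span (S :: (bit ^ 'm) set)"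
proof -
  have "(\<exists>k. x - k *s a \<in> vec.span S) \<longleftrightarrow> x - 0 *s a \<in> vec.span S \<or> x - 1 *s a \<in> vec.span S"
    by (metis bit.exhaust)
  then show ?thesis
    by (simp add: vec.span_breakdown_eq)
qed

lemma card_bit_span_insert:
  assumes "a \<notin> vec.span (S :: (bit ^ 'm) set)"
  shows "card (vec.span (insert a S)) = 2 * card (vec.span S)"
proof -
  have "vec.span (insert a S) = vec.span S \<union> (+) a ` vec.span S"
  proof (rule Set.set_eqI)
    fix x
    have "x \<in> (+) a ` vec.span S \<longleftrightarrow> x + a \<in> vec.span S"
      by (metis (no_types, lifting) add.commute bit_vec_add_self(2) image_iff)
    then show "x \<in> vec.span (insert a S) \<longleftrightarrow> x \<in> vec.span S \<union> (+) a ` vec.span S"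
      by (simp add: bit_span_insert)
  qed
  moreover have "vec.span S \<inter> (+) a ` vec.span S = {}"
    using assms by (auto simp: bit_subspace_add_iff[OF vec.subspace_span])
  ultimately show ?thesis
    by (simp add: card_Un_disjoint card_image)
qed

text \<open>Each new basis vector doubles the span. Later statements about dimensions are obtained
  by comparing the corresponding powers of 2.\<close>

lemma card_bit_subspace:
  assumes "vec.subspace (U :: (bit ^ 'm) set)"
  shows "card U = 2 ^ vec.dim U"
proof -
  have *: "vec.independent S \<Longrightarrow> card (vec.span S) = 2 ^ card S" for S :: "(bit ^ 'm) set"
  proof (induction S rule: finite_induct[OF finite_bit_vec])
    case (2 x F)
    then show ?case
      by (auto simp: vec.independent_insert card_bit_span_insert)
  qed simp
  obtain S where S: "S \<subseteq> U" "vec.independent S" "U \<subseteq> vec.span S" "card S = vec.dim U"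
    using vec.basis_exists .
  then have "vec.span S = U"
    using assms vec.span_minimal by blast
  then show ?thesis
    using * S by metis
qed

lemma card_UNIV_bit_vec: "card (UNIV :: (bit ^ 'm) set) = 2 ^ CARD('m)"
  using card_bit_subspace[OF vec.subspace_UNIV] by (metis vec_dim_card)

lemma bit_vec_set_eqI:
  assumes "U \<subseteq> W" "card U = card (W :: (bit ^ 'm) set)"
  shows "U = W"
  by (rule card_subset_eq[OF finite_bit_vec assms])

section \<open>Character sums\<close>

text \<open>The nontrivial additive character of the two-element field, with integer values so that
  its sums can be compared with signs.\<close>

definition chi :: "bit \<Rightarrow> int" where
  "chi c = (if c = 0 then 1 else - 1)"

lemma chi_simps [simp]: "chi 0 = 1" "chi 1 = - 1" "chi c * chi c = 1"
  "chi c * (chi c * k) = k"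
  by (simp_all add: chi_def)

lemma chi_add: "chi (a + b) = chi a * chi b"
  by (cases a; cases b; simp)

lemma chi_eq_iff [simp]: "chi a = chi b \<longleftrightarrow> a = b" "chi a = 1 \<longleftrightarrow> a = 0" "chi a = - 1 \<longleftrightarrow> a = 1"
  by (cases a; cases b; simp)+

lemma sum_translate:
  fixes f :: "bit ^ 'm \<Rightarrow> 'a :: comm_monoid_add"
  assumes "vec.subspace U" "u \<in> U"
  shows "(\<Sum>x\<in>U. f (x + u)) = sum f U"
proof (rule sum.reindex_bij_witness[where i = "\<lambda>x. x + u" and j = "\<lambda>x. x + u"])
qed (use assms in \<open>auto simp: bit_subspace_add_iff add.assoc\<close>)

text \<open>Orthogonality of characters: translation by a vector \<open>u\<close> with
  \<open>f u = 1\<close> permutes \<open>U\<close> and negates the sum.\<close>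

lemma chi_sum_additive:
  fixes f :: "bit ^ 'm \<Rightarrow> bit"
  assumes U: "vec.subspace U" and f: "\<And>x y. x \<in> U \<Longrightarrow> y \<in> U \<Longrightarrow> f (x + y) = f x + f y"
  shows "(\<Sum>x\<in>U. chi (f x)) = (if \<forall>x\<in>U. f x = 0 then int (card U) else 0)"
proof (cases "\<forall>x\<in>U. f x = 0")
  case False
  then obtain u where u: "u \<in> U" "f u = 1" by auto
  have "(\<Sum>x\<in>U. chi (f x)) = (\<Sum>x\<in>U. chi (f (x + u)))"
    by (rule sum_translate[OF U u(1), symmetric])
  also have "\<dots> = - (\<Sum>x\<in>U. chi (f x))"
    unfolding sum_negf[symmetric] by (rule sum.cong) (use f u in \<open>auto simp: chi_add\<close>)
  finally show ?thesis using False by auto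
qed simp

text \<open>The indicator of \<open>f x = c\<close> is half of \<open>1 + chi c * chi (f x)\<close>;
  the factor 2 keeps everything in the integers.\<close>

lemma card_level_set:
  fixes f :: "bit ^ 'm \<Rightarrow> bit"
  shows "2 * int (card {x \<in> U. f x = c}) = int (card U) + chi c * (\<Sum>x\<in>U. chi (f x))"
proof -
  have "int (card {x \<in> U. f x = c}) = (\<Sum>x\<in>U. if f x = c then 1 else 0)"
    by (simp add: sum.If_cases Int_def conj_commute)
  then have "2 * int (card {x \<in> U. f x = c}) = (\<Sum>x\<in>U. 2 * (if f x = c then 1 else 0))"
    by (simp add: sum_distrib_left)
  also have "\<dots> = (\<Sum>x\<in>U. 1 + chi c * chi (f x))"
    by (rule sum.cong) (auto simp: chi_def)
  finally show ?thesis
    by (simp add: sum.distrib sum_distrib_left)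
qed

section \<open>Symplectic spaces and quadratic forms\<close>

text \<open>The number of zeros of \<open>\<phi>\<close> on \<open>U\<close> minus the number of
  nonzeros. On a nondegenerate \<open>U\<close> its sign is the Arf invariant, written
  multiplicatively.\<close>

definition gauss_sum :: "(bit ^ 'm \<Rightarrow> bit) \<Rightarrow> (bit ^ 'm) set \<Rightarrow> int" where
  "gauss_sum \<phi> U = (\<Sum>x\<in>U. chi (\<phi> x))"

locale symplectic_space =
  fixes B :: "bit ^ 'm \<Rightarrow> bit ^ 'm \<Rightarrow> bit" and n :: nat
  assumes symplectic: "symplectic_form B" and card_index: "CARD('m) = 2 * n"
begin

lemma form_add [simp]: "B (x + y) z = B x z + B y z" "B x (y + z) = B x y + B x z"
  using symplectic by (simp_all add: symplectic_form_def bilinear_form_def Vector_Spaces.linear_iff)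

lemma form_self [simp]: "B x x = 0"
  using symplectic by (simp add: symplectic_form_def)

lemma form_zero [simp]: "B 0 x = 0" "B x 0 = 0"
  by (metis bit_add_self(1) bit_vec_add_self(1) form_add)+

lemma form_commute: "B x y = B y x"
proof -
  have "B (x + y) (x + y) = B x y + B y x"
    by (simp only: form_add) simp
  then have "B x y + B y x = 0"
    by (simp only: form_self)
  then show ?thesis
    by (cases "B x y"; cases "B y x") simp_all
qed

lemma form_nondegenerate: "x \<noteq> 0 \<Longrightarrow> \<exists>y. B x y = 1"
  using symplectic unfolding symplectic_form_def by (metis bit_not_one_iff)

lemma bilinear_form_B: "bilinear_form B"
  using symplectic by (simp add: symplectic_form_def)

section \<open>Orthogonal complements and nondegenerate subspaces\<close>

lemma mem_perp_iff: "x \<in> perp B U \<longleftrightarrow> (\<forall>u\<in>U. B u x = 0)"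
  by (simp add: perp_def)

lemma subspace_perp: "vec.subspace (perp B U)"
  by (simp add: bit_subspace_iff mem_perp_iff)

lemma perp_antimono: "U \<subseteq> W \<Longrightarrow> perp B W \<subseteq> perp B U"
  unfolding perp_def by blast

lemma subset_perp_perp: "U \<subseteq> perp B (perp B U)"
  using form_commute by (auto simp: mem_perp_iff) metis

text \<open>A subspace is not the union of two proper subspaces: if neither \<open>a\<close> nor
  \<open>b\<close> serves both \<open>x\<close> and \<open>y\<close>, then \<open>a + b\<close>
  does.\<close>

lemma common_dual_vector:
  assumes "vec.subspace P" "a \<in> P" "B x a = 1" "b \<in> P" "B y b = 1"
  shows "\<exists>p\<in>P. B x p = 1 \<and> B y p = 1"
proof (cases "B y a = 1 \<or> B x b = 1")
  case False
  then have "B x (a + b) = 1" "B y (a + b) = 1"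
    using assms by simp_all
  then show ?thesis
    using assms vec.subspace_add by metis
qed (use assms in blast)

lemma nondegenerate_subspaceI:
  assumes "vec.subspace U" "\<And>x. x \<in> U \<Longrightarrow> x \<noteq> 0 \<Longrightarrow> \<exists>y\<in>U. B x y = 1"
  shows "nondegenerate_subspace B U"
proof -
  have "x = 0" if "x \<in> U" "x \<in> perp B U" for x
    using assms(2)[OF that(1)] that(2) form_commute by (fastforce simp: mem_perp_iff)
  then show ?thesis
    using assms(1) vec.subspace_0[OF assms(1)] vec.subspace_0[OF subspace_perp]
    by (auto simp: nondegenerate_subspace_def)
qed

lemma nondegenerate_subspaceD:
  assumes "nondegenerate_subspace B U"
  shows "vec.subspace U" "\<And>x. x \<in> U \<Longrightarrow> x \<noteq> 0 \<Longrightarrow> \<exists>y\<in>U. B x y = 1"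
proof -
  fix x assume "x \<in> U" "x \<noteq> 0"
  then have "x \<notin> perp B U"
    using assms by (auto simp: nondegenerate_subspace_def)
  then show "\<exists>y\<in>U. B x y = 1"
    using form_commute by (auto simp: mem_perp_iff)
qed (use assms nondegenerate_subspace_def in blast)

lemma nondegenerate_UNIV: "nondegenerate_subspace B UNIV"
  using form_nondegenerate by (intro nondegenerate_subspaceI) auto

lemma sum_chi_form:
  assumes "vec.subspace U"
  shows "(\<Sum>x\<in>U. chi (B x y)) = (if y \<in> perp B U then int (card U) else 0)"
  using chi_sum_additive[OF assms, of "\<lambda>x. B x y"] by (simp add: mem_perp_iff)

text \<open>Double counting of \<open>chi (B w x)\<close> over pairs from \<open>W\<close> and
  \<open>U\<close>. Summing over \<open>w\<close> first leaves the \<open>x\<close> orthogonal to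
  \<open>W\<close>, each with weight \<open>card W\<close>; summing over \<open>x\<close> first
  leaves only \<open>w = 0\<close>, by nondegeneracy of \<open>U\<close>.\<close>

lemma card_perp:
  assumes U: "nondegenerate_subspace B U" and W: "vec.subspace W" "W \<subseteq> U"
  shows "card W * card (U \<inter> perp B W) = card U"
proof -
  have "int (card W) * int (card (U \<inter> perp B W)) = (\<Sum>x\<in>U. \<Sum>w\<in>W. chi (B w x))"
    by (simp add: sum_chi_form[OF W(1)] sum.If_cases Int_def)
  also have "\<dots> = (\<Sum>w\<in>W. \<Sum>x\<in>U. chi (B x w))"
    by (subst sum.swap) (simp add: form_commute)
  also have "\<dots> = (\<Sum>w\<in>W. if w = 0 then int (card U) else 0)"
  proof (rule sum.cong)
    fix w assume "w \<in> W"
    then have "w \<in> perp B U \<longleftrightarrow> w = 0"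
      using U W by (auto simp: nondegenerate_subspace_def)
    then show "(\<Sum>x\<in>U. chi (B x w)) = (if w = 0 then int (card U) else 0)"
      using sum_chi_form nondegenerate_subspaceD(1)[OF U] by simp
  qed simp
  also have "\<dots> = int (card U)"
    using vec.subspace_0[OF W(1)] by simp
  finally show ?thesis
    by (metis of_nat_eq_iff of_nat_mult)
qed

lemma card_perp_UNIV:
  assumes "vec.subspace W"
  shows "card W * card (perp B W) = 2 ^ CARD('m)"
  using card_perp[OF nondegenerate_UNIV assms] card_UNIV_bit_vec[where 'm = 'm]
  by (simp only: Int_UNIV_left subset_UNIV)

lemma dim_perp:
  assumes "vec.subspace W"
  shows "vec.dim W + vec.dim (perp B W) = CARD('m)"
  using card_perp_UNIV[OF assms]
  by (simp add: card_bit_subspace assms subspace_perp flip: power_add)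

lemma perp_perp:
  assumes "vec.subspace W"
  shows "perp B (perp B W) = W"
proof -
  have "card W * card (perp B W) = card (perp B (perp B W)) * card (perp B W)"
    using card_perp_UNIV[OF assms] card_perp_UNIV[OF subspace_perp, of W] by (simp add: mult.commute)
  then have "card W = card (perp B (perp B W))"
    using card_bit_subspace[OF subspace_perp, of W] by simp
  then show ?thesis
    by (rule bit_vec_set_eqI[OF subset_perp_perp, symmetric])
qed

lemma nondegenerate_perp:
  assumes "nondegenerate_subspace B U"
  shows "nondegenerate_subspace B (perp B U)"
  using assms perp_perp subspace_perp by (auto simp: nondegenerate_subspace_def)

text \<open>Injectivity is the trivial intersection of \<open>U\<close> with its complement;
  surjectivity then follows by counting.\<close>

lemma nondegenerate_decomposition_bij:
  assumes "nondegenerate_subspace B U"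
  shows "bij_betw (\<lambda>(u, w). u + w) (U \<times> perp B U) UNIV"
proof -
  note U = nondegenerate_subspaceD(1)[OF assms]
  have inj: "inj_on (\<lambda>(u, w). u + w) (U \<times> perp B U)"
  proof (rule inj_onI, clarsimp)
    fix u w u' w' assume *: "u \<in> U" "w \<in> perp B U" "u' \<in> U" "w' \<in> perp B U" "u + w = u' + w'"
    then have "u + u' = w + w'"
      by (metis add.assoc add.commute bit_vec_add_self(2))
    moreover have "u + u' \<in> U" "w + w' \<in> perp B U"
      using * U subspace_perp vec.subspace_add by metis+
    ultimately have "u + u' \<in> U \<inter> perp B U"
      by simp
    then have "u + u' = 0"
      using assms unfolding nondegenerate_subspace_def by blast
    then show "u = u' \<and> w = w'"
      using \<open>u + u' = w + w'\<close> by simp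
  qed
  then have "card ((\<lambda>(u, w). u + w) ` (U \<times> perp B U)) = card (UNIV :: (bit ^ 'm) set)"
    by (simp only: card_image card_cartesian_product card_perp_UNIV[OF U] card_UNIV_bit_vec)
  then have "(\<lambda>(u, w). u + w) ` (U \<times> perp B U) = UNIV"
    by (intro bit_vec_set_eqI) auto
  with inj show ?thesis
    by (simp add: bij_betw_def)
qed

lemma nondegenerate_decomposition:
  assumes "nondegenerate_subspace B U"
  obtains u w where "u \<in> U" "w \<in> perp B U" "v = u + w"
proof -
  have "v \<in> (\<lambda>(u, w). u + w) ` (U \<times> perp B U)"
    using nondegenerate_decomposition_bij[OF assms] by (simp add: bij_betw_def)
  then show thesis
    using that by auto
qed

text \<open>Over the two-element field, homogeneity amounts to \<open>\<phi> 0 = 0\<close>, which is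
  the polarisation identity at 0.\<close>

lemma forms_iff: "\<phi> \<in> forms B \<longleftrightarrow> (\<forall>x y. \<phi> (x + y) = \<phi> x + \<phi> y + B x y)"
proof
  assume *: "\<forall>x y. \<phi> (x + y) = \<phi> x + \<phi> y + B x y"
  then have "\<phi> (0 + 0) = \<phi> 0 + \<phi> 0 + B 0 0" by blast
  then have "\<phi> 0 = 0" by simp
  moreover have "\<phi> x + \<phi> y + B x y + \<phi> x + \<phi> y = B x y" for x y
    by (cases "\<phi> x"; cases "\<phi> y"; cases "B x y") simp_all
  ultimately show "\<phi> \<in> forms B"
    using * bilinear_form_B by (simp add: forms_def quadratic_form_def bit_scale)
next
  assume "\<phi> \<in> forms B"
  then have "\<phi> (x + y) + \<phi> x + \<phi> y = B x y" for x y
    by (simp add: forms_def)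
  then show "\<forall>x y. \<phi> (x + y) = \<phi> x + \<phi> y + B x y"
    by (metis add.assoc add.commute bit_add_self(2))
qed

lemma forms_add: "\<phi> \<in> forms B \<Longrightarrow> \<phi> (x + y) = \<phi> x + \<phi> y + B x y"
  by (simp add: forms_iff)

lemma forms_zero [simp]: "\<phi> \<in> forms B \<Longrightarrow> \<phi> 0 = 0"
  using forms_add[of \<phi> 0 0] by simp

text \<open>After shifting the second variable by the first, the product
  \<open>chi (\<phi> x) * chi (\<phi> (y + x))\<close> equals
  \<open>chi (\<phi> y) * chi (B x y)\<close>, and the sum over \<open>x\<close> annihilates every
  \<open>y\<close> except 0.\<close>

lemma gauss_sum_square:
  assumes \<phi>: "\<phi> \<in> forms B" and U: "nondegenerate_subspace B U"
  shows "gauss_sum \<phi> U * gauss_sum \<phi> U = int (card U)"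
proof -
  note sub = nondegenerate_subspaceD(1)[OF U]
  have "gauss_sum \<phi> U * gauss_sum \<phi> U = (\<Sum>x\<in>U. chi (\<phi> x) * (\<Sum>y\<in>U. chi (\<phi> y)))"
    by (simp add: gauss_sum_def sum_distrib_right)
  also have "\<dots> = (\<Sum>x\<in>U. chi (\<phi> x) * (\<Sum>y\<in>U. chi (\<phi> (y + x))))"
    by (rule sum.cong) (simp_all add: sum_translate[OF sub, of _ "\<lambda>y. chi (\<phi> y)"])
  also have "\<dots> = (\<Sum>x\<in>U. \<Sum>y\<in>U. chi (\<phi> y) * chi (B x y))"
    by (simp add: sum_distrib_left forms_add[OF \<phi>] chi_add mult_ac form_commute)
  also have "\<dots> = (\<Sum>y\<in>U. chi (\<phi> y) * (\<Sum>x\<in>U. chi (B x y)))"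
    by (subst sum.swap) (simp add: sum_distrib_left)
  also have "\<dots> = (\<Sum>y\<in>U. if y = 0 then int (card U) else 0)"
    by (rule sum.cong)
      (use U \<phi> in \<open>auto simp: sum_chi_form[OF sub] nondegenerate_subspace_def\<close>)
  also have "\<dots> = int (card U)"
    using vec.subspace_0[OF sub] by simp
  finally show ?thesis .
qed

text \<open>Averaging over translations by \<open>W\<close>: since \<open>\<phi>\<close> vanishes on
  \<open>W\<close>, a shift by \<open>w\<close> multiplies the sign at \<open>x\<close> by
  \<open>chi (B w x)\<close>, and these factors cancel unless \<open>x\<close> is orthogonal to
  \<open>W\<close>.\<close>

lemma gauss_sum_perp:
  assumes \<phi>: "\<phi> \<in> forms B" and U: "vec.subspace U" and W: "vec.subspace W" "W \<subseteq> U" "W \<subseteq> Sing \<phi>"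
  shows "gauss_sum \<phi> U = gauss_sum \<phi> (U \<inter> perp B W)"
proof -
  have "int (card W) * gauss_sum \<phi> U = (\<Sum>w\<in>W. \<Sum>x\<in>U. chi (\<phi> (x + w)))"
    using W(2) by (subst sum.cong[OF refl sum_translate[OF U, of _ "\<lambda>x. chi (\<phi> x)"]])
      (auto simp: gauss_sum_def)
  also have "\<dots> = (\<Sum>w\<in>W. \<Sum>x\<in>U. chi (\<phi> x) * chi (B w x))"
    by (rule sum.cong) (use W in \<open>auto simp: Sing_def forms_add[OF \<phi>] chi_add form_commute\<close>)
  also have "\<dots> = (\<Sum>x\<in>U. chi (\<phi> x) * (\<Sum>w\<in>W. chi (B w x)))"
    by (subst sum.swap) (simp add: sum_distrib_left)
  also have "\<dots> = (\<Sum>x\<in>U. if x \<in> perp B W then int (card W) * chi (\<phi> x) else 0)"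
    by (rule sum.cong) (auto simp: sum_chi_form[OF W(1)])
  also have "\<dots> = int (card W) * gauss_sum \<phi> (U \<inter> perp B W)"
    by (simp add: sum.If_cases gauss_sum_def sum_distrib_left Int_def)
  finally show ?thesis
    using card_bit_subspace[OF W(1)] by simp
qed

lemma singular_imp_isotropic:
  assumes "\<phi> \<in> forms B" "vec.subspace W" "W \<subseteq> Sing \<phi>"
  shows "W \<subseteq> perp B W"
proof -
  have "B x y = 0" if "x \<in> W" "y \<in> W" for x y
  proof -
    have "x + y \<in> W"
      using assms(2) that by (rule vec.subspace_add)
    then have "\<phi> (x + y) = 0" "\<phi> x = 0" "\<phi> y = 0"
      using assms(3) that by (auto simp: Sing_def)
    then show ?thesis
      using forms_add[OF assms(1), of x y] by simp
  qed
  then show ?thesis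
    by (auto simp: mem_perp_iff)
qed

lemma witt_index_attained:
  assumes "\<phi> \<in> forms B" "vec.subspace U"
  obtains W where "vec.subspace W" "W \<subseteq> U" "W \<subseteq> Sing \<phi>" "vec.dim W = witt_index \<phi> U"
    "\<And>W'. vec.subspace W' \<Longrightarrow> W' \<subseteq> U \<Longrightarrow> W' \<subseteq> Sing \<phi> \<Longrightarrow> vec.dim W' \<le> vec.dim W"
proof -
  define S where "S = {vec.dim W | W. vec.subspace W \<and> W \<subseteq> U \<and> W \<subseteq> Sing \<phi>}"
  have "finite S"
    by (rule finite_subset[of _ "{..CARD('m)}"]) (auto simp: S_def dim_subset_UNIV_cart_gen)
  moreover have "vec.dim {0 :: bit ^ 'm} \<in> S"
    using assms(1) vec.subspace_0[OF assms(2)] unfolding S_def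
    by (auto simp: Sing_def intro!: exI[of _ "{0}"])
  ultimately have S: "Max S \<in> S" "\<And>k. k \<in> S \<Longrightarrow> k \<le> Max S"
    using Max_in by auto
  then obtain W where W: "vec.subspace W" "W \<subseteq> U" "W \<subseteq> Sing \<phi>" "vec.dim W = Max S"
    unfolding S_def by auto
  show thesis
  proof (rule that[OF W(1-3)])
    show "vec.dim W = witt_index \<phi> U"
      by (simp add: W(4) witt_index_def S_def)
    fix W' assume "vec.subspace W'" "W' \<subseteq> U" "W' \<subseteq> Sing \<phi>"
    then have "vec.dim W' \<in> S"
      unfolding S_def by blast
    then show "vec.dim W' \<le> vec.dim W"
      using S(2) W(4) by simp
  qed
qed

text \<open>Let \<open>W\<close> be a totally singular subspace of maximal dimension and
  \<open>P\<close> its complement in \<open>U\<close>. A zero of \<open>\<phi>\<close> in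
  \<open>P - W\<close> could be adjoined to \<open>W\<close>, so \<open>\<phi>\<close> is 1 on
  \<open>P - W\<close> and the Gauss sum is \<open>card W - card (P - W)\<close>, that is
  \<open>2 ^ w * (2 - 4 ^ j)\<close> with \<open>j = r - w\<close>. Its square is
  \<open>card U\<close>, which leaves \<open>j = 0\<close> and \<open>j = 1\<close>: the hyperbolic
  and the elliptic case.\<close>

lemma witt_index_cases:
  assumes \<phi>: "\<phi> \<in> forms B" and U: "nondegenerate_subspace B U" "vec.dim U = 2 * r"
  shows "witt_index \<phi> U = r \<and> gauss_sum \<phi> U = 2 ^ r \<or> witt_index \<phi> U + 1 = r \<and> gauss_sum \<phi> U = - (2 ^ r)"
proof -
  note sub = nondegenerate_subspaceD(1)[OF U(1)]
  obtain W where W: "vec.subspace W" "W \<subseteq> U" "W \<subseteq> Sing \<phi>" "vec.dim W = witt_index \<phi> U"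
    and max: "\<And>W'. vec.subspace W' \<Longrightarrow> W' \<subseteq> U \<Longrightarrow> W' \<subseteq> Sing \<phi> \<Longrightarrow> vec.dim W' \<le> vec.dim W"
    using witt_index_attained[OF \<phi> sub] by blast
  define P where "P = U \<inter> perp B W"
  have P: "vec.subspace P"
    unfolding P_def using sub subspace_perp by (rule vec.subspace_inter)
  have WP: "W \<subseteq> P"
    using W singular_imp_isotropic[OF \<phi>] by (auto simp: P_def)
  have one: "\<phi> x = 1" if "x \<in> P - W" for x
  proof (rule ccontr)
    assume "\<phi> x \<noteq> 1"
    then have x: "\<phi> x = 0" by simp
    define W' where "W' = vec.span (insert x W)"
    have spanW: "vec.span W = W"
      using W(1) vec.span_eq_iff by blast
    have "\<phi> y = 0" if "y \<in> W'" for y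
    proof -
      consider "y \<in> W" | w where "w \<in> W" "y = w + x"
        using \<open>y \<in> W'\<close> unfolding W'_def bit_span_insert spanW
        by (metis add.assoc add.right_neutral bit_vec_add_self(1))
      then show ?thesis
        using W x \<open>x \<in> P - W\<close> by cases (auto simp: Sing_def P_def forms_add[OF \<phi>] mem_perp_iff)
    qed
    moreover have "W' \<subseteq> U"
      unfolding W'_def using W \<open>x \<in> P - W\<close> sub by (intro vec.span_minimal) (auto simp: P_def)
    ultimately have "vec.dim W' \<le> vec.dim W"
      using max[of W'] by (auto simp: W'_def Sing_def)
    moreover have "(2 :: nat) ^ vec.dim W' = 2 ^ Suc (vec.dim W)"
      using card_bit_span_insert[of x W] \<open>x \<in> P - W\<close> card_bit_subspace[OF W(1)]
        card_bit_subspace[OF vec.subspace_span, of "insert x W"]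
      by (simp add: spanW W'_def)
    ultimately show False
      using power_inject_exp[of "2 :: nat" "vec.dim W'" "Suc (vec.dim W)"] by simp
  qed
  define w e where "w = vec.dim W" and "e = vec.dim P"
  have "card W * card P = card U"
    unfolding P_def by (rule card_perp[OF U(1) W(1,2)])
  then have "(2 :: nat) ^ (w + e) = 2 ^ (2 * r)"
    by (simp add: card_bit_subspace W(1) P sub U(2) w_def e_def power_add)
  then have we: "w + e = 2 * r" by simp
  have "w \<le> e"
    unfolding w_def e_def using WP by (rule vec.dim_subset)
  define j where "j = r - w"
  have j: "r = w + j" "e = w + 2 * j"
    using we \<open>w \<le> e\<close> by (auto simp: j_def)
  have "gauss_sum \<phi> U = gauss_sum \<phi> P"
    unfolding P_def by (rule gauss_sum_perp[OF \<phi> sub W(1-3)])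
  also have "\<dots> = (\<Sum>x\<in>W. chi (\<phi> x)) + (\<Sum>x\<in>P - W. chi (\<phi> x))"
    unfolding gauss_sum_def using WP by (subst sum.subset_diff[OF WP]) auto
  also have "\<dots> = int (card W) - int (card (P - W))"
    using W(3) one by (simp add: Sing_def subset_iff)
  also have "int (card (P - W)) = int (card P) - int (card W)"
    using WP by (simp add: card_Diff_subset card_mono of_nat_diff)
  finally have "gauss_sum \<phi> U = 2 * 2 ^ w - 2 ^ (w + 2 * j)"
    by (simp add: card_bit_subspace W(1) P flip: w_def e_def j(2))
  moreover have four: "(4 :: int) ^ j = 2 ^ (2 * j)"
    by (simp add: power_mult)
  ultimately have g: "gauss_sum \<phi> U = 2 ^ w * (2 - 4 ^ j)"
    by (simp add: power_add algebra_simps)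
  have "(2 :: int) ^ w * 2 ^ w * ((2 - 4 ^ j) * (2 - 4 ^ j)) = 2 ^ w * 2 ^ w * 4 ^ j"
  proof -
    have "2 * r = w + w + 2 * j"
      using j(1) by simp
    then have "int (card U) = 2 ^ (w + w + 2 * j)"
      using U(2) card_bit_subspace[OF sub] by (simp only: of_nat_power of_nat_numeral)
    then have "int (card U) = 2 ^ w * 2 ^ w * 4 ^ j"
      by (simp only: power_add four)
    then show ?thesis
      using gauss_sum_square[OF \<phi> U(1)] unfolding g by (simp only: mult_ac)
  qed
  then have sq: "(2 - 4 ^ j) * (2 - 4 ^ j) = (4 :: int) ^ j"
    by simp
  \<comment> \<open>For larger \<open>j\<close> the square is too big: \<open>4 ^ j - 2\<close> is
    at least 14, and 14 times \<open>4 ^ j - 2\<close> already exceeds \<open>4 ^ j\<close>.\<close>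
  have "j < 2"
  proof (rule ccontr)
    assume "\<not> j < 2"
    then have "(4 :: int) ^ 2 \<le> 4 ^ j" by (intro power_increasing) auto
    then have "14 * (4 ^ j - 2) \<le> ((4 :: int) ^ j - 2) * (4 ^ j - 2)"
      by (intro mult_right_mono) simp_all
    moreover have "(2 - 4 ^ j) * (2 - 4 ^ j) = (4 ^ j - 2) * ((4 :: int) ^ j - 2)"
      by (simp add: algebra_simps)
    ultimately show False
      using sq \<open>4 ^ 2 \<le> 4 ^ j\<close> by simp
  qed
  then consider "j = 0" | "j = 1" by linarith
  then show ?thesis
    using W(4) g by cases (auto simp: j w_def)
qed

lemma has_type_iff:
  assumes "\<phi> \<in> forms B" "nondegenerate_subspace B U" "vec.dim U = 2 * r"
  shows "has_type \<phi> U s \<longleftrightarrow> s \<in> {1, -1} \<and> gauss_sum \<phi> U = s * 2 ^ r"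
proof -
  have "(2 :: int) ^ r \<noteq> - (2 ^ r)"
    by (simp add: eq_neg_iff_add_eq_0)
  then show ?thesis
    using witt_index_cases[OF assms] assms(3) unfolding has_type_def by auto
qed

lemma gauss_sum_cases:
  assumes "\<phi> \<in> forms B" "nondegenerate_subspace B U" "vec.dim U = 2 * r"
  obtains s where "s \<in> {1, -1}" "gauss_sum \<phi> U = s * 2 ^ r"
  using witt_index_cases[OF assms] that[of 1] that[of "-1"] by auto

lemma dim_UNIV: "vec.dim (UNIV :: (bit ^ 'm) set) = 2 * n"
  by (simp only: vec_dim_card card_index)

lemma forms_of_type_iff:
  "\<phi> \<in> forms_of_type B s \<longleftrightarrow> \<phi> \<in> forms B \<and> s \<in> {1, -1} \<and> gauss_sum \<phi> UNIV = s * 2 ^ n"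
  using has_type_iff[OF _ nondegenerate_UNIV dim_UNIV] by (auto simp: forms_of_type_def)

text \<open>A Fourier argument that avoids extending \<open>f\<close> to the whole space. Correlate
  \<open>f\<close> with all functionals \<open>B u z\<close> and sum over \<open>z\<close>: only
  \<open>u = 0\<close> survives, so the total is \<open>card UNIV\<close> and some \<open>z\<close>
  has nonzero correlation. For this \<open>z\<close> the additive map \<open>f u + B u z\<close> has
  a nonzero character sum, hence vanishes.\<close>

lemma additive_representation:
  assumes U: "vec.subspace U" and f: "\<And>x y. x \<in> U \<Longrightarrow> y \<in> U \<Longrightarrow> f (x + y) = f x + (f y :: bit)"
  shows "\<exists>z. \<forall>u\<in>U. f u = B u z"
proof -
  have U0: "0 \<in> U"
    using U by (rule vec.subspace_0)
  have f0: "f 0 = 0"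
    using f[OF U0 U0] by simp
  have "(\<Sum>z\<in>UNIV. \<Sum>u\<in>U. chi (f u + B u z)) = (\<Sum>u\<in>U. chi (f u) * (\<Sum>z\<in>UNIV. chi (B z u)))"
    by (subst sum.swap) (simp add: chi_add sum_distrib_left form_commute)
  also have "\<dots> = (\<Sum>u\<in>U. if u = 0 then int (card (UNIV :: (bit ^ 'm) set)) else 0)"
  proof (rule sum.cong)
    fix u
    have "u \<in> perp B UNIV \<longleftrightarrow> u = 0"
      using nondegenerate_UNIV unfolding nondegenerate_subspace_def by blast
    then show "chi (f u) * (\<Sum>z\<in>UNIV. chi (B z u)) =
        (if u = 0 then int (card (UNIV :: (bit ^ 'm) set)) else 0)"
      using sum_chi_form[OF vec.subspace_UNIV, of u] f0 by simp
  qed simp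
  also have "\<dots> \<noteq> 0"
    using U0 by (simp add: card_UNIV_bit_vec del: CARD_vec)
  finally obtain z where "(\<Sum>u\<in>U. chi (f u + B u z)) \<noteq> 0"
    by (meson sum.not_neutral_contains_not_neutral)
  then have "\<forall>u\<in>U. f u + B u z = 0"
    using chi_sum_additive[OF U, of "\<lambda>u. f u + B u z"] f
    by (simp add: ac_simps split: if_splits)
  then have "\<forall>u\<in>U. f u = B u z"
    by (metis add.right_neutral bit_add_self(2))
  then show ?thesis ..
qed

section \<open>Translation of forms by vectors\<close>

definition translate :: "(bit ^ 'm \<Rightarrow> bit) \<Rightarrow> bit ^ 'm \<Rightarrow> bit ^ 'm \<Rightarrow> bit" where
  "translate \<phi> v = (\<lambda>x. \<phi> x + B x v)"

lemma translate_forms: "\<phi> \<in> forms B \<Longrightarrow> translate \<phi> v \<in> forms B"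
  by (simp add: forms_iff translate_def ac_simps)

lemma translate_translate [simp]: "translate (translate \<phi> u) w = translate \<phi> (u + w)"
  by (simp add: translate_def ac_simps)

lemma translate_zero [simp]: "translate \<phi> 0 = \<phi>"
  by (simp add: translate_def)

lemma translate_eq_iff [simp]: "translate \<phi> v = translate \<phi> w \<longleftrightarrow> v = w"
proof
  assume eq: "translate \<phi> v = translate \<phi> w"
  have "B (v + w) x = 0" for x
    using fun_cong[OF eq, of x] form_commute[of x] by (simp add: translate_def)
  then have "v + w = 0"
    using form_nondegenerate by fastforce
  then show "v = w" by simp
qed simp

lemma forms_translate:
  assumes "\<phi> \<in> forms B" "\<psi> \<in> forms B"
  obtains v where "\<psi> = translate \<phi> v"
proof -
  have "\<psi> (x + y) + \<phi> (x + y) = (\<psi> x + \<phi> x) + (\<psi> y + \<phi> y)" for x y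
    using forms_add[OF assms(1)] forms_add[OF assms(2)]
    by (cases "B x y") (simp_all add: ac_simps)
  then obtain v where v: "\<And>x. \<psi> x + \<phi> x = B x v"
    using additive_representation[OF vec.subspace_UNIV, of "\<lambda>x. \<psi> x + \<phi> x"] by auto
  have "\<psi> = translate \<phi> v"
    unfolding translate_def v[symmetric] by (simp add: ac_simps)
  then show thesis by (rule that)
qed

lemma translate_form_bij:
  assumes "\<phi> \<in> forms B"
  shows "bij_betw (translate \<phi>) UNIV (forms B)"
proof (rule bij_betwI')
  show "\<exists>v\<in>UNIV. \<psi> = translate \<phi> v" if "\<psi> \<in> forms B" for \<psi>
    using forms_translate[OF assms that] by blast
qed (simp_all add: translate_forms[OF assms])

lemma finite_forms: "finite (forms B)"
proof (cases "forms B = {}")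
  case False
  then obtain \<phi> where "\<phi> \<in> forms B" by blast
  then show ?thesis
    using translate_form_bij bij_betw_finite finite_bit_vec by metis
qed simp

lemma finite_forms_of_type [simp]: "finite (forms_of_type B s)"
  using finite_forms by (simp add: forms_of_type_def)

text \<open>Completing the square: \<open>\<phi> x + B x u\<close> is
  \<open>\<phi> (x + u) + \<phi> u\<close>, while \<open>w\<close> is invisible on
  \<open>U\<close>.\<close>

lemma gauss_sum_translate:
  assumes \<phi>: "\<phi> \<in> forms B" and U: "vec.subspace U" and "u \<in> U" "w \<in> perp B U"
  shows "gauss_sum (translate \<phi> (u + w)) U = chi (\<phi> u) * gauss_sum \<phi> U"
proof -
  have "gauss_sum (translate \<phi> (u + w)) U = (\<Sum>x\<in>U. chi (\<phi> u) * chi (\<phi> (x + u)))"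
    unfolding gauss_sum_def
    by (rule sum.cong)
      (use assms(4) in \<open>auto simp: translate_def mem_perp_iff forms_add[OF \<phi>] chi_add mult_ac\<close>)
  also have "\<dots> = chi (\<phi> u) * gauss_sum \<phi> U"
    using sum_translate[OF U \<open>u \<in> U\<close>, of "\<lambda>x. chi (\<phi> x)"]
    by (simp add: gauss_sum_def flip: sum_distrib_left)
  finally show ?thesis .
qed

lemma gauss_sum_translate_UNIV:
  assumes "\<phi> \<in> forms B"
  shows "gauss_sum (translate \<phi> v) UNIV = chi (\<phi> v) * gauss_sum \<phi> UNIV"
  using gauss_sum_translate[OF assms vec.subspace_UNIV, of v 0] vec.subspace_0[OF subspace_perp] by simp

lemma gauss_sum_split:
  assumes \<phi>: "\<phi> \<in> forms B" and U: "nondegenerate_subspace B U"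
  shows "gauss_sum \<phi> UNIV = gauss_sum \<phi> U * gauss_sum \<phi> (perp B U)"
proof -
  have "gauss_sum \<phi> UNIV = (\<Sum>(u, w)\<in>U \<times> perp B U. chi (\<phi> (u + w)))"
    unfolding gauss_sum_def sum.reindex_bij_betw[OF nondegenerate_decomposition_bij[OF U], symmetric]
    by (simp add: case_prod_unfold)
  also have "\<dots> = (\<Sum>(u, w)\<in>U \<times> perp B U. chi (\<phi> u) * chi (\<phi> w))"
    by (rule sum.cong) (auto simp: forms_add[OF \<phi>] mem_perp_iff chi_add)
  finally show ?thesis
    by (simp add: gauss_sum_def sum_product sum.cartesian_product)
qed

lemma translate_type:
  assumes "\<phi> \<in> forms_of_type B s"
  shows "translate \<phi> v \<in> forms_of_type B s \<longleftrightarrow> \<phi> v = 0"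
  using assms translate_forms gauss_sum_translate_UNIV
  by (cases "\<phi> v") (auto simp: forms_of_type_iff)

lemma forms_of_type_subset: "\<phi> \<in> forms_of_type B s \<Longrightarrow> \<phi> \<in> forms B"
  by (simp add: forms_of_type_def)

section \<open>The symplectic group and its transvections\<close>

lemma Sp_iff: "g \<in> carrier (Sp B) \<longleftrightarrow>
    (\<forall>x y. g (x + y) = g x + g y) \<and> bij g \<and> (\<forall>x y. B (g x) (g y) = B x y)"
  by (simp add: Sp_def bit_linear_iff)

lemma SpD:
  assumes "g \<in> carrier (Sp B)"
  shows "g (x + y) = g x + g y" "bij g" "B (g x) (g y) = B x y" "inj g" "surj g"
  using assms by (auto simp: Sp_iff bij_def)

lemma Sp_linear: "g \<in> carrier (Sp B) \<Longrightarrow> Vector_Spaces.linear (*s) (*s) g"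
  by (simp add: Sp_def)

lemma Sp_inv_simps [simp]:
  assumes "g \<in> carrier (Sp B)"
  shows "inv_into UNIV g (g x) = x" "g (inv_into UNIV g x) = x"
  using SpD[OF assms] by (simp_all add: surj_f_inv_f)

lemma Sp_zero [simp]: "g \<in> carrier (Sp B) \<Longrightarrow> g 0 = 0"
  using SpD(1)[of g 0 0] by simp

lemma Sp_eq_0_iff [simp]: "g \<in> carrier (Sp B) \<Longrightarrow> g x = 0 \<longleftrightarrow> x = 0"
  by (metis Sp_inv_simps(1) Sp_zero)

lemma Sp_id: "id \<in> carrier (Sp B)"
  by (simp add: Sp_iff)

lemma Sp_comp: "g \<in> carrier (Sp B) \<Longrightarrow> h \<in> carrier (Sp B) \<Longrightarrow> h \<circ> g \<in> carrier (Sp B)"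
  by (auto simp: Sp_iff bij_comp)

lemma Sp_inv:
  assumes "g \<in> carrier (Sp B)"
  shows "inv_into UNIV g \<in> carrier (Sp B)"
proof -
  have "inv_into UNIV g (x + y) = inv_into UNIV g x + inv_into UNIV g y" for x y
    by (metis Sp_inv_simps SpD(1) assms)
  moreover have "B (inv_into UNIV g x) (inv_into UNIV g y) = B x y" for x y
    by (metis Sp_inv_simps(2) SpD(3) assms)
  ultimately show ?thesis
    using SpD(2)[OF assms] by (simp add: Sp_iff bij_imp_bij_inv)
qed

lemma form_act_apply [simp]: "g \<in> carrier (Sp B) \<Longrightarrow> form_act g \<phi> (g x) = \<phi> x"
  by (simp add: form_act_def)

lemma form_act_eqI:
  assumes "g \<in> carrier (Sp B)" "\<And>x. \<psi> (g x) = \<phi> x"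
  shows "form_act g \<phi> = \<psi>"
proof
  fix x show "form_act g \<phi> x = \<psi> x"
    using assms(2)[of "inv_into UNIV g x"] by (simp add: form_act_def assms(1))
qed

lemma form_act_inv [simp]:
  assumes "g \<in> carrier (Sp B)"
  shows "form_act (inv_into UNIV g) (form_act g \<phi>) = \<phi>" "form_act g (form_act (inv_into UNIV g) \<phi>) = \<phi>"
  using assms by (simp_all add: form_act_def inv_inv_eq[OF SpD(2)[OF assms]])

lemma form_act_forms:
  assumes "g \<in> carrier (Sp B)" "\<phi> \<in> forms B"
  shows "form_act g \<phi> \<in> forms B"
  using SpD[OF Sp_inv[OF assms(1)]] forms_add[OF assms(2)] by (simp add: forms_iff form_act_def)

lemma form_act_translate:
  assumes "g \<in> carrier (Sp B)"
  shows "form_act g (translate \<phi> v) = translate (form_act g \<phi>) (g v)"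
  by (rule form_act_eqI[OF assms]) (simp add: translate_def assms SpD(3))

lemma gauss_sum_act:
  assumes "g \<in> carrier (Sp B)"
  shows "gauss_sum (form_act g \<phi>) (g ` U) = gauss_sum \<phi> U"
  unfolding gauss_sum_def using assms
  by (subst sum.reindex) (auto intro: inj_on_subset[OF SpD(4)])

lemma form_act_type:
  assumes "g \<in> carrier (Sp B)" "\<phi> \<in> forms_of_type B s"
  shows "form_act g \<phi> \<in> forms_of_type B s"
  using assms form_act_forms gauss_sum_act[OF assms(1), of \<phi> UNIV] SpD(5)[OF assms(1)]
  by (simp add: forms_of_type_iff)

lemma subspace_image: "g \<in> carrier (Sp B) \<Longrightarrow> vec.subspace U \<Longrightarrow> vec.subspace (g ` U)"
  by (auto simp: bit_subspace_iff image_iff simp flip: SpD(1))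

lemma dim_image:
  assumes "g \<in> carrier (Sp B)" "vec.subspace U"
  shows "vec.dim (g ` U) = vec.dim U"
proof -
  have "(2 :: nat) ^ vec.dim (g ` U) = 2 ^ vec.dim U"
    using card_image[OF inj_on_subset[OF SpD(4)[OF assms(1)] subset_UNIV], of U]
      card_bit_subspace[OF assms(2)] card_bit_subspace[OF subspace_image[OF assms]] by simp
  then show ?thesis by simp
qed

lemma perp_image:
  assumes "g \<in> carrier (Sp B)"
  shows "perp B (g ` U) = g ` perp B U"
proof -
  have "x \<in> perp B (g ` U) \<longleftrightarrow> inv_into UNIV g x \<in> perp B U" for x
    using SpD(3)[OF assms, of _ "inv_into UNIV g x"] assms by (simp add: mem_perp_iff)
  moreover have "x \<in> g ` perp B U \<longleftrightarrow> inv_into UNIV g x \<in> perp B U" for x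
    by (metis (no_types, lifting) Sp_inv_simps assms image_iff)
  ultimately show ?thesis
    by blast
qed

lemma nondegenerate_image:
  assumes "g \<in> carrier (Sp B)" "nondegenerate_subspace B U"
  shows "nondegenerate_subspace B (g ` U)"
proof -
  have "g ` U \<inter> g ` perp B U = g ` (U \<inter> perp B U)"
    by (rule image_Int[OF SpD(4)[OF assms(1)], symmetric])
  then show ?thesis
    using assms subspace_image by (auto simp: nondegenerate_subspace_def perp_image)
qed

lemma isotropic_image:
  assumes "g \<in> carrier (Sp B)" "totally_isotropic B U"
  shows "totally_isotropic B (g ` U)"
  using assms subspace_image by (auto simp: totally_isotropic_def perp_image)

section \<open>Transvections\<close>

definition transvection :: "bit ^ 'm \<Rightarrow> bit ^ 'm \<Rightarrow> bit ^ 'm" where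
  "transvection v x = x + B x v *s v"

lemma transvection_simps:
  "B x v = 0 \<Longrightarrow> transvection v x = x" "B x v = 1 \<Longrightarrow> transvection v x = x + v"
  by (simp_all add: transvection_def)

lemma transvection_involution [simp]: "transvection v (transvection v x) = x"
  by (cases "B x v") (simp_all add: transvection_def add.assoc)

lemma transvection_Sp: "transvection v \<in> carrier (Sp B)"
proof -
  have "transvection v (x + y) = transvection v x + transvection v y" for x y
    by (cases "B x v"; cases "B y v") (simp_all add: transvection_def ac_simps)
  moreover have "bij (transvection v)"
    by (metis bijI' transvection_involution)
  moreover have "B (transvection v x) (transvection v y) = B x y" for x y
    by (cases "B x v"; cases "B y v") (simp_all add: transvection_def form_commute[of v] ac_simps)
  ultimately show ?thesis
    by (simp add: Sp_iff)
qed

lemma form_act_transvection: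
  assumes "\<phi> \<in> forms B"
  shows "form_act (transvection v) \<phi> = (if \<phi> v = 0 then translate \<phi> v else \<phi>)"
proof (rule form_act_eqI[OF transvection_Sp])
  fix x
  show "(if \<phi> v = 0 then translate \<phi> v else \<phi>) (transvection v x) = \<phi> x"
    by (cases "B x v"; cases "\<phi> v") (simp_all add: transvection_def translate_def forms_add[OF assms])
qed

section \<open>Witt's theorem for subspaces\<close>

lemma perp_span: "perp B (vec.span S) = perp B S"
proof
  show "perp B S \<subseteq> perp B (vec.span S)"
  proof
    fix x assume "x \<in> perp B S"
    then have "S \<subseteq> perp B {x}"
      by (auto simp: mem_perp_iff form_commute)
    then have "vec.span S \<subseteq> perp B {x}"
      using subspace_perp by (rule vec.span_minimal)
    then show "x \<in> perp B (vec.span S)"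
      using form_commute by (fastforce simp: mem_perp_iff)
  qed
qed (rule perp_antimono[OF vec.span_superset])

lemma span_insert_span:
  "vec.span (insert a (vec.span S)) = vec.span (insert a (S :: (bit ^ 'm) set))"
  "vec.span (insert a (insert b (vec.span S))) = vec.span (insert a (insert b S))"
  by (rule Set.set_eqI, simp add: bit_span_insert vec.span_span)+

lemma not_mem_subspace:
  assumes "vec.subspace U" "x \<notin> U"
  shows "\<exists>a\<in>perp B U. B x a = 1"
proof -
  have "x \<notin> perp B (perp B U)"
    using assms perp_perp by simp
  then show ?thesis
    by (auto simp: mem_perp_iff[of x] form_commute[of x])
qed

text \<open>If \<open>x\<close> and \<open>y\<close> are not orthogonal, the transvection of
  \<open>x + y\<close> does it. Otherwise the route goes through \<open>x + p\<close>, where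
  \<open>p\<close> is orthogonal to \<open>U\<close> and pairs to 1 with both vectors; such a
  \<open>p\<close> exists because neither \<open>x\<close> nor \<open>y\<close> lies in
  \<open>U\<close>, the complement of its complement.\<close>

lemma transvections_move:
  assumes U: "vec.subspace U" and xy: "x \<notin> U" "y \<notin> U" "\<And>u. u \<in> U \<Longrightarrow> B u x = B u y"
  shows "\<exists>h\<in>carrier (Sp B). h x = y \<and> (\<forall>u\<in>U. h u = u)"
proof (cases "B x y = 1")
  case True
  then have "transvection (x + y) x = y" "\<And>u. u \<in> U \<Longrightarrow> transvection (x + y) u = u"
    using xy(3) by (simp_all add: transvection_simps)
  then show ?thesis
    using transvection_Sp by blast
next
  case False
  obtain a b where "a \<in> perp B U" "B x a = 1" "b \<in> perp B U" "B y b = 1"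
    using not_mem_subspace[OF U] xy by metis
  then obtain p where p: "p \<in> perp B U" "B x p = 1" "B y p = 1"
    using common_dual_vector[OF subspace_perp] by blast
  define h where "h = transvection (x + p + y) \<circ> transvection p"
  have "h x = y"
    using p False by (simp add: h_def transvection_simps form_commute[of p] ac_simps)
  moreover have "h u = u" if "u \<in> U" for u
    using p(1) xy(3)[OF that] that by (simp add: h_def transvection_simps mem_perp_iff)
  moreover have "h \<in> carrier (Sp B)"
    unfolding h_def by (intro Sp_comp transvection_Sp)
  ultimately show ?thesis by blast
qed

text \<open>Linearly independent lists with equal Gram matrices. As \<open>B\<close> is alternating
  and symmetric, only the products of the new vector with the earlier ones have to be compared. The
  recursion follows the extension of an isometry by one vector at a time.\<close>

inductive isometric_lists :: "(bit ^ 'm) list \<Rightarrow> (bit ^ 'm) list \<Rightarrow> bool" where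
  "isometric_lists [] []"
| "isometric_lists xs ys \<Longrightarrow> x \<notin> vec.span (set xs) \<Longrightarrow> y \<notin> vec.span (set ys) \<Longrightarrow>
     map (B x) xs = map (B y) ys \<Longrightarrow> isometric_lists (x # xs) (y # ys)"

text \<open>Witt's theorem. If \<open>g\<close> already carries \<open>xs\<close> to
  \<open>ys\<close>, then \<open>g x\<close> and \<open>y\<close> have the same products with the
  span of \<open>ys\<close> and lie outside it, so a further map moves \<open>g x\<close> to
  \<open>y\<close> while fixing that span.\<close>

lemma isometric_lists_extend:
  assumes "isometric_lists xs ys"
  shows "\<exists>g\<in>carrier (Sp B). map g xs = ys"
  using assms
proof induction
  case 1
  then show ?case using Sp_id by auto
next
  case (2 xs ys x y)
  then obtain g where g: "g \<in> carrier (Sp B)" "map g xs = ys" by blast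
  have span: "vec.span (set ys) = g ` vec.span (set xs)"
    using vec.linear_span_image[OF Sp_linear[OF g(1)], of "set xs"] g(2) by auto
  have "g x \<notin> vec.span (set ys)"
    unfolding span using 2(2) SpD(4)[OF g(1)] by (simp add: inj_image_mem_iff)
  have "map (B (g x)) ys = map (B y) ys"
    using 2(4) unfolding g(2)[symmetric] by (simp add: SpD(3)[OF g(1)] comp_def)
  then have "set ys \<subseteq> perp B {g x + y}"
    by (auto simp: mem_perp_iff)
  then have *: "vec.span (set ys) \<subseteq> perp B {g x + y}"
    using subspace_perp by (rule vec.span_minimal)
  have "B u (g x) = B u y" if "u \<in> vec.span (set ys)" for u
  proof -
    have "B (g x) u + B y u = 0"
      using * that by (auto simp: mem_perp_iff)
    then show ?thesis
      by (cases "B (g x) u"; cases "B y u") (simp_all add: form_commute[of u])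
  qed
  then obtain h where h: "h \<in> carrier (Sp B)" "h (g x) = y" "\<And>u. u \<in> vec.span (set ys) \<Longrightarrow> h u = u"
    using transvections_move[OF vec.subspace_span \<open>g x \<notin> _\<close> 2(3)] by blast
  have "map (h \<circ> g) (x # xs) = y # map h (map g xs)"
    using h(2) by simp
  also have "map h (map g xs) = ys"
    unfolding g(2) using h(3) by (intro map_idI) (simp add: vec.span_base)
  finally show ?case
    using Sp_comp[OF g(1) h(1)] by (intro bexI[of _ "h \<circ> g"])
qed

lemma isometric_lists_span:
  assumes "isometric_lists xs ys"
  shows "\<exists>g\<in>carrier (Sp B). g ` vec.span (set xs) = vec.span (set ys)"
proof -
  obtain g where g: "g \<in> carrier (Sp B)" "map g xs = ys"
    using isometric_lists_extend[OF assms] by blast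
  then show ?thesis
    using vec.linear_span_image[OF Sp_linear[OF g(1)], of "set xs"] by (metis list.set_map)
qed

lemma isometric_lists_length: "isometric_lists xs ys \<Longrightarrow> length xs = length ys"
  by (induction rule: isometric_lists.induct) simp_all

text \<open>All Gram matrices are zero here, so any matching of the two independent sets will
  do.\<close>

lemma isotropic_isometric_lists:
  assumes "vec.independent S" "vec.independent S'" "card S = card S'"
    "\<And>x y. x \<in> S \<Longrightarrow> y \<in> S \<Longrightarrow> B x y = 0" "\<And>x y. x \<in> S' \<Longrightarrow> y \<in> S' \<Longrightarrow> B x y = 0"
  shows "\<exists>xs ys. isometric_lists xs ys \<and> set xs = S \<and> set ys = S'"
  using finite_bit_vec[of S] assms
proof (induction S arbitrary: S' rule: finite_induct)
  case empty
  then show ?case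
    using isometric_lists.intros(1) by auto
next
  case (insert x S)
  then have "card S' = Suc (card S)"
    by simp
  then obtain y T where y: "S' = insert y T" "y \<notin> T" "card T = card S"
    by (auto simp: card_Suc_eq)
  have "\<exists>xs ys. isometric_lists xs ys \<and> set xs = S \<and> set ys = T"
    by (rule insert.IH) (use insert.hyps insert.prems y in \<open>simp_all add: vec.independent_insert\<close>)
  then obtain xs ys where l: "isometric_lists xs ys" "set xs = S" "set ys = T"
    by blast
  have "map (B x) xs = map (\<lambda>_. 0) xs"
    using insert.prems(4)[of x] l(2) by simp
  also have "\<dots> = map (\<lambda>_. 0) ys"
    using isometric_lists_length[OF l(1)] by (simp add: map_replicate_const)
  also have "\<dots> = map (B y) ys"
    using insert.prems(5)[of y] l(3) y(1) by simp
  finally have "isometric_lists (x # xs) (y # ys)"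
    using l insert y by (intro isometric_lists.intros) (auto simp: vec.independent_insert)
  moreover have "set (x # xs) = insert x S" "set (y # ys) = S'"
    using l y by simp_all
  ultimately show ?case by blast
qed

lemma isotropic_transitive:
  assumes "totally_isotropic B U" "totally_isotropic B U'" "vec.dim U = vec.dim U'"
  shows "\<exists>g\<in>carrier (Sp B). g ` U = U'"
proof -
  have iso: "x \<in> W \<Longrightarrow> y \<in> W \<Longrightarrow> B x y = 0" if "totally_isotropic B W" for W x y
    using that by (auto simp: totally_isotropic_def mem_perp_iff)
  obtain S where S: "S \<subseteq> U" "vec.independent S" "U \<subseteq> vec.span S" "card S = vec.dim U"
    using vec.basis_exists .
  obtain S' where S': "S' \<subseteq> U'" "vec.independent S'" "U' \<subseteq> vec.span S'" "card S' = vec.dim U'"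
    using vec.basis_exists .
  have "vec.span S = U" "vec.span S' = U'"
    using S S' assms vec.span_minimal unfolding totally_isotropic_def by blast+
  moreover have "\<exists>xs ys. isometric_lists xs ys \<and> set xs = S \<and> set ys = S'"
    by (rule isotropic_isometric_lists[OF S(2) S'(2)])
      (use S S' assms(3) in \<open>auto intro: iso[OF assms(1)] iso[OF assms(2)]\<close>)
  ultimately show ?thesis
    using isometric_lists_span by metis
qed

lemma hyperbolic_pair_split:
  assumes U: "nondegenerate_subspace B U" and vw: "v \<in> U" "w \<in> U" "B v w = 1"
  defines "P \<equiv> U \<inter> perp B {v, w}"
  shows "nondegenerate_subspace B P" "card U = 4 * card P"
    "w \<notin> P" "v \<notin> vec.span (insert w P)" "vec.span (insert v (insert w P)) = U"
proof -
  note sub = nondegenerate_subspaceD[OF U]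
  have P: "vec.subspace P"
    unfolding P_def using sub(1) subspace_perp by (rule vec.subspace_inter)
  have spanP: "vec.span P = P"
    using P vec.span_eq_iff by blast
  have memP: "x \<in> P \<longleftrightarrow> x \<in> U \<and> B v x = 0 \<and> B w x = 0" for x
    by (auto simp: P_def mem_perp_iff)
  show "nondegenerate_subspace B P"
  proof (rule nondegenerate_subspaceI[OF P])
    fix x assume x: "x \<in> P" "x \<noteq> 0"
    then obtain y where y: "y \<in> U" "B x y = 1"
      using sub(2) memP by blast
    \<comment> \<open>The projection of \<open>y\<close> to \<open>P\<close> along the hyperbolic
      pair; it has the same product with \<open>x\<close>, which is orthogonal to \<open>v\<close>
      and \<open>w\<close>.\<close>
    define z where "z = y + (B y w *s v + B y v *s w)"
    have "z \<in> U"
      unfolding z_def using sub(1) y(1) vw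
      by (intro vec.subspace_add vec.subspace_scale)
    moreover have "B v z = 0" "B w z = 0" "B x z = 1"
      using x y vw(3) unfolding z_def memP
      by (cases "B y w"; cases "B y v";
          simp add: form_commute[of _ y] form_commute[of w v] form_commute[of x v] form_commute[of x w])+
    ultimately show "\<exists>y\<in>P. B x y = 1"
      using memP by blast
  qed
  show wP: "w \<notin> P"
    using vw(3) by (auto simp: memP)
  show vP: "v \<notin> vec.span (insert w P)"
    using vw(3) by (auto simp: bit_span_insert spanP memP form_commute[of w v])
  have wv: "v \<notin> vec.span {w}"
    using vec.span_mono[of "{w}" "insert w P"] vP by blast
  have "w \<noteq> 0"
    using vw(3) by auto
  then have "card (vec.span {v, w}) = 4"
    using card_bit_span_insert[OF wv] card_bit_span_insert[of w "{}"] by simp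
  moreover have "card (vec.span {v, w}) * card (U \<inter> perp B (vec.span {v, w})) = card U"
    using vw sub(1) by (intro card_perp[OF U vec.subspace_span] vec.span_minimal) auto
  ultimately show card: "card U = 4 * card P"
    by (simp add: P_def perp_span)
  show "vec.span (insert v (insert w P)) = U"
  proof (rule bit_vec_set_eqI)
    show "vec.span (insert v (insert w P)) \<subseteq> U"
      using vw sub(1) by (intro vec.span_minimal) (auto simp: memP)
    show "card (vec.span (insert v (insert w P))) = card U"
      using card_bit_span_insert[OF vP] card_bit_span_insert[of w P] wP card spanP by simp
  qed
qed

text \<open>Hyperbolic pairs are split off from both spaces in parallel. The complements of the
  pairs are again nondegenerate, of equal and smaller size, so the induction builds matching
  symplectic bases.\<close>

lemma nondegenerate_isometric_lists:
  assumes "nondegenerate_subspace B U" "nondegenerate_subspace B U'" "card U = card U'"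
  shows "\<exists>xs ys. isometric_lists xs ys \<and> vec.span (set xs) = U \<and> vec.span (set ys) = U'"
  using assms
proof (induction "card U" arbitrary: U U' rule: less_induct)
  case less
  note sub = nondegenerate_subspaceD[OF less.prems(1)] nondegenerate_subspaceD[OF less.prems(2)]
  have zero: "0 \<in> U" "0 \<in> U'"
    using sub vec.subspace_0 by auto
  show ?case
  proof (cases "U = {0}")
    case True
    then have "card U' = 1" using less.prems(3) by simp
    then have "U' = {0}" using zero by (auto simp: card_1_singleton_iff)
    with True show ?thesis
      using isometric_lists.intros(1) by fastforce
  next
    case False
    then have "card U \<noteq> 1"
      using zero by (auto simp: card_1_singleton_iff)
    then have "U' \<noteq> {0}"
      using less.prems(3) by auto
    then obtain v v' where v: "v \<in> U" "v \<noteq> 0" "v' \<in> U'" "v' \<noteq> 0"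
      using False zero by blast
    then obtain w w' where "w \<in> U" "B v w = 1" "w' \<in> U'" "B v' w' = 1"
      using sub(2)[of v] sub(4)[of v'] by blast
    with v have vw: "v \<in> U" "w \<in> U" "B v w = 1" "v' \<in> U'" "w' \<in> U'" "B v' w' = 1"
      by simp_all
    define P P' where "P = U \<inter> perp B {v, w}" and "P' = U' \<inter> perp B {v', w'}"
    note sp = hyperbolic_pair_split[OF less.prems(1) vw(1-3), folded P_def]
    note sp' = hyperbolic_pair_split[OF less.prems(2) vw(4-6), folded P'_def]
    have "0 < card P"
      using card_bit_subspace[OF nondegenerate_subspaceD(1)[OF sp(1)]] by simp
    then have "card P < card U" "card P = card P'"
      using sp(2) sp'(2) less.prems(3) by linarith+
    then obtain xs ys where l: "isometric_lists xs ys" "vec.span (set xs) = P" "vec.span (set ys) = P'"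
      using less.hyps[OF \<open>card P < card U\<close> sp(1) sp'(1) \<open>card P = card P'\<close>] by blast
    have z: "map (B c) zs = map (\<lambda>_. 0) zs"
      if "vec.span (set zs) \<subseteq> perp B {v, w}" "c \<in> {v, w}" for c v w zs
    proof -
      have "x \<in> perp B {v, w}" if "x \<in> set zs" for x
        using subsetD[OF \<open>vec.span (set zs) \<subseteq> _\<close> vec.span_base[OF that]] .
      then show ?thesis
        using \<open>c \<in> _\<close> by (auto simp: mem_perp_iff)
    qed
    have eq: "map (B c) xs = map (B c') ys" if "c \<in> {v, w}" "c' \<in> {v', w'}" for c c'
    proof -
      have "map (B c) xs = map (\<lambda>_. 0) xs"
        using l(2) that by (intro z) (auto simp: P_def)
      also have "\<dots> = map (\<lambda>_. 0) ys"
        using isometric_lists_length[OF l(1)] by (simp add: map_replicate_const)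
      also have "\<dots> = map (B c') ys"
        using l(3) that by (intro z[symmetric]) (auto simp: P'_def)
      finally show ?thesis .
    qed
    have "isometric_lists (w # xs) (w' # ys)"
      using l sp(3) sp'(3) eq[of w w'] by (simp add: isometric_lists.intros)
    then have "isometric_lists (v # w # xs) (v' # w' # ys)"
    proof (rule isometric_lists.intros)
      show "v \<notin> vec.span (set (w # xs))" "v' \<notin> vec.span (set (w' # ys))"
        using sp(4)[folded l(2)] sp'(4)[folded l(3)] by (simp_all add: span_insert_span)
      show "map (B v) (w # xs) = map (B v') (w' # ys)"
        using eq[of v v'] vw by simp
    qed
    moreover have "vec.span (set (v # w # xs)) = U" "vec.span (set (v' # w' # ys)) = U'"
      using sp(5)[folded l(2)] sp'(5)[folded l(3)] by (simp_all add: span_insert_span)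
    ultimately show ?thesis by blast
  qed
qed

lemma nondegenerate_transitive:
  assumes "nondegenerate_subspace B U" "nondegenerate_subspace B U'" "vec.dim U = vec.dim U'"
  shows "\<exists>g\<in>carrier (Sp B). g ` U = U'"
proof -
  have "card U = card U'"
    using assms nondegenerate_subspaceD(1) by (simp add: card_bit_subspace)
  then show ?thesis
    using nondegenerate_isometric_lists[OF assms(1,2)] isometric_lists_span by metis
qed

section \<open>Codewords\<close>

lemma bit_of_sign:
  fixes t :: int
  assumes "t \<in> {1, -1}"
  obtains c where "chi c = t"
  using assms that[of 0] that[of 1] by auto

text \<open>The type on the complement is forced by the type on \<open>U\<close> and the total type,
  because Gauss sums are multiplicative over the orthogonal splitting. This leaves one condition per
  codeword.\<close>

lemma nondegenerate_word:
  assumes U: "nondegenerate_subspace B U" "vec.dim U = 2 * d" and s: "s \<in> {1, -1}"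
  shows "{\<phi> \<in> forms_of_type B \<epsilon>. has_type \<phi> U s \<and> has_type \<phi> (perp B U) (\<epsilon> * s)} =
    {\<phi> \<in> forms_of_type B \<epsilon>. gauss_sum \<phi> U = s * 2 ^ d}"
proof -
  have "has_type \<phi> (perp B U) (\<epsilon> * s)" if \<phi>: "\<phi> \<in> forms_of_type B \<epsilon>" "gauss_sum \<phi> U = s * 2 ^ d" for \<phi>
  proof -
    have f: "\<phi> \<in> forms B" "\<epsilon> \<in> {1, -1}" "gauss_sum \<phi> UNIV = \<epsilon> * 2 ^ n"
      using \<phi>(1) by (auto simp: forms_of_type_iff)
    have dim: "2 * d + vec.dim (perp B U) = 2 * n"
      using dim_perp[OF nondegenerate_subspaceD(1)[OF U(1)]] U(2) card_index by simp
    then have dn: "vec.dim (perp B U) = 2 * (n - d)" "d \<le> n"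
      by simp_all
    have "(2 :: int) ^ n = 2 ^ d * 2 ^ (n - d)"
      using dn(2) by (simp flip: power_add)
    then have "s * 2 ^ d * gauss_sum \<phi> (perp B U) = \<epsilon> * 2 ^ d * 2 ^ (n - d)"
      using gauss_sum_split[OF f(1) U(1)] f(3) \<phi>(2) by simp
    then have "gauss_sum \<phi> (perp B U) = \<epsilon> * s * 2 ^ (n - d)"
      using s f(2) by auto
    moreover have "\<epsilon> * s \<in> {1, -1}"
      using s f(2) by auto
    ultimately show ?thesis
      unfolding has_type_iff[OF f(1) nondegenerate_perp[OF U(1)] dn(1)] by simp
  qed
  moreover have "has_type \<phi> U s \<longleftrightarrow> gauss_sum \<phi> U = s * 2 ^ d" if "\<phi> \<in> forms_of_type B \<epsilon>" for \<phi>
    using has_type_iff[OF forms_of_type_subset[OF that] U] s by simp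
  ultimately show ?thesis
    by (intro Collect_cong) blast
qed

text \<open>Every form is a translate of one fixed \<open>\<phi>\<close> by some
  \<open>u + w\<close> along the splitting, and membership in the word becomes two independent
  conditions, one on \<open>\<phi> u\<close> and one on \<open>\<phi> w\<close>. Each is counted as
  a level set, with a factor 2; hence the 4.\<close>

lemma card_nondegenerate_word:
  assumes ex: "\<phi> \<in> forms B" and U: "nondegenerate_subspace B U" "vec.dim U = 2 * d"
    and s: "s \<in> {1, -1}" "\<epsilon> \<in> {1, -1}"
  shows "4 * int (card {\<phi> \<in> forms_of_type B \<epsilon>. gauss_sum \<phi> U = s * 2 ^ d}) =
    2 ^ n * (2 ^ d + s) * (2 ^ (n - d) + \<epsilon> * s)"
proof -
  note sub = nondegenerate_subspaceD(1)[OF U(1)]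
  define P where "P = perp B U"
  have P: "nondegenerate_subspace B P" "vec.subspace P"
    unfolding P_def using nondegenerate_perp[OF U(1)] subspace_perp by auto
  have "2 * d + vec.dim P = 2 * n"
    using dim_perp[OF sub] U(2) card_index by (simp add: P_def)
  then have dn: "vec.dim P = 2 * (n - d)" "d \<le> n"
    by simp_all
  then have pow: "(2 :: int) ^ n = 2 ^ d * 2 ^ (n - d)"
    by (simp flip: power_add)
  obtain a where a: "a \<in> {1, -1}" "gauss_sum \<phi> U = a * 2 ^ d"
    using gauss_sum_cases[OF ex U] .
  obtain b where b: "b \<in> {1, -1}" "gauss_sum \<phi> P = b * 2 ^ (n - d)"
    using gauss_sum_cases[OF ex P(1) dn(1)] .
  have V: "gauss_sum \<phi> UNIV = a * b * 2 ^ n"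
    using gauss_sum_split[OF ex U(1)] a(2) b(2) pow by (simp add: P_def)
  \<comment> \<open>\<open>c\<close> corrects the sign on \<open>U\<close> from \<open>a\<close> to
    \<open>s\<close>, and \<open>c'\<close> corrects the sign on the complement from
    \<open>b\<close> to \<open>\<epsilon> * s\<close>.\<close>
  obtain c where c: "chi c = s * a"
    using bit_of_sign[of "s * a"] s a by auto
  obtain c' where c': "chi c' = \<epsilon> * s * b"
    using bit_of_sign[of "\<epsilon> * s * b"] s b by auto
  let ?W = "{\<phi> \<in> forms_of_type B \<epsilon>. gauss_sum \<phi> U = s * 2 ^ d}"
  let ?A = "{u \<in> U. \<phi> u = c}" and ?A' = "{w \<in> P. \<phi> w = c'}"
  have mem: "translate \<phi> (u + w) \<in> ?W \<longleftrightarrow> \<phi> u = c \<and> \<phi> w = c'" if "u \<in> U" "w \<in> P" for u w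
  proof -
    have "gauss_sum (translate \<phi> (u + w)) U = chi (\<phi> u) * a * 2 ^ d"
      using gauss_sum_translate[OF ex sub, of u w] that a by (simp add: P_def)
    moreover have "\<phi> (u + w) = \<phi> u + \<phi> w"
      using that by (simp add: forms_add[OF ex] P_def mem_perp_iff)
    then have "gauss_sum (translate \<phi> (u + w)) UNIV = chi (\<phi> u) * chi (\<phi> w) * (a * b) * 2 ^ n"
      using gauss_sum_translate_UNIV[OF ex, of "u + w"] V by (simp add: chi_add)
    ultimately have "translate \<phi> (u + w) \<in> ?W \<longleftrightarrow>
        chi (\<phi> u) * a = s \<and> chi (\<phi> u) * chi (\<phi> w) * (a * b) = \<epsilon>"
      using translate_forms[OF ex] s by (simp add: forms_of_type_iff conj_commute)
    also have "\<dots> \<longleftrightarrow> chi (\<phi> u) = s * a \<and> chi (\<phi> w) = \<epsilon> * s * b"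
      using s a(1) b(1) by auto
    also have "\<dots> \<longleftrightarrow> \<phi> u = c \<and> \<phi> w = c'"
      by (simp flip: c c')
    finally show ?thesis .
  qed
  have "bij_betw (\<lambda>(u, w). translate \<phi> (u + w)) (?A \<times> ?A') ?W"
  proof (rule bij_betw_imageI)
    have "inj_on (\<lambda>(u, w). u + w) (U \<times> P)"
      using nondegenerate_decomposition_bij[OF U(1)] by (simp add: P_def bij_betw_def)
    then show "inj_on (\<lambda>(u, w). translate \<phi> (u + w)) (?A \<times> ?A')"
      by (auto simp: inj_on_def)
    show "(\<lambda>(u, w). translate \<phi> (u + w)) ` (?A \<times> ?A') = ?W"
    proof
      show "?W \<subseteq> (\<lambda>(u, w). translate \<phi> (u + w)) ` (?A \<times> ?A')"
      proof
        fix \<psi> assume \<psi>: "\<psi> \<in> ?W"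
        then obtain v where v: "\<psi> = translate \<phi> v"
          using forms_translate[OF ex] forms_of_type_subset by blast
        obtain u w where uw: "u \<in> U" "w \<in> P" "v = u + w"
          using nondegenerate_decomposition[OF U(1)] unfolding P_def .
        then show "\<psi> \<in> (\<lambda>(u, w). translate \<phi> (u + w)) ` (?A \<times> ?A')"
          using mem[OF uw(1,2)] \<psi> v by auto
      qed
      show "(\<lambda>(u, w). translate \<phi> (u + w)) ` (?A \<times> ?A') \<subseteq> ?W"
      proof (rule image_subsetI, unfold split_paired_all mem_Times_iff fst_conv snd_conv prod.case)
        fix u w assume "u \<in> ?A \<and> w \<in> ?A'"
        then show "translate \<phi> (u + w) \<in> ?W"
          using mem[of u w] by blast
      qed
    qed
  qed
  then have "card ?W = card ?A * card ?A'"
    by (simp add: bij_betw_same_card[symmetric] card_cartesian_product)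
  then have "4 * int (card ?W) = (2 * int (card ?A)) * (2 * int (card ?A'))"
    by simp
  also have "\<dots> = (2 ^ (2 * d) + s * 2 ^ d) * (2 ^ (2 * (n - d)) + \<epsilon> * s * 2 ^ (n - d))"
  proof -
    have "2 * int (card ?A) = 2 ^ (2 * d) + s * 2 ^ d"
      unfolding card_level_set using a s
      by (auto simp: c card_bit_subspace sub U(2) simp flip: gauss_sum_def)
    moreover have "2 * int (card ?A') = 2 ^ (2 * (n - d)) + \<epsilon> * s * 2 ^ (n - d)"
      unfolding card_level_set using b s
      by (auto simp: c' card_bit_subspace P dn simp flip: gauss_sum_def)
    ultimately show ?thesis by simp
  qed
  also have "\<dots> = 2 ^ n * (2 ^ d + s) * (2 ^ (n - d) + \<epsilon> * s)"
    unfolding pow by (simp only: mult_2 power_add) (simp add: algebra_simps)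
  finally show ?thesis .
qed

text \<open>The case \<open>U = UNIV\<close> of the previous count, where the factor of the zero
  complement is \<open>1 + \<epsilon> * \<epsilon> = 2\<close>.\<close>

lemma card_forms_of_type:
  assumes "\<phi> \<in> forms B" "\<epsilon> \<in> {1, -1}"
  shows "2 * int (card (forms_of_type B \<epsilon>)) = 2 ^ n * (2 ^ n + \<epsilon>)"
proof -
  have "{\<phi> \<in> forms_of_type B \<epsilon>. gauss_sum \<phi> UNIV = \<epsilon> * 2 ^ n} = forms_of_type B \<epsilon>"
    by (auto simp: forms_of_type_iff)
  then have "4 * int (card (forms_of_type B \<epsilon>)) = 2 ^ n * (2 ^ n + \<epsilon>) * (2 ^ (n - n) + \<epsilon> * \<epsilon>)"
    using card_nondegenerate_word[OF assms(1) nondegenerate_UNIV dim_UNIV assms(2,2)] by simp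
  moreover have "\<epsilon> * \<epsilon> = 1"
    using assms(2) by auto
  ultimately show ?thesis by simp
qed

lemma isotropic_additive:
  assumes "\<phi> \<in> forms B" "totally_isotropic B U" "x \<in> U" "y \<in> U"
  shows "\<phi> (x + y) = \<phi> x + \<phi> y"
  using assms by (auto simp: totally_isotropic_def mem_perp_iff forms_add)

text \<open>A suitable translate \<open>\<theta>\<close> of \<open>\<phi>\<close> vanishes on
  \<open>U\<close>, and the forms vanishing on \<open>U\<close> are the translates of
  \<open>\<theta>\<close> by vectors orthogonal to \<open>U\<close>. The type condition selects a
  level set of \<open>\<theta>\<close> on this complement, where \<open>\<theta>\<close> has the
  same Gauss sum as on the whole space.\<close>

lemma card_isotropic_word:
  assumes ex: "\<phi> \<in> forms B" and U: "totally_isotropic B U" and \<epsilon>: "\<epsilon> \<in> {1, -1}"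
  shows "2 * int (card {\<phi> \<in> forms_of_type B \<epsilon>. U \<subseteq> Sing \<phi>}) = 2 ^ (2 * n - vec.dim U) + \<epsilon> * 2 ^ n"
proof -
  have sub: "vec.subspace U" and iso: "U \<subseteq> perp B U"
    using U by (auto simp: totally_isotropic_def)
  obtain z where z: "\<And>u. u \<in> U \<Longrightarrow> \<phi> u = B u z"
    using additive_representation[OF sub, of \<phi>] isotropic_additive[OF ex U] by blast
  define \<theta> where "\<theta> = translate \<phi> z"
  have \<theta>: "\<theta> \<in> forms B" "U \<subseteq> Sing \<theta>"
    using z translate_forms[OF ex] by (auto simp: \<theta>_def translate_def Sing_def)
  obtain a where a: "a \<in> {1, -1}" "gauss_sum \<theta> UNIV = a * 2 ^ n"
    using gauss_sum_cases[OF \<theta>(1) nondegenerate_UNIV dim_UNIV] .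
  obtain c where c: "chi c = \<epsilon> * a"
    using bit_of_sign[of "\<epsilon> * a"] \<epsilon> a by auto
  let ?W = "{\<phi> \<in> forms_of_type B \<epsilon>. U \<subseteq> Sing \<phi>}" and ?A = "{v \<in> perp B U. \<theta> v = c}"
  have mem: "translate \<theta> v \<in> ?W \<longleftrightarrow> v \<in> ?A" for v
  proof -
    have "translate \<theta> v \<in> forms_of_type B \<epsilon> \<longleftrightarrow> chi (\<theta> v) * a = \<epsilon>"
      using translate_forms[OF \<theta>(1)] \<epsilon> gauss_sum_translate_UNIV[OF \<theta>(1), of v] a(2)
      by (simp add: forms_of_type_iff)
    also have "\<dots> \<longleftrightarrow> chi (\<theta> v) = chi c"
      unfolding c using \<epsilon> a(1) by auto
    moreover have "U \<subseteq> Sing (translate \<theta> v) \<longleftrightarrow> v \<in> perp B U"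
      using \<theta>(2) by (simp add: Sing_def translate_def mem_perp_iff subset_iff Ball_def)
    ultimately show ?thesis
      unfolding mem_Collect_eq chi_eq_iff by blast
  qed
  have img: "translate \<theta> ` ?A = ?W"
  proof
    show "?W \<subseteq> translate \<theta> ` ?A"
    proof
      fix \<psi> assume \<psi>: "\<psi> \<in> ?W"
      then obtain v where v: "\<psi> = translate \<theta> v"
        using forms_translate[OF \<theta>(1)] forms_of_type_subset by blast
      with \<psi> have "v \<in> ?A"
        using mem by blast
      with v show "\<psi> \<in> translate \<theta> ` ?A"
        by (rule image_eqI)
    qed
  qed (use mem in blast)
  have inj: "inj_on (translate \<theta>) ?A"
    by (simp add: inj_on_def)
  have "card ?W = card ?A"
    using card_image[OF inj] unfolding img .
  then have "2 * int (card ?W) = int (card (perp B U)) + chi c * gauss_sum \<theta> (perp B U)"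
    by (simp add: card_level_set gauss_sum_def)
  also have "gauss_sum \<theta> (perp B U) = a * 2 ^ n"
    using gauss_sum_perp[OF \<theta>(1) vec.subspace_UNIV sub _ \<theta>(2)] a by simp
  also have "int (card (perp B U)) = 2 ^ (2 * n - vec.dim U)"
  proof -
    have "vec.dim (perp B U) = 2 * n - vec.dim U"
      using dim_perp[OF sub] card_index by linarith
    then show ?thesis
      by (simp add: card_bit_subspace[OF subspace_perp])
  qed
  finally show ?thesis
    using a(1) c by auto
qed

lemma dim_isotropic_le:
  assumes "totally_isotropic B U"
  shows "vec.dim U \<le> n"
  using dim_perp[of U] vec.dim_subset[of U "perp B U"] assms card_index
  by (auto simp: totally_isotropic_def)

text \<open>\<open>\<phi>\<close> is additive on \<open>U\<close>, so its zeros there form a kernel,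
  which is all of \<open>U\<close> or a hyperplane. Thus \<open>\<delta>\<close> only records
  whether \<open>\<phi>\<close> vanishes on \<open>U\<close>.\<close>

lemma dim_Sing_isotropic:
  assumes \<phi>: "\<phi> \<in> forms B" and U: "totally_isotropic B U"
  shows "vec.dim (Sing \<phi> \<inter> U) = (if U \<subseteq> Sing \<phi> then vec.dim U else vec.dim U - 1)"
proof (cases "U \<subseteq> Sing \<phi>")
  case False
  have sub: "vec.subspace U"
    using U by (simp add: totally_isotropic_def)
  have K: "vec.subspace (Sing \<phi> \<inter> U)"
    using isotropic_additive[OF \<phi> U] sub \<phi> by (auto simp: bit_subspace_iff Sing_def)
  have "2 * int (card {x \<in> U. \<phi> x = 0}) = int (card U)"
    using chi_sum_additive[OF sub isotropic_additive[OF \<phi> U]] False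
    by (auto simp: card_level_set Sing_def)
  then have "2 * int (card (Sing \<phi> \<inter> U)) = int (card U)"
    by (simp add: Sing_def Int_def conj_commute)
  then have "2 * card (Sing \<phi> \<inter> U) = card U"
    by linarith
  then have "(2 :: nat) ^ Suc (vec.dim (Sing \<phi> \<inter> U)) = 2 ^ vec.dim U"
    by (simp add: card_bit_subspace K sub)
  then have "Suc (vec.dim (Sing \<phi> \<inter> U)) = vec.dim U"
    by (simp only: power_inject_exp)
  with False show ?thesis by simp
qed (simp add: Int_absorb1)

section \<open>The two families of codes as orbits of single codewords\<close>

lemma form_act_word:
  assumes "g \<in> carrier (Sp B)" "\<And>\<phi>. P' (form_act g \<phi>) \<longleftrightarrow> P \<phi>"
  shows "form_act g ` {\<phi> \<in> forms_of_type B \<epsilon>. P \<phi>} = {\<phi> \<in> forms_of_type B \<epsilon>. P' \<phi>}"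
proof
  show "{\<phi> \<in> forms_of_type B \<epsilon>. P' \<phi>} \<subseteq> form_act g ` {\<phi> \<in> forms_of_type B \<epsilon>. P \<phi>}"
  proof
    fix \<phi> assume \<phi>: "\<phi> \<in> {\<phi> \<in> forms_of_type B \<epsilon>. P' \<phi>}"
    then have "form_act (inv_into UNIV g) \<phi> \<in> {\<phi> \<in> forms_of_type B \<epsilon>. P \<phi>}"
      using form_act_type[OF Sp_inv[OF assms(1)]] assms(2)[of "form_act (inv_into UNIV g) \<phi>"] assms(1)
      by simp
    then show "\<phi> \<in> form_act g ` {\<phi> \<in> forms_of_type B \<epsilon>. P \<phi>}"
      by (rule image_eqI[rotated]) (simp add: assms(1))
  qed
qed (use assms form_act_type in blast)

text \<open>Shared by both families: \<open>Q\<close> is the kind of subspace that indexes the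
  words, \<open>w'\<close> a word as the definition of the code gives it, and \<open>w\<close> its
  reduced, visibly equivariant description.\<close>

lemma orbit_reindex:
  assumes "\<And>g. g \<in> carrier (Sp B) \<Longrightarrow> Q (g ` U)" "\<And>U'. Q U' \<Longrightarrow> \<exists>g\<in>carrier (Sp B). g ` U = U'"
    and "\<And>g. g \<in> carrier (Sp B) \<Longrightarrow> w (g ` U) = form_act g ` w U"
    and "\<And>U'. Q U' \<Longrightarrow> w' U' = w U'"
  shows "{w' U' | U'. Q U'} = {form_act g ` w U | g. g \<in> carrier (Sp B)}"
proof
  show "{w' U' | U'. Q U'} \<subseteq> {form_act g ` w U | g. g \<in> carrier (Sp B)}"
  proof clarify
    fix U' assume "Q U'"
    then obtain g where "g \<in> carrier (Sp B)" "g ` U = U'"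
      using assms(2) by blast
    then show "\<exists>g. w' U' = form_act g ` w U \<and> g \<in> carrier (Sp B)"
      using assms(3)[of g] assms(4)[OF \<open>Q U'\<close>] by auto
  qed
  show "{form_act g ` w U | g. g \<in> carrier (Sp B)} \<subseteq> {w' U' | U'. Q U'}"
  proof clarify
    fix g assume "g \<in> carrier (Sp B)"
    then show "\<exists>U'. form_act g ` w U = w' U' \<and> Q U'"
      using assms(1,3)[of g] assms(4)[of "g ` U"] by (intro exI[of _ "g ` U"]) simp
  qed
qed

lemma nondegenerate_code_eq:
  assumes U: "nondegenerate_subspace B U" "vec.dim U = 2 * d" and s: "s \<in> {1, -1}"
  shows "nondegenerate_code B d \<epsilon> s =
    {form_act g ` {\<phi> \<in> forms_of_type B \<epsilon>. gauss_sum \<phi> U = s * 2 ^ d} | g. g \<in> carrier (Sp B)}"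
  unfolding nondegenerate_code_def
proof (rule orbit_reindex)
  fix g assume g: "g \<in> carrier (Sp B)"
  show "nondegenerate_subspace B (g ` U) \<and> vec.dim (g ` U) = 2 * d"
    using nondegenerate_image[OF g U(1)] dim_image[OF g nondegenerate_subspaceD(1)[OF U(1)]] U(2) by simp
  show "{\<phi> \<in> forms_of_type B \<epsilon>. gauss_sum \<phi> (g ` U) = s * 2 ^ d} =
      form_act g ` {\<phi> \<in> forms_of_type B \<epsilon>. gauss_sum \<phi> U = s * 2 ^ d}"
    by (rule form_act_word[OF g, symmetric]) (simp add: gauss_sum_act[OF g])
qed (use nondegenerate_transitive[OF U(1)] U(2) nondegenerate_word[OF _ _ s] in simp_all)

lemma Sing_act:
  assumes "g \<in> carrier (Sp B)"
  shows "g ` U \<subseteq> Sing (form_act g \<phi>) \<longleftrightarrow> U \<subseteq> Sing \<phi>"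
  using assms by (auto simp: Sing_def)

lemma isotropic_code_eq:
  assumes U: "totally_isotropic B U" "vec.dim U = d" "1 \<le> d" and \<delta>: "\<delta> \<in> {0, 1}"
  shows "isotropic_code B d \<epsilon> \<delta> =
    {form_act g ` {\<phi> \<in> forms_of_type B \<epsilon>. U \<subseteq> Sing \<phi> \<longleftrightarrow> \<delta> = 0} | g. g \<in> carrier (Sp B)}"
  unfolding isotropic_code_def
proof (rule orbit_reindex)
  fix g assume g: "g \<in> carrier (Sp B)"
  show "totally_isotropic B (g ` U) \<and> vec.dim (g ` U) = d"
    using isotropic_image[OF g U(1)] dim_image[OF g, of U] U(1,2) by (simp add: totally_isotropic_def)
  show "{\<phi> \<in> forms_of_type B \<epsilon>. g ` U \<subseteq> Sing \<phi> \<longleftrightarrow> \<delta> = 0} =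
      form_act g ` {\<phi> \<in> forms_of_type B \<epsilon>. U \<subseteq> Sing \<phi> \<longleftrightarrow> \<delta> = 0}"
    by (rule form_act_word[OF g, symmetric]) (simp only: Sing_act[OF g])
next
  fix U' assume U': "totally_isotropic B U' \<and> vec.dim U' = d"
  then show "\<exists>g\<in>carrier (Sp B). g ` U = U'"
    using isotropic_transitive[OF U(1)] U(2) by simp
  have "vec.dim (Sing \<phi> \<inter> U') = d - \<delta> \<longleftrightarrow> (U' \<subseteq> Sing \<phi> \<longleftrightarrow> \<delta> = 0)" if "\<phi> \<in> forms_of_type B \<epsilon>" for \<phi>
    using dim_Sing_isotropic[OF forms_of_type_subset[OF that], of U'] U' \<delta> U(3) by auto
  then show "{\<phi> \<in> forms_of_type B \<epsilon>. vec.dim (Sing \<phi> \<inter> U') = d - \<delta>} =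
      {\<phi> \<in> forms_of_type B \<epsilon>. U' \<subseteq> Sing \<phi> \<longleftrightarrow> \<delta> = 0}"
    by (intro Collect_cong) blast
qed

text \<open>Translation produces a form with the required values on \<open>U\<close>, possibly of
  the wrong type. In that case a further translation by a vector \<open>w\<close> of
  \<open>U\<close> on which this form is 1 changes the type, and it preserves the values on
  \<open>U\<close> because \<open>U\<close> is totally isotropic.\<close>

lemma isotropic_restriction_extends:
  assumes "\<phi> \<in> forms_of_type B \<epsilon>" "totally_isotropic B U" "a \<notin> perp B U"
  obtains \<eta> where "\<eta> \<in> forms_of_type B \<epsilon>" "\<And>u. u \<in> U \<Longrightarrow> \<eta> u = B u a"
proof -
  have \<phi>: "\<phi> \<in> forms B"
    using assms(1) by (rule forms_of_type_subset)
  have sub: "vec.subspace U" and iso: "U \<subseteq> perp B U"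
    using assms(2) by (auto simp: totally_isotropic_def)
  obtain z where z: "\<And>u. u \<in> U \<Longrightarrow> \<phi> u = B u z"
    using additive_representation[OF sub, of \<phi>] isotropic_additive[OF \<phi> assms(2)] by blast
  define \<psi> where "\<psi> = translate \<phi> (z + a)"
  have \<psi>: "\<psi> \<in> forms B" "\<And>u. u \<in> U \<Longrightarrow> \<psi> u = B u a"
    using z translate_forms[OF \<phi>, of "z + a"] by (simp_all add: \<psi>_def) (simp add: translate_def)
  obtain w where w: "w \<in> U" "B w a = 1"
    using assms(3) by (auto simp: mem_perp_iff)
  obtain s where s: "s \<in> {1, -1}" "gauss_sum \<psi> UNIV = s * 2 ^ n"
    using gauss_sum_cases[OF \<psi>(1) nondegenerate_UNIV dim_UNIV] .
  show thesis
  proof (cases "s = \<epsilon>")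
    case True
    then show ?thesis
      using \<psi> s by (intro that[of \<psi>]) (auto simp: forms_of_type_iff)
  next
    case False
    have \<epsilon>: "\<epsilon> \<in> {1, -1}"
      using assms(1) by (simp add: forms_of_type_iff)
    have "gauss_sum (translate \<psi> w) UNIV = - s * 2 ^ n"
      using gauss_sum_translate_UNIV[OF \<psi>(1), of w] \<psi>(2)[OF w(1)] w(2) s(2) by simp
    then have "translate \<psi> w \<in> forms_of_type B \<epsilon>"
      using False s(1) \<epsilon> translate_forms[OF \<psi>(1)] by (auto simp: forms_of_type_iff)
    moreover have "translate \<psi> w u = B u a" if "u \<in> U" for u
    proof -
      have "B u w = 0"
        using iso w(1) that by (auto simp: mem_perp_iff)
      then show ?thesis
        using \<psi>(2)[OF that] by (simp add: translate_def)
    qed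
    ultimately show ?thesis by (rule that)
  qed
qed

text \<open>Here the restrictions to \<open>U\<close> are exactly the nonzero functionals on
  \<open>U\<close>. They are represented by vectors modulo the complement of \<open>U\<close> and
  split into the classes \<open>T X\<close> and \<open>T Y\<close>. Since \<open>X\<close> absorbs
  sums of an element of \<open>X\<close> and one of \<open>Y\<close>, the class \<open>T Y\<close>
  together with zero is closed under addition, hence a subspace \<open>A\<close>. Its complement
  \<open>W\<close> lies in \<open>U\<close>, and a form vanishes on \<open>W\<close> exactly if its
  functional belongs to \<open>A\<close>.\<close>

lemma isotropic_restriction_classes:
  assumes U: "totally_isotropic B U" and nz: "\<And>\<phi>. \<phi> \<in> forms_of_type B \<epsilon> \<Longrightarrow> \<not> U \<subseteq> Sing \<phi>"
    and XY: "X \<union> Y = forms_of_type B \<epsilon>" "X \<noteq> {}"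
    and sep: "\<And>\<phi> \<psi>. \<phi> \<in> X \<Longrightarrow> \<psi> \<in> Y \<Longrightarrow> \<exists>u\<in>U. \<phi> u \<noteq> \<psi> u"
    and sum: "\<And>\<phi> \<psi> \<eta>. \<phi> \<in> X \<Longrightarrow> \<psi> \<in> Y \<Longrightarrow> \<eta> \<in> forms_of_type B \<epsilon> \<Longrightarrow>
      (\<And>u. u \<in> U \<Longrightarrow> \<eta> u = \<phi> u + \<psi> u) \<Longrightarrow> \<eta> \<in> X"
  shows "\<exists>W. totally_isotropic B W \<and> W \<noteq> {0} \<and> {\<phi> \<in> forms_of_type B \<epsilon>. W \<subseteq> Sing \<phi>} = Y"
proof -
  have sub: "vec.subspace U" and iso: "U \<subseteq> perp B U"
    using U by (auto simp: totally_isotropic_def)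
  obtain \<phi>0 where \<phi>0: "\<phi>0 \<in> X"
    using XY(2) by blast
  then have \<phi>0Q: "\<phi>0 \<in> forms_of_type B \<epsilon>"
    using XY(1) by blast
  define R where "R \<phi> a \<longleftrightarrow> (\<forall>u\<in>U. \<phi> u = B u a)" for \<phi> a
  define T where "T Z = {a. \<exists>\<phi>\<in>Z. R \<phi> a}" for Z
  have R_ex: "\<exists>a. R \<phi> a" if "\<phi> \<in> forms_of_type B \<epsilon>" for \<phi>
    unfolding R_def using that
    by (intro additive_representation[OF sub] isotropic_additive[OF forms_of_type_subset U])
  have R_nz: "a \<notin> perp B U" if "\<phi> \<in> forms_of_type B \<epsilon>" "R \<phi> a" for \<phi> a
    using nz[OF that(1)] that(2) by (auto simp: R_def Sing_def mem_perp_iff)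
  have disj: "a \<notin> T Y" if "a \<in> T X" for a
    using that sep by (fastforce simp: T_def R_def)
  have cover: "a \<in> T X \<or> a \<in> T Y" if na: "a \<notin> perp B U" for a
  proof -
    obtain \<eta> where "\<eta> \<in> forms_of_type B \<epsilon>" "\<And>u. u \<in> U \<Longrightarrow> \<eta> u = B u a"
      using isotropic_restriction_extends[OF \<phi>0Q U na] by blast
    then have "R \<eta> a" "\<eta> \<in> X \<or> \<eta> \<in> Y"
      using XY(1) by (simp add: R_def, blast)
    then show ?thesis
      unfolding T_def by blast
  qed
  have T_sum: "a + b \<in> T X" if ab: "a \<in> T X" "b \<in> T Y" for a b
  proof -
    obtain \<phi> \<psi> where p: "\<phi> \<in> X" "R \<phi> a" "\<psi> \<in> Y" "R \<psi> b"
      using ab by (auto simp: T_def)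
    obtain u where u: "u \<in> U" "\<phi> u \<noteq> \<psi> u"
      using sep[OF p(1,3)] by blast
    then have "B u (a + b) \<noteq> 0"
      using p(2,4) by (cases "B u a"; cases "B u b") (simp_all add: R_def)
    then have "a + b \<notin> perp B U"
      using u(1) by (auto simp: mem_perp_iff)
    then obtain \<eta> where \<eta>: "\<eta> \<in> forms_of_type B \<epsilon>" "\<And>u. u \<in> U \<Longrightarrow> \<eta> u = B u (a + b)"
      using isotropic_restriction_extends[OF \<phi>0Q U] by blast
    have "\<eta> \<in> X"
      using p \<eta>(2) by (intro sum[OF p(1,3) \<eta>(1)]) (simp add: R_def)
    moreover have "R \<eta> (a + b)"
      unfolding R_def using \<eta>(2) by blast
    ultimately show ?thesis
      unfolding T_def by blast
  qed
  have T_shift: "a + v \<in> T Z" if av: "a \<in> T Z" "v \<in> perp B U" for a v Z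
  proof -
    obtain \<phi> where "\<phi> \<in> Z" "R \<phi> a"
      using av(1) by (auto simp: T_def)
    moreover from this have "R \<phi> (a + v)"
      using av(2) by (simp add: R_def mem_perp_iff)
    ultimately show ?thesis
      unfolding T_def by blast
  qed
  define A where "A = perp B U \<union> T Y"
  have A: "vec.subspace A"
    unfolding bit_subspace_iff
  proof (intro conjI ballI)
    show "0 \<in> A"
      using vec.subspace_0[OF subspace_perp] by (simp add: A_def)
    fix x y assume "x \<in> A" "y \<in> A"
    then consider "x \<in> perp B U" "y \<in> perp B U" | "x \<in> perp B U" "y \<in> T Y" | "x \<in> T Y" "y \<in> perp B U"
      | "x \<in> T Y" "y \<in> T Y"
      by (auto simp: A_def)
    then show "x + y \<in> A"
    proof cases
      case 1
      then show ?thesis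
        unfolding A_def using vec.subspace_add[OF subspace_perp] by blast
    next
      case 2
      then show ?thesis
        using T_shift[of y Y x] by (simp add: A_def add.commute)
    next
      case 3
      then show ?thesis
        using T_shift[of x Y y] by (simp add: A_def)
    next
      case 4
      \<comment> \<open>Otherwise \<open>x\<close>, being the sum of \<open>x + y\<close> and
        \<open>y\<close>, would lie in \<open>T X\<close>.\<close>
      have "x + y \<notin> T X"
        using T_sum[of "x + y" y] disj[of x] 4 by (auto simp: add.assoc bit_vec_add_self)
      then show ?thesis
        using cover[of "x + y"] by (auto simp: A_def)
    qed
  qed
  define W where "W = perp B A"
  have perpW: "perp B W = A"
    unfolding W_def by (rule perp_perp[OF A])
  have WU: "W \<subseteq> U"
    using perp_antimono[of "perp B U" A] perp_perp[OF sub] by (simp add: A_def W_def)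
  have "W \<subseteq> perp B W"
    using WU iso perp_antimono[OF WU] by blast
  then have tiW: "totally_isotropic B W"
    by (simp add: totally_isotropic_def W_def subspace_perp)
  have mem: "W \<subseteq> Sing \<phi> \<longleftrightarrow> \<phi> \<in> Y" if \<phi>: "\<phi> \<in> forms_of_type B \<epsilon>" for \<phi>
  proof -
    obtain a where a: "R \<phi> a"
      using R_ex[OF \<phi>] by blast
    have "W \<subseteq> Sing \<phi> \<longleftrightarrow> a \<in> perp B W"
      using a WU by (auto simp: Sing_def R_def mem_perp_iff subset_iff)
    also have "\<dots> \<longleftrightarrow> a \<in> T Y"
      unfolding perpW A_def using R_nz[OF \<phi> a] by blast
    also have "\<dots> \<longleftrightarrow> \<phi> \<in> Y"
    proof
      assume "a \<in> T Y"
      then have "a \<notin> T X"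
        using disj by blast
      then show "\<phi> \<in> Y"
        using a \<phi> XY(1) unfolding T_def by blast
    qed (use a in \<open>auto simp: T_def\<close>)
    finally show ?thesis .
  qed
  have "\<phi>0 \<notin> Y"
    using sep[OF \<phi>0] by blast
  then have "W \<noteq> {0}"
    using mem[OF \<phi>0Q] forms_of_type_subset[OF \<phi>0Q] by (auto simp: Sing_def)
  moreover have "{\<phi> \<in> forms_of_type B \<epsilon>. W \<subseteq> Sing \<phi>} = Y"
    using mem XY(1) by blast
  ultimately show ?thesis
    using tiW by blast
qed

end

section \<open>Codewords with a flag-transitive stabiliser\<close>

locale transitive_codeword = symplectic_space B n
  for B :: "bit ^ 'm \<Rightarrow> bit ^ 'm \<Rightarrow> bit" and n :: nat +
  fixes \<epsilon> :: int and \<Delta> :: "(bit ^ 'm \<Rightarrow> bit) set"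
  assumes codeword_subset: "\<Delta> \<subseteq> forms_of_type B \<epsilon>"
    and codeword_nonempty: "\<Delta> \<noteq> {}" "forms_of_type B \<epsilon> - \<Delta> \<noteq> {}"
    and flag_transitive: "\<lbrakk>\<phi> \<in> \<Delta>; \<phi>' \<in> \<Delta>; \<psi> \<in> forms_of_type B \<epsilon> - \<Delta>; \<psi>' \<in> forms_of_type B \<epsilon> - \<Delta>\<rbrakk> \<Longrightarrow>
      \<exists>g\<in>codeword_stabiliser B \<Delta>. form_act g \<phi> = \<phi>' \<and> form_act g \<psi> = \<psi>'"
begin

abbreviation "Q \<equiv> forms_of_type B \<epsilon>"
abbreviation "H \<equiv> codeword_stabiliser B \<Delta>"

section \<open>The codeword stabiliser and the transvections outside it\<close>

lemma stabiliser_Sp: "g \<in> H \<Longrightarrow> g \<in> carrier (Sp B)"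
  by (simp add: codeword_stabiliser_def)

lemma stabiliser_mem_iff:
  assumes "g \<in> H"
  shows "form_act g \<phi> \<in> \<Delta> \<longleftrightarrow> \<phi> \<in> \<Delta>"
proof -
  have g: "g \<in> carrier (Sp B)" "form_act g ` \<Delta> = \<Delta>"
    using assms by (simp_all add: codeword_stabiliser_def)
  have "inj (form_act g)"
    by (metis form_act_inv(1)[OF g(1)] injI)
  then have "form_act g \<phi> \<in> form_act g ` \<Delta> \<longleftrightarrow> \<phi> \<in> \<Delta>"
    by (rule inj_image_mem_iff)
  then show ?thesis
    by (simp add: g(2))
qed

lemma stabiliserI:
  assumes "g \<in> carrier (Sp B)" "\<And>\<phi>. \<phi> \<in> \<Delta> \<Longrightarrow> form_act g \<phi> \<in> \<Delta>"
  shows "g \<in> H"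
proof -
  have "inj (form_act g)"
    by (metis form_act_inv(1)[OF assms(1)] injI)
  moreover have "finite \<Delta>"
    using codeword_subset finite_forms_of_type by (rule finite_subset)
  ultimately have "form_act g ` \<Delta> = \<Delta>"
    using assms(2) by (intro endo_inj_surj) (auto intro: inj_on_subset)
  then show ?thesis
    using assms(1) by (simp add: codeword_stabiliser_def)
qed

lemma crossing_pair:
  assumes "transvection v \<notin> H"
  obtains \<phi> where "\<phi> \<in> \<Delta>" "translate \<phi> v \<in> Q - \<Delta>"
proof -
  obtain \<phi> where \<phi>: "\<phi> \<in> \<Delta>" "form_act (transvection v) \<phi> \<notin> \<Delta>"
    using assms stabiliserI[OF transvection_Sp] by blast
  have f: "\<phi> \<in> Q" "\<phi> \<in> forms B"
    using \<phi>(1) codeword_subset forms_of_type_subset by blast+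
  have "\<phi> v = 0"
    using \<phi> form_act_transvection[OF f(2), of v] by (auto split: if_splits)
  then show thesis
    using \<phi> f form_act_transvection[OF f(2), of v] translate_type[OF f(1), of v] by (intro that[of \<phi>]) auto
qed

text \<open>
  The difference vector of a form in \<open>\<Delta>\<close> and one outside \<open>\<Delta>\<close> is determined equivariantly, so the
  vectors whose transvections do not stabilise \<open>\<Delta>\<close> form a single orbit.
\<close>

lemma crossing_vectors_conjugate:
  assumes "transvection v \<notin> H" "transvection w \<notin> H"
  obtains h where "h \<in> H" "h v = w"
proof -
  obtain \<phi> where \<phi>: "\<phi> \<in> \<Delta>" "translate \<phi> v \<in> Q - \<Delta>"
    using crossing_pair[OF assms(1)] .
  obtain \<psi> where \<psi>: "\<psi> \<in> \<Delta>" "translate \<psi> w \<in> Q - \<Delta>"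
    using crossing_pair[OF assms(2)] .
  obtain h where h: "h \<in> H" "form_act h \<phi> = \<psi>" "form_act h (translate \<phi> v) = translate \<psi> w"
    using flag_transitive[OF \<phi>(1) \<psi>(1) \<phi>(2) \<psi>(2)] by blast
  then have "h v = w"
    using form_act_translate[OF stabiliser_Sp[OF h(1)], of \<phi> v] by simp
  with h(1) show thesis by (rule that)
qed

lemma translate_mem_iff:
  assumes "transvection v \<in> H" "\<phi> \<in> Q" "\<phi> v = 0"
  shows "translate \<phi> v \<in> \<Delta> \<longleftrightarrow> \<phi> \<in> \<Delta>"
  using stabiliser_mem_iff[OF assms(1), of \<phi>] form_act_transvection[OF forms_of_type_subset[OF assms(2)], of v]
    assms(3) by simp

text \<open>A vector \<open>y\<close> not orthogonal to \<open>U\<close> has a transvection that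
  moves \<open>U\<close>. As \<open>H\<close> preserves the complement of \<open>U\<close>, the
  single orbit of vectors with transvection outside \<open>H\<close> avoids this complement, so
  membership in \<open>\<Delta>\<close> depends only on the restriction to \<open>U\<close>. If some
  form of type \<open>\<epsilon>\<close> vanishes on \<open>U\<close>, the forms that do are an
  \<open>H\<close>-invariant set on one side, and transitivity makes them that whole side. If none
  does, transitivity on pairs puts all sums of a restriction from \<open>\<Delta>\<close> and one
  from its complement on the same side, and that side absorbs the other as in
  \<open>isotropic_restriction_classes\<close>.\<close>

lemma isotropic_case:
  assumes U: "totally_isotropic B U" "U \<noteq> {0}" and H: "H \<subseteq> subspace_stabiliser B U"
  shows "\<exists>W. totally_isotropic B W \<and> W \<noteq> {0} \<and>
    ({\<phi> \<in> Q. W \<subseteq> Sing \<phi>} = \<Delta> \<or> {\<phi> \<in> Q. W \<subseteq> Sing \<phi>} = Q - \<Delta>)"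
proof -
  have sub: "vec.subspace U" and iso: "U \<subseteq> perp B U"
    using U(1) by (auto simp: totally_isotropic_def)
  have Him: "h ` U = U" if "h \<in> H" for h
    using H that by (auto simp: subspace_stabiliser_def)
  obtain u where u: "u \<in> U" "u \<noteq> 0"
    using U(2) vec.subspace_0[OF sub] by blast
  obtain y where y: "B u y = 1"
    using form_nondegenerate[OF u(2)] by blast
  have y_perp: "y \<notin> perp B U"
    using u(1) y by (auto simp: mem_perp_iff)
  have ty: "transvection y \<notin> H"
  proof
    assume "transvection y \<in> H"
    then have "u + y \<in> U"
      using Him u(1) transvection_simps(2)[OF y] by (metis imageI)
    then show False
      using bit_subspace_add_iff(1)[OF sub u(1)] iso y_perp by blast
  qed
  have tv: "transvection v \<in> H" if "v \<in> perp B U" for v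
  proof (rule ccontr)
    assume "transvection v \<notin> H"
    then obtain h where h: "h \<in> H" "h v = y"
      using crossing_vectors_conjugate ty by blast
    then have "y \<in> h ` perp B U"
      using that by blast
    then show False
      using perp_image[OF stabiliser_Sp[OF h(1)], of U] Him[OF h(1)] y_perp by simp
  qed
  have same: "\<phi> \<in> \<Delta> \<longleftrightarrow> \<psi> \<in> \<Delta>" if pq: "\<phi> \<in> Q" "\<psi> \<in> Q" "\<And>u. u \<in> U \<Longrightarrow> \<phi> u = \<psi> u" for \<phi> \<psi>
  proof -
    obtain v where v: "\<psi> = translate \<phi> v"
      using forms_translate pq(1,2) forms_of_type_subset by blast
    then have "v \<in> perp B U"
      using pq(3) by (simp add: mem_perp_iff translate_def)
    moreover have "\<phi> v = 0"
      using translate_type[OF pq(1), of v] pq(2) v by simp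
    ultimately show ?thesis
      using translate_mem_iff[OF tv pq(1)] v by simp
  qed
  have act: "form_act h \<eta> u = form_act h \<phi> u + form_act h \<psi> u"
    if hu: "h \<in> H" "u \<in> U" "\<And>u. u \<in> U \<Longrightarrow> \<eta> u = \<phi> u + \<psi> u" for h \<eta> \<phi> \<psi> u
  proof -
    obtain x where "x \<in> U" "u = h x"
      using Him[OF hu(1)] hu(2) by blast
    then show ?thesis
      using hu(3) stabiliser_Sp[OF hu(1)] by simp
  qed
  obtain \<phi>0 \<psi>0 where \<phi>0: "\<phi>0 \<in> \<Delta>" and \<psi>0: "\<psi>0 \<in> Q - \<Delta>"
    using codeword_nonempty by blast
  have \<phi>0Q: "\<phi>0 \<in> Q"
    using \<phi>0 codeword_subset by blast
  show ?thesis
  proof (cases "\<exists>\<phi>\<in>Q. U \<subseteq> Sing \<phi>")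
    case True
    then obtain \<phi>1 where \<phi>1: "\<phi>1 \<in> Q" "U \<subseteq> Sing \<phi>1" by blast
    have side: "\<phi> \<in> \<Delta> \<longleftrightarrow> \<phi>1 \<in> \<Delta>" if "\<phi> \<in> Q" "U \<subseteq> Sing \<phi>" for \<phi>
      using that \<phi>1 by (intro same) (auto simp: Sing_def subset_iff)
    have sing: "U \<subseteq> Sing (form_act g \<phi>1)" if "g \<in> H" for g
      using Sing_act[OF stabiliser_Sp[OF that], of U \<phi>1] Him[OF that] \<phi>1(2) by simp
    have "{\<phi> \<in> Q. U \<subseteq> Sing \<phi>} = \<Delta> \<or> {\<phi> \<in> Q. U \<subseteq> Sing \<phi>} = Q - \<Delta>"
    proof (cases "\<phi>1 \<in> \<Delta>")
      case True
      have "U \<subseteq> Sing \<phi>" if "\<phi> \<in> \<Delta>" for \<phi>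
        using flag_transitive[OF True that \<psi>0 \<psi>0] sing by auto
      then have "{\<phi> \<in> Q. U \<subseteq> Sing \<phi>} = \<Delta>"
        using side True codeword_subset by blast
      then show ?thesis ..
    next
      case False
      then have "\<phi>1 \<in> Q - \<Delta>"
        using \<phi>1 by blast
      then have "U \<subseteq> Sing \<phi>" if "\<phi> \<in> Q - \<Delta>" for \<phi>
        using flag_transitive[OF \<phi>0 \<phi>0 _ that] sing by blast
      then have "{\<phi> \<in> Q. U \<subseteq> Sing \<phi>} = Q - \<Delta>"
        using side False by blast
      then show ?thesis ..
    qed
    then show ?thesis
      using U by blast
  next
    case False
    then have nz: "\<And>\<phi>. \<phi> \<in> Q \<Longrightarrow> \<not> U \<subseteq> Sing \<phi>" by blast
    have sep: "\<exists>u\<in>U. \<phi> u \<noteq> \<psi> u" if "\<phi> \<in> \<Delta>" "\<psi> \<in> Q - \<Delta>" for \<phi> \<psi>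
      using same[of \<phi> \<psi>] that codeword_subset by blast
    \<comment> \<open>The sum of the two restrictions is a nonzero functional, because
      \<open>\<phi>0\<close> and \<open>\<psi>0\<close> differ somewhere on \<open>U\<close>;
      therefore a form of type \<open>\<epsilon>\<close> realises it.\<close>
    obtain \<eta>0 where \<eta>0: "\<eta>0 \<in> Q" "\<And>u. u \<in> U \<Longrightarrow> \<eta>0 u = \<phi>0 u + \<psi>0 u"
    proof -
      have f: "\<phi>0 \<in> forms B" "\<psi>0 \<in> forms B"
        using \<phi>0Q \<psi>0 forms_of_type_subset by blast+
      obtain v where v: "\<psi>0 = translate \<phi>0 v"
        using forms_translate[OF f] .
      have "v \<notin> perp B U"
        using sep[OF \<phi>0 \<psi>0] by (auto simp: v translate_def mem_perp_iff)
      then obtain \<eta> where "\<eta> \<in> Q" "\<And>u. u \<in> U \<Longrightarrow> \<eta> u = B u v"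
        using isotropic_restriction_extends[OF \<phi>0Q U(1)] by blast
      then show ?thesis
        by (intro that[of \<eta>]) (simp_all add: v translate_def)
    qed
    have orbit: "\<eta> \<in> \<Delta> \<longleftrightarrow> \<eta>0 \<in> \<Delta>"
      if \<eta>: "\<phi> \<in> \<Delta>" "\<psi> \<in> Q - \<Delta>" "\<eta> \<in> Q" "\<And>u. u \<in> U \<Longrightarrow> \<eta> u = \<phi> u + \<psi> u" for \<phi> \<psi> \<eta>
    proof -
      obtain g where g: "g \<in> H" "form_act g \<phi>0 = \<phi>" "form_act g \<psi>0 = \<psi>"
        using flag_transitive[OF \<phi>0 \<eta>(1) \<psi>0 \<eta>(2)] by blast
      have "form_act g \<eta>0 u = \<eta> u" if "u \<in> U" for u
        using act[OF g(1) that, of \<eta>0 \<phi>0 \<psi>0] \<eta>0(2) \<eta>(4)[OF that] g by simp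
      then have "\<eta> \<in> \<Delta> \<longleftrightarrow> form_act g \<eta>0 \<in> \<Delta>"
        using \<eta>(3) form_act_type[OF stabiliser_Sp[OF g(1)] \<eta>0(1)] by (intro same) auto
      then show ?thesis
        using stabiliser_mem_iff[OF g(1)] by simp
    qed
    show ?thesis
    proof (cases "\<eta>0 \<in> \<Delta>")
      case True
      have "\<exists>W. totally_isotropic B W \<and> W \<noteq> {0} \<and> {\<phi> \<in> Q. W \<subseteq> Sing \<phi>} = Q - \<Delta>"
      proof (rule isotropic_restriction_classes[OF U(1) nz, where X = \<Delta>])
        show "\<Delta> \<union> (Q - \<Delta>) = Q"
          using codeword_subset by blast
        show "\<eta> \<in> \<Delta>" if "\<phi> \<in> \<Delta>" "\<psi> \<in> Q - \<Delta>" "\<eta> \<in> Q" "\<And>u. u \<in> U \<Longrightarrow> \<eta> u = \<phi> u + \<psi> u" for \<phi> \<psi> \<eta>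
          using orbit[OF that] True by blast
      qed (use sep codeword_nonempty in blast)+
      then show ?thesis by blast
    next
      case False
      have "\<exists>W. totally_isotropic B W \<and> W \<noteq> {0} \<and> {\<phi> \<in> Q. W \<subseteq> Sing \<phi>} = \<Delta>"
      proof (rule isotropic_restriction_classes[OF U(1) nz, where X = "Q - \<Delta>"])
        show "Q - \<Delta> \<union> \<Delta> = Q"
          using codeword_subset by blast
        show "\<exists>u\<in>U. \<psi> u \<noteq> \<phi> u" if "\<psi> \<in> Q - \<Delta>" "\<phi> \<in> \<Delta>" for \<phi> \<psi>
          using sep[OF that(2,1)] by metis
        show "\<eta> \<in> Q - \<Delta>"
          if "\<psi> \<in> Q - \<Delta>" "\<phi> \<in> \<Delta>" "\<eta> \<in> Q" "\<And>u. u \<in> U \<Longrightarrow> \<eta> u = \<psi> u + \<phi> u" for \<phi> \<psi> \<eta>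
          using orbit[OF that(2,1,3)] that(3,4) False by (simp add: add.commute)
      qed (use codeword_nonempty in blast)+
      then show ?thesis by blast
    qed
  qed
qed

text \<open>Two forms of type \<open>\<epsilon>\<close> with the same sign on \<open>U\<close>
  differ by some \<open>u + w\<close> along the splitting with \<open>\<phi> u = 0\<close> and
  \<open>\<phi> w = 0\<close>. The translations by \<open>u\<close> and by \<open>w\<close> are then
  effected by transvections in \<open>H\<close>, so membership depends only on the sign on
  \<open>U\<close>. There are only two signs and \<open>\<Delta>\<close> is neither empty nor
  everything, so one sign characterises it.\<close>

lemma nondegenerate_word_if_transvections:
  assumes U: "nondegenerate_subspace B U" "vec.dim U = 2 * d"
    and tv: "\<And>x. x \<in> U \<union> perp B U \<Longrightarrow> transvection x \<in> H"
  shows "\<exists>s\<in>{1, -1}. \<Delta> = {\<phi> \<in> Q. gauss_sum \<phi> U = s * 2 ^ d}"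
proof -
  note sub = nondegenerate_subspaceD(1)[OF U(1)]
  have same: "\<phi> \<in> \<Delta> \<longleftrightarrow> \<psi> \<in> \<Delta>" if pq: "\<phi> \<in> Q" "\<psi> \<in> Q" "gauss_sum \<phi> U = gauss_sum \<psi> U" for \<phi> \<psi>
  proof -
    have f: "\<phi> \<in> forms B" "\<psi> \<in> forms B"
      using pq forms_of_type_subset by blast+
    obtain v where v: "\<psi> = translate \<phi> v"
      using forms_translate[OF f] .
    obtain u w where uw: "u \<in> U" "w \<in> perp B U" "v = u + w"
      using nondegenerate_decomposition[OF U(1)] .
    obtain r where "r \<in> {1, -1}" "gauss_sum \<phi> U = r * 2 ^ d"
      using gauss_sum_cases[OF f(1) U] .
    then have "gauss_sum \<phi> U \<noteq> 0" by auto
    moreover have "gauss_sum \<psi> U = chi (\<phi> u) * gauss_sum \<phi> U"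
      unfolding v uw(3) by (rule gauss_sum_translate[OF f(1) sub uw(1,2)])
    note trans[OF pq(3) this]
    ultimately have u0: "\<phi> u = 0"
      by (cases "\<phi> u") auto
    have "\<phi> v = 0"
      using translate_type[OF pq(1), of v] pq(2) v by simp
    then have w0: "\<phi> w = 0"
      using u0 uw by (simp add: forms_add[OF f(1)] mem_perp_iff)
    have "translate \<phi> u \<in> Q"
      using translate_type[OF pq(1)] u0 by simp
    moreover have "translate \<phi> u w = 0"
      using w0 uw by (simp add: translate_def mem_perp_iff form_commute[of w])
    ultimately have "translate (translate \<phi> u) w \<in> \<Delta> \<longleftrightarrow> translate \<phi> u \<in> \<Delta>"
      using tv uw(2) by (intro translate_mem_iff) auto
    then show ?thesis
      using translate_mem_iff[OF tv pq(1) u0] uw by (simp add: v)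
  qed
  obtain \<phi> \<psi> where \<phi>: "\<phi> \<in> \<Delta>" and \<psi>: "\<psi> \<in> Q - \<Delta>"
    using codeword_nonempty by blast
  have \<phi>Q: "\<phi> \<in> Q"
    using \<phi> codeword_subset by blast
  obtain s where s: "s \<in> {1, -1}" "gauss_sum \<phi> U = s * 2 ^ d"
    using gauss_sum_cases[OF forms_of_type_subset[OF \<phi>Q] U] .
  have "\<eta> \<in> \<Delta> \<longleftrightarrow> gauss_sum \<eta> U = s * 2 ^ d" if \<eta>: "\<eta> \<in> Q" for \<eta>
  proof
    assume "gauss_sum \<eta> U = s * 2 ^ d"
    then show "\<eta> \<in> \<Delta>"
      using same[OF \<eta> \<phi>Q] s(2) \<phi> by simp
  next
    assume "\<eta> \<in> \<Delta>"
    then have ne: "gauss_sum \<eta> U \<noteq> gauss_sum \<psi> U" "gauss_sum \<phi> U \<noteq> gauss_sum \<psi> U"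
      using same[OF \<eta>, of \<psi>] same[OF \<phi>Q, of \<psi>] \<phi> \<psi> by blast+
    obtain a where a: "a \<in> {1, -1}" "gauss_sum \<eta> U = a * 2 ^ d"
      using gauss_sum_cases[OF forms_of_type_subset[OF \<eta>] U] .
    obtain b where b: "b \<in> {1, -1}" "gauss_sum \<psi> U = b * 2 ^ d"
      using gauss_sum_cases[OF forms_of_type_subset U] \<psi> by blast
    have "a = s"
      using ne a b s by auto
    with a show "gauss_sum \<eta> U = s * 2 ^ d" by simp
  qed
  then have "\<Delta> = {\<phi> \<in> Q. gauss_sum \<phi> U = s * 2 ^ d}"
    using codeword_subset by blast
  with s(1) show ?thesis by blast
qed

text \<open>The transvection of \<open>u + w\<close> with both components nonzero takes a vector
  \<open>a\<close> of \<open>U\<close> with \<open>B u a = 1\<close> to \<open>a + u + w\<close>,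
  whose components are again both nonzero. It therefore lies outside \<open>H\<close>. All other
  vectors with this property are conjugate to \<open>u + w\<close> under \<open>H\<close>, and so
  none of them lies in the invariant union.\<close>

lemma transvections_of_invariant_splitting:
  assumes U: "nondegenerate_subspace B U" "U \<noteq> {0}" "perp B U \<noteq> {0}"
    and inv: "\<And>h x. h \<in> H \<Longrightarrow> x \<in> U \<union> perp B U \<Longrightarrow> h x \<in> U \<union> perp B U"
    and x: "x \<in> U \<union> perp B U"
  shows "transvection x \<in> H"
proof (rule ccontr)
  assume tx: "transvection x \<notin> H"
  note sub = nondegenerate_subspaceD(1)[OF U(1)]
  have zero: "U \<inter> perp B U = {0}"
    using U(1) by (simp add: nondegenerate_subspace_def)
  obtain u w where u: "u \<in> U" "u \<noteq> 0" and w: "w \<in> perp B U" "w \<noteq> 0"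
    using U(2,3) vec.subspace_0[OF sub] vec.subspace_0[OF subspace_perp] by blast
  obtain a where a: "a \<in> U" "B u a = 1"
    using nondegenerate_subspaceD(2)[OF U(1) u] by blast
  have notin: "c + w \<notin> U \<union> perp B U" if "c \<in> U" "c \<noteq> 0" for c
    using bit_subspace_add_iff(1)[OF sub that(1), of w] bit_subspace_add_iff(2)[OF subspace_perp w(1), of c]
      zero that w by blast
  have "transvection (u + w) \<notin> H"
  proof
    assume t: "transvection (u + w) \<in> H"
    have "B a (u + w) = 1"
      using a w(1) by (simp add: mem_perp_iff form_commute[of a u])
    then have "a + (u + w) \<in> U \<union> perp B U"
      using inv[OF t, of a] a(1) transvection_simps(2)[of a "u + w"] by simp
    moreover have "a + u \<in> U"
      using sub a(1) u(1) by (rule vec.subspace_add)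
    moreover have "a + u \<noteq> 0"
      using a(2) by auto
    ultimately show False
      using notin[of "a + u"] by (simp add: add.assoc)
  qed
  then obtain h where "h \<in> H" "h x = u + w"
    using crossing_vectors_conjugate[OF tx] by blast
  then show False
    using inv[of h x] x notin[OF u] by simp
qed

text \<open>\<open>H\<close> permutes the summands, so it preserves the number of nonzero components
  of a vector. Yet vectors with two and with three nonzero components both have transvections
  outside \<open>H\<close>, which would make them conjugate.\<close>

lemma no_triple_decomposition:
  assumes D: "H \<subseteq> decomposition_stabiliser B D"
    and nd: "\<And>W. W \<in> D \<Longrightarrow> nondegenerate_subspace B W \<and> W \<noteq> {0}"
    and orth: "\<And>W W'. W \<in> D \<Longrightarrow> W' \<in> D \<Longrightarrow> W \<noteq> W' \<Longrightarrow> W' \<subseteq> perp B W"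
    and W: "W1 \<in> D" "W2 \<in> D" "W3 \<in> D" "W1 \<noteq> W2" "W1 \<noteq> W3" "W2 \<noteq> W3"
  shows False
proof -
  have ex: "\<exists>x. x \<in> W \<and> x \<noteq> 0" if "W \<in> D" for W
    using nd[OF that] vec.subspace_0[OF nondegenerate_subspaceD(1)] by blast
  obtain x1 x2 x3 where x: "x1 \<in> W1" "x1 \<noteq> 0" "x2 \<in> W2" "x2 \<noteq> 0" "x3 \<in> W3" "x3 \<noteq> 0"
    using ex W by meson
  have dual: "\<exists>a\<in>W. B a x = 1" if "W \<in> D" "x \<in> W" "x \<noteq> 0" for W x
    using nondegenerate_subspaceD(2)[of W x] nd[OF that(1)] that form_commute by metis
  have B0: "B a b = 0" if "W \<in> D" "W' \<in> D" "W \<noteq> W'" "a \<in> W" "b \<in> W'" for W W' a b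
    using orth[OF that(1-3)] that(4,5) by (auto simp: mem_perp_iff)
  have HD: "h ` W \<in> D" if "h \<in> H" "W \<in> D" for h W
    using D that by (auto simp: decomposition_stabiliser_def)
  \<comment> \<open>The third part \<open>z\<close>, either 0 or \<open>x3\<close>, is invisible
    from \<open>W1\<close> and \<open>W2\<close>, so one argument treats both vectors: a vector of
    \<open>W1\<close> is sent to one with nonzero components in \<open>W1\<close> and in
    \<open>W2\<close>, which lies in no summand.\<close>
  have not_stab: "transvection (x1 + x2 + z) \<notin> H" if z: "\<And>a. a \<in> W1 \<union> W2 \<Longrightarrow> B a z = 0" for z
  proof
    assume t: "transvection (x1 + x2 + z) \<in> H"
    obtain a where a: "a \<in> W1" "B a x1 = 1"
      using dual[OF W(1) x(1,2)] by blast
    have "B a (x1 + x2 + z) = 1"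
      using a z[of a] B0[OF W(1,2,4) a(1) x(3)] by simp
    then have m: "a + (x1 + x2 + z) \<in> transvection (x1 + x2 + z) ` W1"
      using a(1) transvection_simps(2) by (metis imageI)
    have W': "transvection (x1 + x2 + z) ` W1 \<in> D"
      by (rule HD[OF t W(1)])
    show False
    proof (cases "transvection (x1 + x2 + z) ` W1 = W1")
      case True
      obtain c where c: "c \<in> W2" "B c x2 = 1"
        using dual[OF W(2) x(3,4)] by blast
      have "B c (a + (x1 + x2 + z)) = 1"
        using c z[of c] B0[OF W(2,1) W(4)[symmetric] c(1)] a(1) x(1) by simp
      moreover have "B c (a + (x1 + x2 + z)) = 0"
        using B0[OF W(2,1) W(4)[symmetric] c(1) m[unfolded True]] .
      ultimately show False by simp
    next
      case False
      have "a + x1 \<noteq> 0" "a + x1 \<in> W1"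
        using a x(1) nondegenerate_subspaceD(1) nd[OF W(1)] vec.subspace_add by auto
      then obtain c where c: "c \<in> W1" "B c (a + x1) = 1"
        using dual[OF W(1)] by blast
      have "B c (a + (x1 + x2 + z)) = B c (a + x1) + B c x2 + B c z"
        by (simp add: ac_simps)
      then have "B c (a + (x1 + x2 + z)) = 1"
        using c z[of c] B0[OF W(1,2,4) c(1) x(3)] by simp
      moreover have "B c (a + (x1 + x2 + z)) = 0"
        using B0[OF W(1) W' False[symmetric] c(1) m] .
      ultimately show False by simp
    qed
  qed
  have "transvection (x1 + x2 + 0) \<notin> H" "transvection (x1 + x2 + x3) \<notin> H"
    using B0[OF W(1,3,5) _ x(5)] B0[OF W(2,3,6) _ x(5)] by (intro not_stab; auto)+
  then obtain h where h: "h \<in> H" "h (x1 + x2 + 0) = x1 + x2 + x3"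
    using crossing_vectors_conjugate by blast
  then have hx: "h x1 + h x2 = x1 + x2 + x3"
    using SpD(1)[OF stabiliser_Sp[OF h(1)]] by simp
  \<comment> \<open>A summand other than the images of \<open>W1\<close> and \<open>W2\<close> is
    orthogonal to \<open>h x1 + h x2\<close>. None of \<open>W1\<close>, \<open>W2\<close>,
    \<open>W3\<close> is orthogonal to this vector, so all three would have to be among two
    images.\<close>
  have key: False if V: "V \<in> D" "V \<noteq> h ` W1" "V \<noteq> h ` W2" "a \<in> V" "B a (x1 + x2 + x3) = 1" for V a
  proof -
    have "B a (h x1) = 0" "B a (h x2) = 0"
      using B0[OF V(1) HD[OF h(1) W(1)] V(2,4)] B0[OF V(1) HD[OF h(1) W(2)] V(3,4)] x by blast+
    then have "B a (h x1 + h x2) = 0" by simp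
    then show False
      using V(5) unfolding hx by simp
  qed
  obtain a1 a2 a3 where a: "a1 \<in> W1" "B a1 x1 = 1" "a2 \<in> W2" "B a2 x2 = 1" "a3 \<in> W3" "B a3 x3 = 1"
    using dual W x by meson
  have "B a1 (x1 + x2 + x3) = 1"
    using B0[OF W(1,2,4) a(1) x(3)] B0[OF W(1,3,5) a(1) x(5)] a(2) by simp
  moreover have "B a2 (x1 + x2 + x3) = 1"
    using B0[OF W(2,1) W(4)[symmetric] a(3) x(1)] B0[OF W(2,3,6) a(3) x(5)] a(4) by simp
  moreover have "B a3 (x1 + x2 + x3) = 1"
    using B0[OF W(3,1) W(5)[symmetric] a(5) x(1)] B0[OF W(3,2) W(6)[symmetric] a(5) x(3)] a(6) by simp
  ultimately show False
    using key[OF W(1) _ _ a(1)] key[OF W(2) _ _ a(3)] key[OF W(3) _ _ a(5)] W(4-6) by metis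
qed

text \<open>
  Brauer's permutation lemma in a special case: the matrix of the signs \<open>(-1)\<close> to the power \<open>\<phi> u\<close>,
  with rows \<open>u\<close> and columns \<open>\<phi>\<close>, is invertible and equivariant. If the stabiliser were transitive on
  nonzero vectors, then the row sums over \<open>\<Delta>\<close> would be constant off \<open>0\<close>, and inverting the matrix
  would show that membership in \<open>\<Delta>\<close> depends only on the type.
\<close>

lemma stabiliser_contains_transvection: "\<exists>v. v \<noteq> 0 \<and> transvection v \<in> H"
proof (rule ccontr)
  assume "\<not> ?thesis"
  then have none: "\<And>v. v \<noteq> 0 \<Longrightarrow> transvection v \<notin> H" by blast
  have fin: "finite \<Delta>"
    using codeword_subset finite_forms_of_type by (rule finite_subset)
  define \<alpha> where "\<alpha> u = (\<Sum>\<phi>\<in>\<Delta>. chi (\<phi> u))" for u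
  have "\<alpha> u = \<alpha> u'" if uu: "u \<noteq> 0" "u' \<noteq> 0" for u u'
  proof -
    obtain h where h: "h \<in> H" "h u = u'"
      using crossing_vectors_conjugate none uu by metis
    have im: "form_act h ` \<Delta> = \<Delta>"
      using h(1) by (simp add: codeword_stabiliser_def)
    have inj: "inj_on (form_act h) \<Delta>"
      by (metis form_act_inv(1)[OF stabiliser_Sp[OF h(1)]] inj_onI)
    have "\<alpha> u' = (\<Sum>\<phi>\<in>form_act h ` \<Delta>. chi (\<phi> u'))"
      by (simp only: im \<alpha>_def)
    also have "\<dots> = (\<Sum>\<phi>\<in>\<Delta>. chi (form_act h \<phi> (h u)))"
      unfolding h(2) by (simp add: sum.reindex[OF inj])
    also have "\<dots> = \<alpha> u"
      using form_act_apply[OF stabiliser_Sp[OF h(1)]] by (simp add: \<alpha>_def)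
    finally show ?thesis ..
  qed
  then obtain c where c: "\<And>u. u \<noteq> 0 \<Longrightarrow> \<alpha> u = c"
    by (metis (full_types))
  let ?N = "int (card (UNIV :: (bit ^ 'm) set))"
  \<comment> \<open>Orthogonality of the columns: the product of the columns of
    \<open>\<phi>\<close> and \<open>\<theta>\<close> is the additive character given by the
    difference vector of the two forms.\<close>
  have inv1: "(\<Sum>u\<in>UNIV. \<alpha> u * chi (\<theta> u)) = (if \<theta> \<in> \<Delta> then ?N else 0)" if \<theta>: "\<theta> \<in> Q" for \<theta>
  proof -
    have "(\<Sum>u\<in>UNIV. \<alpha> u * chi (\<theta> u)) = (\<Sum>\<phi>\<in>\<Delta>. \<Sum>u\<in>UNIV. chi (\<phi> u) * chi (\<theta> u))"
      unfolding \<alpha>_def sum_distrib_right by (rule sum.swap)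
    also have "\<dots> = (\<Sum>\<phi>\<in>\<Delta>. if \<phi> = \<theta> then ?N else 0)"
    proof (rule sum.cong)
      fix \<phi> assume "\<phi> \<in> \<Delta>"
      then have "\<phi> \<in> forms B"
        using codeword_subset forms_of_type_subset by blast
      then obtain v where v: "\<phi> = translate \<theta> v"
        using forms_translate[OF forms_of_type_subset[OF \<theta>]] by blast
      have "(\<Sum>u\<in>UNIV. chi (\<phi> u) * chi (\<theta> u)) = (\<Sum>u\<in>UNIV. chi (B u v))"
        by (simp add: v translate_def chi_add mult_ac)
      also have "\<dots> = (if v \<in> perp B UNIV then ?N else 0)"
        by (rule sum_chi_form[OF vec.subspace_UNIV])
      also have "v \<in> perp B UNIV \<longleftrightarrow> v = 0"
        using nondegenerate_UNIV unfolding nondegenerate_subspace_def by blast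
      also have "v = 0 \<longleftrightarrow> \<phi> = \<theta>"
        using translate_eq_iff[of \<theta> v 0] by (simp add: v)
      finally show "(\<Sum>u\<in>UNIV. chi (\<phi> u) * chi (\<theta> u)) = (if \<phi> = \<theta> then ?N else 0)" .
    qed simp
    finally show ?thesis
      using fin by simp
  qed
  \<comment> \<open>With row sums constant away from 0, the same expression reduces to the Gauss sum
    of \<open>\<theta>\<close>, which is the same for all forms of type
    \<open>\<epsilon>\<close>.\<close>
  have inv2: "(\<Sum>u\<in>UNIV. \<alpha> u * chi (\<theta> u)) = \<alpha> 0 + c * (\<epsilon> * 2 ^ n - 1)" if \<theta>: "\<theta> \<in> Q" for \<theta>
  proof -
    have \<theta>0: "\<theta> 0 = 0"
      using forms_of_type_subset[OF \<theta>] by simp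
    have "gauss_sum \<theta> UNIV = 1 + (\<Sum>u\<in>UNIV - {0}. chi (\<theta> u))"
      unfolding gauss_sum_def using \<theta>0 by (subst sum.remove[of _ 0]) auto
    then have "(\<Sum>u\<in>UNIV - {0}. chi (\<theta> u)) = \<epsilon> * 2 ^ n - 1"
      using \<theta> by (simp add: forms_of_type_iff)
    moreover have "(\<Sum>u\<in>UNIV. \<alpha> u * chi (\<theta> u)) = \<alpha> 0 + (\<Sum>u\<in>UNIV - {0}. \<alpha> u * chi (\<theta> u))"
      using \<theta>0 by (subst sum.remove[of _ 0]) auto
    moreover have "(\<Sum>u\<in>UNIV - {0}. \<alpha> u * chi (\<theta> u)) = (\<Sum>u\<in>UNIV - {0}. c * chi (\<theta> u))"
      by (rule sum.cong) (use c in auto)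
    ultimately show ?thesis
      by (simp flip: sum_distrib_left)
  qed
  obtain \<phi> \<psi> where "\<phi> \<in> \<Delta>" "\<psi> \<in> Q - \<Delta>"
    using codeword_nonempty by blast
  then have "?N = 0"
    using inv1[of \<phi>] inv1[of \<psi>] inv2[of \<phi>] inv2[of \<psi>] codeword_subset by auto
  then show False
    by (simp add: card_UNIV_bit_vec del: CARD_vec)
qed

end

section \<open>Field extension structures\<close>

context symplectic_space
begin

text \<open>The form \<open>C\<close> is alternating, so all \<open>K\<close>-multiples of
  \<open>v\<close> are orthogonal to \<open>v\<close> and the transvection fixes them; this forces
  the field automorphism to fix every scalar. Then \<open>s a x\<close> must be displaced by
  \<open>s a v\<close> whenever \<open>x\<close> is displaced by \<open>v\<close>, whereas a
  transvection displaces only by 0 or \<open>v\<close>. A scalar \<open>a\<close> other than 0 and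
  1, available because \<open>b\<close> is at least 2, contradicts this.\<close>

lemma transvection_not_semilinear:
  assumes ext: "field_extension_structure B b K s C" and b: "2 \<le> b" and v: "v \<noteq> 0"
  shows "transvection v \<notin> semilinear_group K s C"
proof
  assume "transvection v \<in> semilinear_group K s C"
  then obtain \<sigma> where \<sigma>: "\<sigma> \<in> ring_iso K K"
    and semi: "\<And>a w. a \<in> carrier K \<Longrightarrow> transvection v (s a w) = s (\<sigma> a) (transvection v w)"
    unfolding semilinear_group_def by blast
  let ?M = "\<lparr>carrier = UNIV, mult = undefined, one = undefined, zero = 0, add = (+), smult = s\<rparr>"
  have "Ring.field K" and "Module.module K ?M"
    and card: "card (carrier K) = 2 ^ b" and C: "symplectic_form_over K s C"
    and tr: "\<And>u v. bit_embed K (B u v) = abs_trace K b (C u v)"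
    using ext by (auto simp: field_extension_structure_def scalar_structure_def)
  then interpret K: Ring.field K + M: Module.module K ?M
    by simp_all
  have smult_add: "s (a \<oplus>\<^bsub>K\<^esub> c) w = s a w + s c w" if "a \<in> carrier K" "c \<in> carrier K" for a c w
    using M.smult_l_distr[OF that, of w] by simp
  have smult_assoc: "s (a \<otimes>\<^bsub>K\<^esub> c) w = s a (s c w)" if "a \<in> carrier K" "c \<in> carrier K" for a c w
    using M.smult_assoc1[OF that, of w] by simp
  have smult_one: "s \<one>\<^bsub>K\<^esub> w = w" for w
    using M.smult_one[of w] by simp
  have smult_zero: "s a 0 = 0" if "a \<in> carrier K" for a
    using M.smult_r_null[OF that] by simp
  have smult_eq_0: "a = \<zero>\<^bsub>K\<^esub>" if "a \<in> carrier K" "s a v = 0" for a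
  proof (rule ccontr)
    assume "a \<noteq> \<zero>\<^bsub>K\<^esub>"
    then have "a \<in> Units K"
      using that(1) K.field_Units by blast
    then have "s \<one>\<^bsub>K\<^esub> v = s (inv\<^bsub>K\<^esub> a) (s a v)"
      using smult_assoc[of "inv\<^bsub>K\<^esub> a" a v] that(1) by simp
    then have "v = 0"
      using smult_one that(2) smult_zero \<open>a \<in> Units K\<close> by simp
    with v show False by simp
  qed
  have smult_inj: "a = c" if "a \<in> carrier K" "c \<in> carrier K" "s a v = s c v" for a c
  proof -
    \<comment> \<open>That \<open>K\<close> has characteristic 2 is read off its action on
      \<open>v\<close>, since every vector is its own negative.\<close>
    have "a \<oplus>\<^bsub>K\<^esub> c = \<zero>\<^bsub>K\<^esub>" "c \<oplus>\<^bsub>K\<^esub> c = \<zero>\<^bsub>K\<^esub>"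
      using that smult_add by (intro smult_eq_0; simp)+
    then have "a \<oplus>\<^bsub>K\<^esub> c = c \<oplus>\<^bsub>K\<^esub> c" by simp
    then show ?thesis
      using that(1,2) by simp
  qed
  have Bv: "B (s a v) v = 0" if "a \<in> carrier K" for a
  proof -
    have "C (s a v) v = \<zero>\<^bsub>K\<^esub>"
      using C that by (simp add: symplectic_form_over_def)
    then have "bit_embed K (B (s a v) v) = \<zero>\<^bsub>K\<^esub>"
      using tr[of "s a v" v] by (simp add: abs_trace_def K.nat_pow_zero)
    then show ?thesis
      by (cases "B (s a v) v") (simp_all add: bit_embed_def)
  qed
  have "\<not> carrier K \<subseteq> {\<zero>\<^bsub>K\<^esub>, \<one>\<^bsub>K\<^esub>}"
  proof
    assume "carrier K \<subseteq> {\<zero>\<^bsub>K\<^esub>, \<one>\<^bsub>K\<^esub>}"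
    then have "card (carrier K) \<le> card {\<zero>\<^bsub>K\<^esub>, \<one>\<^bsub>K\<^esub>}"
      by (intro card_mono) auto
    moreover have "card {\<zero>\<^bsub>K\<^esub>, \<one>\<^bsub>K\<^esub>} \<le> 2"
      by (simp add: card_insert_if)
    moreover have "(2 :: nat) ^ 2 \<le> 2 ^ b"
      using b by (intro power_increasing) auto
    ultimately show False
      using card by simp
  qed
  then obtain a where a: "a \<in> carrier K" "a \<noteq> \<zero>\<^bsub>K\<^esub>" "a \<noteq> \<one>\<^bsub>K\<^esub>"
    by blast
  have \<sigma>a: "\<sigma> a \<in> carrier K"
    using \<sigma> a(1) by (auto simp: ring_iso_def ring_hom_def)
  have "s a v = s (\<sigma> a) v"
    using semi[OF a(1), of v] Bv[OF a(1)] by (simp add: transvection_simps)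
  then have \<sigma>a_eq: "\<sigma> a = a"
    using smult_inj[OF a(1) \<sigma>a] by simp
  obtain x where x: "B x v = 1"
    using form_nondegenerate[OF v] form_commute by metis
  have "transvection v (s a x) = s a (x + v)"
    using semi[OF a(1), of x] x by (simp add: \<sigma>a_eq transvection_simps)
  also have "\<dots> = s a x + s a v"
    using M.smult_r_distr[OF a(1), of x v] by simp
  finally have eq: "transvection v (s a x) = s a x + s a v" .
  show False
  proof (cases "B (s a x) v = 1")
    case True
    then have "s a v = s \<one>\<^bsub>K\<^esub> v"
      using eq by (simp add: transvection_simps smult_one)
    then show False
      using smult_inj[OF a(1)] a(3) by simp
  next
    case False
    then have "s a v = 0"
      using eq by (simp add: transvection_simps)
    then show False
      using smult_eq_0[OF a(1)] a(2) by simp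
  qed
qed

end

section \<open>The remaining geometric subgroups and the case distinction\<close>

context transitive_codeword
begin

lemma field_extension_case:
  assumes "field_extension_structure B b K s C" "2 \<le> b" "H \<subseteq> semilinear_group K s C"
  shows False
  using stabiliser_contains_transvection transvection_not_semilinear[OF assms(1,2)] assms(3) by blast

text \<open>Both \<open>\<Delta>\<close> and its complement have at least two elements and
  \<open>H\<close> is transitive on each. Consequently a form fixed by \<open>H\<close> is of the
  other type.\<close>

lemma codeword_not_singleton:
  assumes "1 < card \<Delta>" "card \<Delta> < card Q - 1" "\<psi> \<in> Q"
  obtains h where "h \<in> H" "form_act h \<psi> \<noteq> \<psi>"
proof -
  have fin: "finite \<Delta>"
    using codeword_subset finite_forms_of_type by (rule finite_subset)
  obtain \<phi>0 \<psi>0 where p: "\<phi>0 \<in> \<Delta>" "\<psi>0 \<in> Q - \<Delta>"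
    using codeword_nonempty by blast
  show thesis
  proof (cases "\<psi> \<in> \<Delta>")
    case True
    have "\<Delta> \<noteq> {\<psi>}"
      using assms(1) by auto
    then obtain \<phi> where "\<phi> \<in> \<Delta>" "\<phi> \<noteq> \<psi>"
      using True by blast
    then show ?thesis
      using flag_transitive[OF True _ p(2,2)] that by blast
  next
    case False
    then have \<psi>: "\<psi> \<in> Q - \<Delta>"
      using assms(3) by blast
    have "card (Q - \<Delta>) = card Q - card \<Delta>"
      using fin codeword_subset by (rule card_Diff_subset)
    then have "Q - \<Delta> \<noteq> {\<psi>}"
      using assms(2) by auto
    then obtain \<phi> where "\<phi> \<in> Q - \<Delta>" "\<phi> \<noteq> \<psi>"
      using \<psi> by blast
    then show ?thesis
      using flag_transitive[OF p(1,1) \<psi>] that by blast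
  qed
qed

text \<open>The transvection of a nonzero zero \<open>z\<close> of \<open>\<psi>\<close> moves
  \<open>\<psi>\<close>, so it lies outside \<open>H\<close>. As \<open>H\<close> preserves
  \<open>\<psi>\<close>, the whole orbit of such vectors consists of zeros of \<open>\<psi>\<close>,
  and \<open>x\<close> is not among them.\<close>

lemma form_stabiliser_transvections:
  assumes \<psi>: "\<psi> \<in> forms B" and H: "H \<subseteq> form_stabiliser B \<psi>"
    and z: "z \<noteq> 0" "\<psi> z = 0" and x: "\<psi> x = 1"
  shows "transvection x \<in> H"
proof (rule ccontr)
  have fixes_form: "form_act h \<psi> = \<psi>" if "h \<in> H" for h
    using H that by (auto simp: form_stabiliser_def)
  assume tx: "transvection x \<notin> H"
  have "transvection z \<notin> H"
  proof
    assume "transvection z \<in> H"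
    then have "translate \<psi> z = translate \<psi> 0"
      using fixes_form form_act_transvection[OF \<psi>, of z] z(2) by simp
    then show False
      using z(1) translate_eq_iff by blast
  qed
  then obtain h where h: "h \<in> H" "h z = x"
    using crossing_vectors_conjugate tx by blast
  have "\<psi> x = \<psi> z"
    using fixes_form[OF h(1)] form_act_apply[OF stabiliser_Sp[OF h(1)], of \<psi> z] h(2) by simp
  then show False
    using z(2) x by simp
qed

text \<open>Translation of \<open>\<psi>\<close> matches the forms of type \<open>\<epsilon>\<close>
  with the vectors on which \<open>\<psi>\<close> is 1. If \<open>a\<close> and \<open>c\<close> are
  two of these with \<open>B a c = 1\<close>, then \<open>\<psi> (a + c) = 1\<close> too, so the
  transvection of \<open>a + c\<close> lies in \<open>H\<close> and both belong to the same side. A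
  vector \<open>v\<close> inside and a vector \<open>w\<close> outside therefore have no common
  neighbour. This forces \<open>\<psi>\<close> to be 1 on all nonzero vectors of a plane
  \<open>U\<close> through \<open>v\<close> and of its complement, and then all their transvections
  lie in \<open>H\<close>.\<close>

lemma form_stabiliser_case:
  assumes k: "1 < card \<Delta>" "card \<Delta> < card Q - 1" and n: "2 \<le> n"
    and \<psi>: "\<psi> \<in> forms B" and H: "H \<subseteq> form_stabiliser B \<psi>"
  shows "\<exists>U. nondegenerate_subspace B U \<and> vec.dim U = 2 \<and> (\<forall>x\<in>U \<union> perp B U. transvection x \<in> H)"
proof -
  have fixes_form: "form_act h \<psi> = \<psi>" if "h \<in> H" for h
    using H that by (auto simp: form_stabiliser_def)
  have "\<psi> \<notin> Q"
    using codeword_not_singleton[OF k] fixes_form by blast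
  then have one: "\<psi> v = 1" if "translate \<psi> v \<in> Q" for v
  proof -
    have "translate (translate \<psi> v) v \<notin> Q"
      using \<open>\<psi> \<notin> Q\<close> by simp
    then have "translate \<psi> v v \<noteq> 0"
      using translate_type[OF that, of v] by blast
    then show ?thesis
      by (simp add: translate_def)
  qed
  obtain \<phi>0 \<psi>0 where p: "\<phi>0 \<in> \<Delta>" "\<phi>0 \<in> Q" "\<psi>0 \<in> Q" "\<psi>0 \<notin> \<Delta>"
    using codeword_nonempty codeword_subset by blast
  obtain v where v: "\<phi>0 = translate \<psi> v"
    using forms_translate[OF \<psi>] forms_of_type_subset[OF p(2)] by blast
  obtain w where w: "\<psi>0 = translate \<psi> w"
    using forms_translate[OF \<psi>] forms_of_type_subset[OF p(3)] by blast
  have \<psi>v: "\<psi> v = 1" and \<psi>w: "\<psi> w = 1"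
    using one p v w by blast+
  have vw: "v \<noteq> w" "v \<noteq> 0" "w \<noteq> 0"
    using p v w \<psi>v \<psi>w \<psi> by auto
  \<comment> \<open>A nonzero zero of \<open>\<psi>\<close> is the prerequisite of
    \<open>form_stabiliser_transvections\<close>. If \<open>v\<close> and \<open>w\<close> are
    orthogonal, \<open>v + w\<close> is one; otherwise either \<open>y\<close> or
    \<open>v + y\<close> is, for a nonzero \<open>y\<close> orthogonal to both.\<close>
  obtain z where z: "z \<noteq> 0" "\<psi> z = 0"
  proof (cases "B v w = 0")
    case True
    then show ?thesis
      using \<psi>v \<psi>w vw by (intro that[of "v + w"]) (simp_all add: forms_add[OF \<psi>])
  next
    case False
    \<comment> \<open>The span of \<open>v\<close> and \<open>w\<close> has at most 4 elements and
      the space has at least 16, as \<open>n\<close> is at least 2.\<close>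
    have "card (perp B {v, w}) \<noteq> 1"
    proof -
      have "card (vec.span {v, w}) \<le> 2 * (2 * card (vec.span ({} :: (bit ^ 'm) set)))"
        using card_bit_span_insert[of v "{w}"] card_bit_span_insert[of w "{}"]
          vec.span_redundant[of v "{w}"] vec.span_redundant[of w "{}"]
        by (cases "v \<in> vec.span {w}"; cases "w \<in> vec.span {}") simp_all
      moreover have "card (vec.span {v, w}) * card (perp B {v, w}) = 2 ^ (2 * n)"
        using card_perp_UNIV[OF vec.subspace_span, of "{v, w}"] by (simp only: perp_span card_index)
      moreover have "(2 :: nat) ^ 4 \<le> 2 ^ (2 * n)"
        using n by (intro power_increasing) auto
      ultimately show ?thesis by auto
    qed
    then have "perp B {v, w} \<noteq> {0}" by auto
    then obtain y where y: "y \<in> perp B {v, w}" "y \<noteq> 0"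
      using vec.subspace_0[OF subspace_perp, of "{v, w}"] by blast
    show ?thesis
    proof (cases "\<psi> y = 0")
      case True
      then show ?thesis using y that by blast
    next
      case nz: False
      have "B v y = 0" "B w y = 0"
        using y(1) by (simp_all add: mem_perp_iff)
      then have "y \<noteq> v"
        using False form_commute[of v w] by auto
      then show ?thesis
        using nz \<psi>v \<open>B v y = 0\<close> by (intro that[of "v + y"]) (auto simp: forms_add[OF \<psi>])
    qed
  qed
  have tv: "transvection x \<in> H" if "\<psi> x = 1" for x
    using form_stabiliser_transvections[OF \<psi> H z that] .
  have step: "translate \<psi> a \<in> \<Delta> \<longleftrightarrow> translate \<psi> c \<in> \<Delta>"
    if ac: "translate \<psi> a \<in> Q" "\<psi> a = 1" "\<psi> c = 1" "B a c = 1" for a c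
  proof -
    have x: "\<psi> (a + c) = 1"
      using ac by (simp add: forms_add[OF \<psi>])
    have "translate \<psi> a (a + c) = 0"
      using x ac(4) by (simp add: translate_def form_commute[of c])
    then show ?thesis
      using translate_mem_iff[OF tv[OF x] ac(1)] by simp
  qed
  have no_common: "\<not> (\<psi> x = 1 \<and> B v x = 1 \<and> B w x = 1)" for x
    using step[of v x] step[of w x] p[unfolded v w] \<psi>v \<psi>w by blast
  have "B v w \<noteq> 1"
    using step[of v w] p[unfolded v w] \<psi>v \<psi>w by blast
  then have Bvw: "B v w = 0"
    by simp
  \<comment> \<open>A neighbour of \<open>v\<close>. Some \<open>q\<close> pairs to 1 with
    \<open>v\<close> and to 0 with \<open>w\<close>; if \<open>\<psi> q = 0\<close>, then
    \<open>q + w\<close> takes its place, as \<open>\<psi> w = 1\<close>.\<close>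
  obtain y where y: "\<psi> y = 1" "B v y = 1"
  proof -
    obtain a b where "B v a = 1" "B (v + w) b = 1"
      using form_nondegenerate[of v] form_nondegenerate[of "v + w"] vw by auto
    then obtain q where q: "B v q = 1" "B (v + w) q = 1"
      using common_dual_vector[OF vec.subspace_UNIV, of a v b "v + w"] by auto
    then have "B w q = 0"
      by (cases "B w q") simp_all
    then have "\<psi> q = 1 \<or> \<psi> (q + w) = 1" "B v (q + w) = 1"
      using q(1) Bvw \<psi>w by (cases "\<psi> q"; simp add: forms_add[OF \<psi>] form_commute[of q])+
    then show ?thesis
      using that q(1) by blast
  qed
  have Byw: "B w y = 0"
    using no_common[of y] y by simp
  define U where "U = vec.span {v, y}"
  define N where "N = perp B U"
  have memN: "x \<in> N \<longleftrightarrow> B v x = 0 \<and> B y x = 0" for x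
    by (simp add: N_def U_def perp_span mem_perp_iff)
  have memU: "x \<in> U \<longleftrightarrow> x \<in> {0, v, y, v + y}" for x
  proof -
    have "x + v = y \<longleftrightarrow> x = v + y"
      by (metis add.commute bit_vec_add_self(2))
    then show ?thesis
      by (auto simp: U_def bit_span_insert)
  qed
  have y0: "y \<noteq> 0" "v \<noteq> y"
    using y by auto
  have Ux: "\<psi> x = 1" if "x \<in> U" "x \<noteq> 0" for x
    using that y \<psi>v unfolding memU by (auto simp: forms_add[OF \<psi>])
  have U: "nondegenerate_subspace B U"
  proof (rule nondegenerate_subspaceI)
    fix x assume "x \<in> U" "x \<noteq> 0"
    then consider "x = v" | "x = y" | "x = v + y"
      by (auto simp: memU)
    then show "\<exists>z\<in>U. B x z = 1"
    proof cases
      case 1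
      then show ?thesis using y(2) by (intro bexI[of _ y]) (auto simp: memU)
    next
      case 2
      then show ?thesis using y(2) form_commute[of v y] by (intro bexI[of _ v]) (auto simp: memU)
    next
      case 3
      then show ?thesis using y(2) by (intro bexI[of _ y]) (auto simp: memU)
    qed
  qed (simp add: U_def)
  have "card U = 2 * (2 * 1)"
  proof -
    have "v \<notin> vec.span {y}" "y \<notin> vec.span {}"
      using y0 vw by (auto simp: bit_span_insert)
    then show ?thesis
      unfolding U_def by (simp add: card_bit_span_insert)
  qed
  then have "(2 :: nat) ^ vec.dim U = 2 ^ 2"
    using card_bit_subspace[of U] U_def by simp
  then have dimU: "vec.dim U = 2"
    by (simp only: power_inject_exp)
  have subN: "vec.subspace N"
    unfolding N_def by (rule subspace_perp)
  have ndN: "nondegenerate_subspace B N"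
    unfolding N_def by (rule nondegenerate_perp[OF U])
  have wN: "w \<in> N"
    using Bvw Byw form_commute[of y w] by (simp add: memN)
  \<comment> \<open>Shifting \<open>x\<close> by \<open>y\<close> gives a vector that pairs to 1
    with both \<open>v\<close> and \<open>w\<close>. Not being a common neighbour, it is a zero of
    \<open>\<psi>\<close>, and \<open>x\<close> is orthogonal to \<open>y\<close> with
    \<open>\<psi> y = 1\<close>.\<close>
  have off: "\<psi> x = 1" if "x \<in> N" "B w x = 1" for x
  proof -
    have "B v (x + y) = 1" "B w (x + y) = 1"
      using that y(2) Byw by (simp_all add: memN)
    then have "\<psi> (x + y) \<noteq> 1"
      using no_common by blast
    then show ?thesis
      using that(1) y(1) by (cases "\<psi> x") (simp_all add: forms_add[OF \<psi>] memN form_commute[of x])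
  qed
  have Nx: "\<psi> x = 1" if x: "x \<in> N" "x \<noteq> 0" for x
  proof (cases "B w x = 1 \<or> x = w")
    case True
    then show ?thesis
      using off[OF x(1)] \<psi>w by blast
  next
    case False
    \<comment> \<open>Any two vectors of \<open>N\<close> orthogonal to \<open>w\<close> would be orthogonal to each other.\<close>
    have "x + w \<in> N"
      using subN x(1) wN by (rule vec.subspace_add)
    then obtain a b where ab: "a \<in> N" "B x a = 1" "b \<in> N" "B (x + w) b = 1"
      using nondegenerate_subspaceD(2)[OF ndN x] nondegenerate_subspaceD(2)[OF ndN, of "x + w"] False
      by auto
    then obtain q where q: "q \<in> N" "B x q = 1" "B (x + w) q = 1"
      using common_dual_vector[OF subN] by blast
    have wq: "B w q = 0"
      using q by (cases "B w q") simp_all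
    obtain c where c: "c \<in> N" "B w c = 1"
      using nondegenerate_subspaceD(2)[OF ndN wN vw(3)] by blast
    have wx: "B w x = 0"
      using False by simp
    \<comment> \<open>All four vectors pair to 1 with \<open>w\<close>, so \<open>off\<close>
      applies to each. The sum of the four values of \<open>\<psi>\<close> is the second difference
      \<open>B x q\<close>, which would have to be 0 although it is 1.\<close>
    have "\<psi> c = 1" "\<psi> (c + x) = 1" "\<psi> (c + q) = 1" "\<psi> (c + (x + q)) = 1"
      using off[of c] off[of "c + x"] off[of "c + q"] off[of "c + (x + q)"] c q(1) x(1) wx wq
        subN by (simp_all add: vec.subspace_add)
    then show ?thesis
      using q(2) by (cases "\<psi> x"; cases "\<psi> q"; cases "B c x"; cases "B c q")
        (simp_all add: forms_add[OF \<psi>])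
  qed
  have "transvection x \<in> H" if "x \<in> U \<union> perp B U" for x
  proof (cases "x = 0")
    case True
    show ?thesis
    proof (rule stabiliserI[OF transvection_Sp])
      fix \<phi> assume "\<phi> \<in> \<Delta>"
      moreover from this have "\<phi> \<in> forms B"
        using codeword_subset forms_of_type_subset by blast
      ultimately show "form_act (transvection x) \<phi> \<in> \<Delta>"
        using form_act_transvection[of \<phi> 0] True by simp
    qed
  next
    case False
    then have "\<psi> x = 1"
      using that Ux Nx by (auto simp: N_def)
    then show ?thesis
      by (rule tv)
  qed
  then show ?thesis
    using U dimU by blast
qed

lemma geometric_stabiliser_cases:
  assumes k: "1 < card \<Delta>" "card \<Delta> < card Q - 1" and n: "2 \<le> n" and geo: "geometric_subgroup n B H"
  shows "(\<exists>U d s. nondegenerate_subspace B U \<and> vec.dim U = 2 * d \<and> 1 \<le> d \<and> d \<le> n - 1 \<and>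
        s \<in> {1, -1} \<and> \<Delta> = {\<phi> \<in> Q. gauss_sum \<phi> U = s * 2 ^ d}) \<or>
      (\<exists>W. totally_isotropic B W \<and> W \<noteq> {0} \<and>
        ({\<phi> \<in> Q. W \<subseteq> Sing \<phi>} = \<Delta> \<or> {\<phi> \<in> Q. W \<subseteq> Sing \<phi>} = Q - \<Delta>))"
    (is "?ND \<or> ?TI")
proof -
  have nonzero: "U \<noteq> {0}" if "1 \<le> vec.dim U" for U :: "(bit ^ 'm) set"
    using that by auto
  \<comment> \<open>Only the union of \<open>U\<close> and its complement is required to be
    invariant, so this serves subspace stabilisers and also decompositions into two summands, which
    \<open>H\<close> may interchange.\<close>
  have split: ?ND
    if U: "nondegenerate_subspace B U" "vec.dim U = 2 * d" "1 \<le> d" "d \<le> n - 1"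
      and inv: "\<And>h x. h \<in> H \<Longrightarrow> x \<in> U \<union> perp B U \<Longrightarrow> h x \<in> U \<union> perp B U" for U d
  proof -
    have "2 * d + vec.dim (perp B U) = 2 * n"
      using dim_perp[OF nondegenerate_subspaceD(1)[OF U(1)]] U(2) card_index by simp
    then have "1 \<le> vec.dim (perp B U)"
      using U(3,4) n by linarith
    then have "U \<noteq> {0}" "perp B U \<noteq> {0}"
      using U(2,3) by (auto intro: nonzero)
    then have "transvection x \<in> H" if "x \<in> U \<union> perp B U" for x
      by (rule transvections_of_invariant_splitting[OF U(1) _ _ _ that]) (rule inv)
    then have "\<exists>s\<in>{1, -1}. \<Delta> = {\<phi> \<in> Q. gauss_sum \<phi> U = s * 2 ^ d}"
      by (rule nondegenerate_word_if_transvections[OF U(1,2)])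
    then show ?ND
      using U by blast
  qed
  consider (nondeg) d U where "1 \<le> d" "2 * d \<le> n - 1" "nondegenerate_subspace B U" "vec.dim U = 2 * d"
      "H \<subseteq> subspace_stabiliser B U"
    | (iso) d U where "1 \<le> d" "totally_isotropic B U" "vec.dim U = d" "H \<subseteq> subspace_stabiliser B U"
    | (decomp) m t D where "n = m * t" "m < n" "orthogonal_decomposition B m t D"
      "H \<subseteq> decomposition_stabiliser B D"
    | (field) b K s C where "Factorial_Ring.prime (b :: nat)" "field_extension_structure B b K s C"
      "H \<subseteq> semilinear_group K s C"
    | (form) \<psi> where "\<psi> \<in> forms B" "H \<subseteq> form_stabiliser B \<psi>"
    using geo unfolding geometric_subgroup_def by auto
  then show ?thesis
  proof cases
    case nondeg
    have "h x \<in> U \<union> perp B U" if "h \<in> H" "x \<in> U \<union> perp B U" for h x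
    proof -
      have "h ` U = U"
        using nondeg(5) that(1) by (auto simp: subspace_stabiliser_def)
      moreover from this have "h ` perp B U = perp B U"
        using perp_image[OF stabiliser_Sp[OF that(1)], of U] by simp
      ultimately show ?thesis
        using that(2) by blast
    qed
    then have ?ND
      using nondeg by (intro split[of U d]) auto
    then show ?thesis ..
  next
    case iso
    then have ?TI
      using nonzero by (intro isotropic_case) auto
    then show ?thesis ..
  next
    case decomp
    have D: "finite D" "card D = t"
      "\<And>W. W \<in> D \<Longrightarrow> nondegenerate_subspace B W" "\<And>W. W \<in> D \<Longrightarrow> vec.dim W = 2 * m"
      "\<And>W W'. W \<in> D \<Longrightarrow> W' \<in> D \<Longrightarrow> W \<noteq> W' \<Longrightarrow> W' \<subseteq> perp B W"
      using decomp(3) by (simp_all add: orthogonal_decomposition_def)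
    have m: "1 \<le> m" "t \<noteq> 0" "t \<noteq> 1"
      using decomp(1,2) n by (auto simp: Suc_le_eq intro: Nat.gr0I)
    have nd: "nondegenerate_subspace B W \<and> W \<noteq> {0}" if "W \<in> D" for W
      using D(3,4)[OF that] m(1) nonzero[of W] by simp
    have "t = 2"
    proof (rule ccontr)
      assume "t \<noteq> 2"
      then have "3 \<le> card D"
        using m D(2) by linarith
      then obtain T where T: "T \<subseteq> D" "card T = 3"
        using obtain_subset_with_card_n by metis
      then obtain W1 W2 W3 where "T = {W1, W2, W3}" "W1 \<noteq> W2" "W1 \<noteq> W3" "W2 \<noteq> W3"
        by (auto simp: card_3_iff)
      with T(1) show False
        using no_triple_decomposition[OF decomp(4) nd D(5), of W1 W2 W3] by simp
    qed
    then obtain U W where UW: "D = {U, W}" "U \<noteq> W"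
      using D(2) by (auto simp: card_2_iff)
    have sub: "vec.subspace U" "vec.subspace W"
      using D(3) nondegenerate_subspaceD(1) UW by blast+
    have "2 * m + vec.dim (perp B U) = 2 * n"
      using dim_perp[OF sub(1)] D(4)[of U] card_index UW by simp
    then have "vec.dim (perp B U) = 2 * m"
      using decomp(1) \<open>t = 2\<close> by simp
    \<comment> \<open>The two summands have equal dimension and are orthogonal, so the second is the
      full complement of the first and the decomposition is a splitting in the sense of
      \<open>split\<close>.\<close>
    then have perpU: "W = perp B U"
      using D(4,5) UW by (intro vec.subspace_dim_equal sub(2) subspace_perp) auto
    have "h x \<in> U \<union> perp B U" if "h \<in> H" "x \<in> U \<union> perp B U" for h x
    proof -
      have "(\<lambda>W. h ` W) ` D = D"
        using decomp(4) that(1) by (auto simp: decomposition_stabiliser_def)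
      then have "h ` V \<in> {U, W}" if "V \<in> D" for V
        using imageI[OF that, of "\<lambda>W. h ` W"] UW(1) by simp
      then have "h ` V \<subseteq> U \<union> W" if "V \<in> D" for V
        using that by fastforce
      then have "h ` U \<subseteq> U \<union> W" "h ` W \<subseteq> U \<union> W"
        using UW(1) by simp_all
      then show ?thesis
        using that(2) unfolding perpU by blast
    qed
    moreover have "m \<le> n - 1"
      using decomp(2) by simp
    ultimately have ?ND
      using D(3,4) UW m by (intro split[of U m]) auto
    then show ?thesis ..
  next
    case field
    then have "2 \<le> b"
      using prime_ge_2_nat by blast
    then show ?thesis
      using field_extension_case[OF field(2) _ field(3)] by simp
  next
    case form
    obtain U where U2: "nondegenerate_subspace B U" "vec.dim U = 2"
        "\<forall>x\<in>U \<union> perp B U. transvection x \<in> H"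
      using form_stabiliser_case[OF k n form] by blast
    then have U: "nondegenerate_subspace B U" "vec.dim U = 2 * 1"
        "\<And>x. x \<in> U \<union> perp B U \<Longrightarrow> transvection x \<in> H"
      by simp_all
    have "\<exists>s\<in>{1, -1}. \<Delta> = {\<phi> \<in> Q. gauss_sum \<phi> U = s * 2 ^ 1}"
      by (rule nondegenerate_word_if_transvections[OF U])
    then obtain s where "s \<in> {1, -1}" "\<Delta> = {\<phi> \<in> Q. gauss_sum \<phi> U = s * 2 ^ 1}"
      by blast
    with U n have ?ND
      by (intro exI[of _ U] exI[of _ "1 :: nat"] exI[of _ s]) simp
    then show ?thesis ..
  qed
qed

end

section \<open>From one codeword to the code and its parameters\<close>

theorem mainTheorem1:
  fixes B :: "bit ^ 'm \<Rightarrow> bit ^ 'm \<Rightarrow> bit"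
    and n k :: nat
    and \<epsilon> :: int
    and \<Gamma> :: "(bit ^ 'm \<Rightarrow> bit) set set"
    and \<Delta> :: "(bit ^ 'm \<Rightarrow> bit) set"
  assumes "1 \<le> n" and "CARD('m) = 2 * n"
    and "symplectic_form B"
    and "\<epsilon> \<in> {1, -1}"
    and "1 < k" and "k < card (forms_of_type B \<epsilon>) - 1"
    and "johnson_code (forms_of_type B \<epsilon>) k \<Gamma>"
    and "Sp_perms B \<epsilon> \<subseteq> code_aut_sym (forms_of_type B \<epsilon>) k \<Gamma>"
    and "strongly_incidence_transitive (forms_of_type B \<epsilon>) (Sp_perms B \<epsilon>) \<Gamma>"
    and "\<Delta> \<in> \<Gamma>" and "geometric_subgroup n B (codeword_stabiliser B \<Delta>)"
  shows
    "(\<exists>(d::nat) (\<epsilon>'::int). 2 \<le> n \<and> 1 \<le> d \<and> d \<le> n - 1 \<and> \<epsilon>' \<in> {1, -1} \<and>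
        (n, d, \<epsilon>) \<noteq> (2, 1, 1) \<and>
        int k = 2 ^ (n - 2) * (2 ^ d + \<epsilon>') * (2 ^ (n - d) + \<epsilon> * \<epsilon>') \<and>
        \<Gamma> = nondegenerate_code B d \<epsilon> \<epsilon>') \<or>
     (\<exists>(d::nat) (\<delta>::nat). 2 \<le> n \<and> 1 \<le> d \<and> d \<le> n \<and> \<delta> \<in> {0, 1} \<and> (d, \<epsilon>) \<noteq> (n, -1) \<and>
        int k = (if \<delta> = 0 then 2 ^ (n - 1) * (2 ^ (n - d) + \<epsilon>)
                 else 2 ^ (2 * n - d - 1) * (2 ^ d - 1)) \<and>
        \<Gamma> = isotropic_code B d \<epsilon> \<delta>)"
proof -
  let ?Q = "forms_of_type B \<epsilon>"
  interpret symplectic_space B n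
    using assms(2,3) by unfold_locales
  have \<Gamma>: "\<Gamma> \<subseteq> johnson_vertices ?Q k"
    using assms(7) by (simp add: johnson_code_def)
  then have \<Delta>: "\<Delta> \<subseteq> ?Q" "card \<Delta> = k" "finite \<Delta>"
    using assms(10) by (auto simp: johnson_vertices_def)
  have restr: "restrict (form_act g) ?Q ` \<Delta> = form_act g ` \<Delta>" for g
    using \<Delta>(1) by (intro image_cong) auto
  \<comment> \<open>One inclusion is transitivity on \<open>\<Gamma>\<close>, the other its
    invariance under the symplectic group. It remains to recognise \<open>\<Delta>\<close> as a word
    of one of the two families.\<close>
  have orbit: "\<Gamma> = {form_act g ` \<Delta> | g. g \<in> carrier (Sp B)}"
  proof
    show "\<Gamma> \<subseteq> {form_act g ` \<Delta> | g. g \<in> carrier (Sp B)}"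
    proof
      fix \<Delta>' assume "\<Delta>' \<in> \<Gamma>"
      then obtain p where "p \<in> Sp_perms B \<epsilon>" "p ` \<Delta> = \<Delta>'"
        using conjunct1[OF assms(9)[unfolded strongly_incidence_transitive_def]] assms(10) by meson
      moreover from this obtain g where "g \<in> carrier (Sp B)" "p = restrict (form_act g) ?Q"
        by (auto simp: Sp_perms_def)
      ultimately have "g \<in> carrier (Sp B)" "\<Delta>' = form_act g ` \<Delta>"
        using restr[of g] by (simp_all only:)
      then show "\<Delta>' \<in> {form_act g ` \<Delta> | g. g \<in> carrier (Sp B)}"
        by blast
    qed
    show "{form_act g ` \<Delta> | g. g \<in> carrier (Sp B)} \<subseteq> \<Gamma>"
    proof clarify
      fix g assume g: "g \<in> carrier (Sp B)"
      let ?p = "restrict (form_act g) ?Q"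
      have "?p \<in> Sp_perms B \<epsilon>"
        using g by (simp add: Sp_perms_def)
      then have "?p \<in> code_aut_sym ?Q k \<Gamma>"
        using assms(8) by blast
      then have "restrict ((`) ?p) (johnson_vertices ?Q k) ` \<Gamma> = \<Gamma>"
        by (simp add: code_aut_sym_def code_aut_def)
      moreover have "restrict ((`) ?p) (johnson_vertices ?Q k) \<Delta> = form_act g ` \<Delta>"
        by (simp only: restrict_apply'[OF subsetD[OF \<Gamma> assms(10)]] restr)
      ultimately show "form_act g ` \<Delta> \<in> \<Gamma>"
        using assms(10) by (metis imageI)
    qed
  qed
  have "\<Delta> \<noteq> ?Q"
    using assms(6) \<Delta>(2) by auto
  then have ne: "\<Delta> \<noteq> {}" "?Q - \<Delta> \<noteq> {}"
    using assms(5) \<Delta>(1,2) by auto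
  interpret transitive_codeword B n \<epsilon> \<Delta>
  proof
    fix \<phi> \<phi>' \<psi> \<psi>'
    assume *: "\<phi> \<in> \<Delta>" "\<phi>' \<in> \<Delta>" "\<psi> \<in> ?Q - \<Delta>" "\<psi>' \<in> ?Q - \<Delta>"
    have m: "(\<phi>, \<psi>) \<in> \<Delta> \<times> (?Q - \<Delta>)" "(\<phi>', \<psi>') \<in> \<Delta> \<times> (?Q - \<Delta>)"
      using * by simp_all
    have tr: "\<forall>(a, c)\<in>\<Delta> \<times> (?Q - \<Delta>). \<forall>(a', c')\<in>\<Delta> \<times> (?Q - \<Delta>).
        \<exists>g\<in>Sp_perms B \<epsilon>. g ` \<Delta> = \<Delta> \<and> g a = a' \<and> g c = c'"
      using conjunct2[OF assms(9)[unfolded strongly_incidence_transitive_def]] assms(10) by (rule bspec)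
    obtain p where p: "p \<in> Sp_perms B \<epsilon>" "p ` \<Delta> = \<Delta>" "p \<phi> = \<phi>'" "p \<psi> = \<psi>'"
      using bspec[OF bspec[OF tr m(1), unfolded prod.case] m(2), unfolded prod.case] by blast
    then obtain g where g: "g \<in> carrier (Sp B)" "p = restrict (form_act g) ?Q"
      by (auto simp: Sp_perms_def)
    show "\<exists>g\<in>codeword_stabiliser B \<Delta>. form_act g \<phi> = \<phi>' \<and> form_act g \<psi> = \<psi>'"
    proof (intro bexI conjI)
      show "form_act g \<phi> = \<phi>'" "form_act g \<psi> = \<psi>'"
        using p g * \<Delta>(1) by auto
      show "g \<in> codeword_stabiliser B \<Delta>"
        using p(2)[unfolded g(2) restr] g(1) by (simp add: codeword_stabiliser_def)
    qed
  qed (use \<Delta> ne in auto)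
  obtain \<phi>0 where \<phi>0: "\<phi>0 \<in> forms B"
    using ne(1) \<Delta>(1) forms_of_type_subset by blast
  have cardQ: "2 * int (card ?Q) = 2 ^ n * (2 ^ n + \<epsilon>)"
    using card_forms_of_type[OF \<phi>0 assms(4)] .
  \<comment> \<open>For \<open>n = 1\<close> there are \<open>2 + \<epsilon>\<close> forms, at most
    3, which leaves no room for \<open>k\<close>.\<close>
  have n: "2 \<le> n"
  proof (rule ccontr)
    assume "\<not> 2 \<le> n"
    then have "n = 1"
      using assms(1) by simp
    then have "int (card ?Q) = 2 + \<epsilon>"
      using cardQ by simp
    then show False
      using assms(4,5,6) by auto
  qed
  have kc: "1 < card \<Delta>" "card \<Delta> < card ?Q - 1"
    using assms(5,6) \<Delta>(2) by simp_all
  obtain j where "n = Suc (Suc j)"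
    using n by (metis add_2_eq_Suc le_Suc_ex)
  then have pow: "(2 :: int) ^ n = 4 * 2 ^ (n - 2)" "(2 :: int) ^ n = 2 * 2 ^ (n - 1)"
    by simp_all
  from geometric_stabiliser_cases[OF kc n assms(11)] show ?thesis
  proof
    assume "\<exists>U d s. nondegenerate_subspace B U \<and> vec.dim U = 2 * d \<and> 1 \<le> d \<and> d \<le> n - 1 \<and>
      s \<in> {1, -1} \<and> \<Delta> = {\<phi> \<in> ?Q. gauss_sum \<phi> U = s * 2 ^ d}"
    then obtain U d s where U: "nondegenerate_subspace B U" "vec.dim U = 2 * d"
      and d: "1 \<le> d" "d \<le> n - 1" and s: "s \<in> {1, -1}"
      and \<Delta>_eq: "\<Delta> = {\<phi> \<in> ?Q. gauss_sum \<phi> U = s * 2 ^ d}"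
      by blast
    have card4: "4 * int k = 2 ^ n * (2 ^ d + s) * (2 ^ (n - d) + \<epsilon> * s)"
      using card_nondegenerate_word[OF \<phi>0 U s assms(4)] \<Delta>(2) unfolding \<Delta>_eq[symmetric] by simp
    then have k_eq: "int k = 2 ^ (n - 2) * (2 ^ d + s) * (2 ^ (n - d) + \<epsilon> * s)"
      unfolding pow(1) by simp
    \<comment> \<open>In this case there are 10 forms and \<open>k\<close> is
      \<open>(2 + s) * (2 + s)\<close>, that is 9 or 1, and both values violate the bounds on
      \<open>k\<close>.\<close>
    have "(n, d, \<epsilon>) \<noteq> (2, 1, 1)"
    proof
      assume eq: "(n, d, \<epsilon>) = (2, 1, 1)"
      then have "int (card ?Q) = 10" "int k = (2 + s) * (2 + s)"
        using cardQ k_eq by simp_all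
      then show False
        using s assms(5,6) by auto
    qed
    moreover note k_eq
    moreover have "\<Gamma> = nondegenerate_code B d \<epsilon> s"
      unfolding nondegenerate_code_eq[OF U s] orbit by (simp only: \<Delta>_eq[symmetric])
    ultimately show ?thesis
      using n d s by blast
  next
    assume "\<exists>W. totally_isotropic B W \<and> W \<noteq> {0} \<and>
      ({\<phi> \<in> ?Q. W \<subseteq> Sing \<phi>} = \<Delta> \<or> {\<phi> \<in> ?Q. W \<subseteq> Sing \<phi>} = ?Q - \<Delta>)"
    then obtain W where W: "totally_isotropic B W" "W \<noteq> {0}"
      and Z: "{\<phi> \<in> ?Q. W \<subseteq> Sing \<phi>} = \<Delta> \<or> {\<phi> \<in> ?Q. W \<subseteq> Sing \<phi>} = ?Q - \<Delta>"
      by blast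
    define d where "d = vec.dim W"
    define Z where "Z = {\<phi> \<in> ?Q. W \<subseteq> Sing \<phi>}"
    have "0 \<in> W"
      using W(1) vec.subspace_0 by (auto simp: totally_isotropic_def)
    then have d: "1 \<le> d" "d \<le> n"
      using W dim_isotropic_le[OF W(1)] by (auto simp: d_def Suc_le_eq intro: Nat.gr0I)
    have "2 * n - d = n + (n - d)"
      using d by simp
    then have cardZ: "2 * int (card Z) = 2 ^ n * (2 ^ (n - d) + \<epsilon>)"
      using card_isotropic_word[OF \<phi>0 W(1) assms(4)] by (simp add: Z_def d_def power_add algebra_simps)
    have "Z \<noteq> {}" "finite Z"
      using Z ne by (auto simp: Z_def)
    \<comment> \<open>For \<open>d = n\<close> and \<open>\<epsilon> = -1\<close> the formula gives
      cardinality 0, but \<open>Z\<close> is either \<open>\<Delta>\<close> or its complement, both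
      nonempty.\<close>
    then have dn: "(d, \<epsilon>) \<noteq> (n, -1)"
      using cardZ by auto
    define \<delta> :: nat where "\<delta> = (if Z = \<Delta> then 0 else 1)"
    have \<delta>: "\<delta> \<in> {0, 1}"
      by (simp add: \<delta>_def)
    have \<Delta>_eq: "\<Delta> = {\<phi> \<in> ?Q. W \<subseteq> Sing \<phi> \<longleftrightarrow> \<delta> = 0}"
    proof (cases "Z = \<Delta>")
      case True
      then show ?thesis by (auto simp: \<delta>_def Z_def)
    next
      case False
      then have "Z = ?Q - \<Delta>"
        using Z by (auto simp: Z_def)
      then have "\<Delta> = ?Q - Z"
        using \<Delta>(1) by blast
      then show ?thesis
        using False by (auto simp: \<delta>_def Z_def)
    qed
    have "\<Gamma> = isotropic_code B d \<epsilon> \<delta>"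
      unfolding isotropic_code_eq[OF W(1) d_def[symmetric] d(1) \<delta>] orbit by (simp only: \<Delta>_eq[symmetric])
    moreover have "int k = (if \<delta> = 0 then 2 ^ (n - 1) * (2 ^ (n - d) + \<epsilon>)
        else 2 ^ (2 * n - d - 1) * (2 ^ d - 1))"
    proof (cases "Z = \<Delta>")
      case True
      then show ?thesis
        using cardZ \<Delta>(2) unfolding pow(2) by (simp add: \<delta>_def)
    next
      case False
      then have "Z = ?Q - \<Delta>"
        using Z by (auto simp: Z_def)
      then have "card Z = card ?Q - k" "k \<le> card ?Q"
        using \<Delta> card_mono[OF finite_forms_of_type \<Delta>(1)] by (simp_all add: card_Diff_subset)
      then have "2 * int k = 2 * int (card ?Q) - 2 * int (card Z)"
        by simp
      also have "\<dots> = 2 ^ n * (2 ^ n - 2 ^ (n - d))"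
        unfolding cardQ cardZ by (simp add: algebra_simps)
      also have "(2 :: int) ^ n - 2 ^ (n - d) = 2 ^ (n - d) * (2 ^ d - 1)"
        using d(2) by (simp add: algebra_simps flip: power_add)
      also have "2 ^ n * (2 ^ (n - d) * (2 ^ d - 1)) = (2 :: int) * (2 ^ (2 * n - d - 1) * (2 ^ d - 1))"
      proof -
        have "2 * n - d - 1 = (n - 1) + (n - d)"
          using d n by simp
        then show ?thesis
          by (simp add: pow(2) power_add)
      qed
      finally show ?thesis
        using False by (simp add: \<delta>_def)
    qed
    ultimately show ?thesis
      using n d dn \<delta> by blast
  qed
qed

end
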